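(* Let $F$, $\mathbf{K}_1$, $\mathbf{K}$, $\mathbf{D}(\mathbf{w})$, $\mathbf{H}(\mathbf{w})$, $\mathbf{Z}$, $\widehat{\mathbf{H}}(\mathbf{w})$ and the RFN algorithm be as in the context. Assume that $F$ is twice differentiable, $\gamma$-strongly convex and $L$-smooth, with $\gamma\mathbf{I}\preceq\mathbf{H}(\mathbf{w})\preceq L\mathbf{I}$ for all $\mathbf{w}\in\mathbb{R}^n$, that $\|\mathbf{D}(\mathbf{w})\|\le\lambda_1<\infty$ for all $\mathbf{w}\in\mathbb{R}^n$, and that there is a constant $M>0$ with $\|\mathbf{H}(\mathbf{w})-\mathbf{H}(\mathbf{w}')\|\le M\|\mathbf{w}-\mathbf{w}'\|$ for all $\mathbf{w},\mathbf{w}'\in\mathbb{R}^n$. Let $\mathbf{w}^*=\arg\min_{\mathbf{w}\in\mathbb{R}^n}F(\mathbf{w})$, $0<\delta<1$, and $$\zeta = \lambda+\lambda_1\left\|\frac{\mathbf{Z}\mathbf{Z}^\top+\mu\mathbf{I}}{n}\right\|+\lambda_1\left\|\frac{\mathbf{K}_1+\mu\mathbf{I}}{n}\right\| .$$ Suppose $\epsilon$ is chosen such that $\nu=\frac{\epsilon}{1-\epsilon}$ satisfies $0<\nu<1$, and $\rho$ is selected such that $\nu<\rho<1$. For each iteration $t=0,1,\dots,t_0$ define $$\epsilon_t=\rho^t\epsilon,\qquad \nu_t=\frac{\epsilon_t}{1-\epsilon_t},\qquad \eta_t=\frac{M}{2(1-\epsilon_t)\gamma}.$$ Assume that the initial point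 $\mathbf{w}_0$ satisfies $$\|\mathbf{w}_0-\mathbf{w}^*\|\le\frac{\rho-\nu_0}{\eta_0}.$$ Then the RFN algorithm with $\alpha_t=1$, where at iteration $t$ the matrix $\widehat{\mathbf{H}}(\mathbf{w}_t)$ is constructed by sampling $$m=\Omega\left(\frac{\zeta^2 n\|\mathbf{K}_1\|}{\epsilon_t^2\gamma^2}\log\frac{\mathrm{Tr}(\mathbf{K}_1)}{\|\mathbf{K}_1\|\,\delta}\right)$$ random features, achieves the following superlinear convergence: $$\|\mathbf{w}_t-\mathbf{w}^*\|\le\rho^t\|\mathbf{w}_{t-1}-\mathbf{w}^*\|,\qquad t=1,\dots,t_0,$$ with probability at least $1-t_0\delta$, where $t_0$ is the number of iterations.
   Context: $\|\cdot\|$ is the spectral norm of a matrix (Euclidean norm of a vector); $\mathbf{A}\preceq\mathbf{B}$ means $\mathbf{B}-\mathbf{A}$ is positive semi-definite; $\Omega(\cdot)$ is the Big Omega notation of complexity theory ($m=\Omega(q)$ means that $m$ is at least a suitable constant multiple of $q$). Data: points $\mathbf{x}_1,\dots,\mathbf{x}_n\in\mathbb{R}^d$, outputs $y_1,\dots,y_n$, parameters $\lambda,\mu>0$, and a loss $\ell(y,u)$ twice differentiable in its second argument $u$ ($\ell''$ is the second derivative in $u$). Kernel: $p$ is a probability density with support in $\mathbb{R}^d$, $\phi(\mathbf{x},\boldsymbol{\omega})$ is a real-valued feature map with $|\phi(\mathbf{x},\boldsymbol{\omega})|\le 1$ everywhere, $k_1(\mathbf{x},\mathbf{x}')=\int\phi(\mathbf{x},\boldsymbol{\omega})\phi(\mathbf{x}',\boldsymbol{\omega})p(\boldsymbol{\omega})d\boldsymbol{\omega}$,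 and $\mathbf{K}_1=[k_1(\mathbf{x}_i,\mathbf{x}_j)]_{i,j=1}^n$. The gram matrix is $\mathbf{K}=\mathbf{K}_1+\mu\mathbf{I}$. Objective: $F(\mathbf{w})=\frac1n\sum_{i=1}^n\ell\big(y_i,[\mathbf{K}\mathbf{w}]_i\big)+\frac{\lambda}{2}\mathbf{w}^\top\mathbf{K}\mathbf{w}$ for $\mathbf{w}\in\mathbb{R}^n$. $\mathbf{D}(\mathbf{w})$ is the $n\times n$ diagonal matrix with $[\mathbf{D}(\mathbf{w})]_{ii}=\ell''\big(y_i,[\mathbf{K}\mathbf{w}]_i\big)$, and the Hessian of $F$ is $\mathbf{H}(\mathbf{w})=\frac1n\mathbf{K}\mathbf{D}(\mathbf{w})\mathbf{K}+\lambda\mathbf{K}$. Random features: for $\boldsymbol{\omega}\in\mathbb{R}^d$, $\mathbf{z}(\boldsymbol{\omega})=[\phi(\mathbf{x}_1,\boldsymbol{\omega}),\dots,\phi(\mathbf{x}_n,\boldsymbol{\omega})]^\top$; for independent samples (random features) $\boldsymbol{\omega}_1,\dots,\boldsymbol{\omega}_m$ from $p$, $\mathbf{Z}=\frac{1}{\sqrt m}[\mathbf{z}(\boldsymbol{\omega}_1),\dots,\mathbf{z}(\boldsymbol{\omega}_m)]\in\mathbb{R}^{n\times m}$ and $$\widehat{\mathbf{H}}(\mathbf{w})=\frac1n(\mathbf{Z}\mathbf{Z}^\top+\mu\mathbf{I})\mathbf{D}(\mathbf{w})(\mathbf{Z}\mathbf{Z}^\top+\mu\mathbf{I})+\lambda(\mathbf{Z}\mathbf{Z}^\top+\mu\mathbf{I}).$$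 RFN (random-feature based Newton) algorithm: starting from $\mathbf{w}_0$, at each iteration $t=0,\dots,t_0-1$ sample $m$ independent random features from $p$ (a new $\mathbf{Z}$ at every iteration; here $m$ may depend on $t$), form $\widehat{\mathbf{H}}(\mathbf{w}_t)$, and set $\mathbf{w}_{t+1}=\mathbf{w}_t-\alpha_t[\widehat{\mathbf{H}}(\mathbf{w}_t)]^{-1}\nabla F(\mathbf{w}_t)$, where $\alpha_t$ is the step size (here $\alpha_t=1$).
   Formalization: The constant in Ω is not universal (that is false, e.g. as δ→1 or ‖K₁‖→0): for any δ₀<1 and R there is a constant depending only on these, valid whenever δ≤δ₀ and εμ≤R‖K₁‖; K₁=0, where the bound is 0/0, is excluded. The bound on m, where ζ is random, is assumed almost surely. *)

theory Defs
  imports "HOL-Probability.Probability" "Jordan_Normal_Form.Gauss_Jordan_Elimination"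
begin

text \<open>
  The numbers n of data points and d of coordinates are values, not types, so that a constant
  can be chosen uniformly in them.  Elements of the n-dimensional Euclidean space in which the
  optimisation takes place are \<open>real vec\<close>s in \<open>carrier_vec n\<close>; data points and random features,
  which only need a measurable structure, are extensional functions in \<open>space (leb d)\<close>.
  All indices start at 0.
\<close>

hide_const (open) Finite_Cartesian_Product.vec Finite_Cartesian_Product.mat
hide_type (open) Finite_Cartesian_Product.vec

definition leb :: "nat \<Rightarrow> (nat \<Rightarrow> real) measure" where
  "leb d = (\<Pi>\<^sub>M i\<in>{..<d}. lborel)"


section \<open>Vectors and matrices\<close>

definition vnorm :: "real vec \<Rightarrow> real" where
  "vnorm v = sqrt (scalar_prod v v)"

definition spec_norm :: "real mat \<Rightarrow> real" where
  "spec_norm A = Sup {vnorm (A *\<^sub>v v) | v. v \<in> carrier_vec (dim_col A) \<and> vnorm v \<le> 1}"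

definition psd :: "nat \<Rightarrow> real mat \<Rightarrow> bool" where
  "psd n A \<longleftrightarrow> A \<in> carrier_mat n n \<and> A\<^sup>T = A \<and>
     (\<forall>v\<in>carrier_vec n. 0 \<le> scalar_prod v (A *\<^sub>v v))"

definition loewner_le :: "nat \<Rightarrow> real mat \<Rightarrow> real mat \<Rightarrow> bool" where
  "loewner_le n A B \<longleftrightarrow> A \<in> carrier_mat n n \<and> B \<in> carrier_mat n n \<and> psd n (B - A)"

definition tr :: "real mat \<Rightarrow> real" where
  "tr A = (\<Sum>i<dim_row A. A $$ (i, i))"

text \<open>The inverse of a singular matrix is set to 0, as for the inverse on fields.\<close>

definition mat_inv :: "real mat \<Rightarrow> real mat" where
  "mat_inv A = (case mat_inverse A of Some B \<Rightarrow> B | None \<Rightarrow> 0\<^sub>m (dim_col A) (dim_row A))"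


section \<open>Differential calculus on \<open>carrier_vec n\<close>\<close>

text \<open>Frechet derivatives with respect to \<^const>\<open>vnorm\<close>.\<close>

definition has_gradient :: "nat \<Rightarrow> (real vec \<Rightarrow> real) \<Rightarrow> real vec \<Rightarrow> real vec \<Rightarrow> bool" where
  "has_gradient n f g w \<longleftrightarrow> g \<in> carrier_vec n \<and>
     (\<forall>e>0. \<exists>r>0. \<forall>h\<in>carrier_vec n. vnorm h < r \<longrightarrow>
        \<bar>f (w + h) - f w - scalar_prod g h\<bar> \<le> e * vnorm h)"

definition gradient :: "nat \<Rightarrow> (real vec \<Rightarrow> real) \<Rightarrow> real vec \<Rightarrow> real vec" where
  "gradient n f w = (THE g. has_gradient n f g w)"

definition has_jacobian :: "nat \<Rightarrow> (real vec \<Rightarrow> real vec) \<Rightarrow> real mat \<Rightarrow> real vec \<Rightarrow> bool" where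
  "has_jacobian n G J w \<longleftrightarrow> J \<in> carrier_mat n n \<and>
     (\<forall>e>0. \<exists>r>0. \<forall>h\<in>carrier_vec n. vnorm h < r \<longrightarrow>
        vnorm (G (w + h) - G w - J *\<^sub>v h) \<le> e * vnorm h)"

definition twice_differentiable :: "nat \<Rightarrow> (real vec \<Rightarrow> real) \<Rightarrow> bool" where
  "twice_differentiable n f \<longleftrightarrow>
     (\<forall>w\<in>carrier_vec n. (\<exists>g. has_gradient n f g w) \<and>
                         (\<exists>J. has_jacobian n (gradient n f) J w))"

definition strongly_convex :: "nat \<Rightarrow> real \<Rightarrow> (real vec \<Rightarrow> real) \<Rightarrow> bool" where
  "strongly_convex n \<gamma> f \<longleftrightarrow> 0 < \<gamma> \<and>
     (\<forall>w\<in>carrier_vec n. \<forall>w'\<in>carrier_vec n.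
        f w' \<ge> f w + scalar_prod (gradient n f w) (w' - w) + \<gamma> / 2 * (vnorm (w' - w))\<^sup>2)"

definition smooth :: "nat \<Rightarrow> real \<Rightarrow> (real vec \<Rightarrow> real) \<Rightarrow> bool" where
  "smooth n L f \<longleftrightarrow>
     (\<forall>w\<in>carrier_vec n. \<forall>w'\<in>carrier_vec n.
        vnorm (gradient n f w - gradient n f w') \<le> L * vnorm (w - w'))"


section \<open>Kernel problem, objective and Hessians\<close>

record kernel_problem =
  n_pts :: nat
  dim_x :: nat
  pt :: "nat \<Rightarrow> nat \<Rightarrow> real"                        \<comment> \<open>\<open>x\<^sub>i\<close>\<close>
  outp :: "nat \<Rightarrow> real"                             \<comment> \<open>\<open>y\<^sub>i\<close>\<close>
  loss :: "real \<Rightarrow> real \<Rightarrow> real"                     \<comment> \<open>\<open>\<ell>\<close>\<close>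
  feat :: "(nat \<Rightarrow> real) \<Rightarrow> (nat \<Rightarrow> real) \<Rightarrow> real"   \<comment> \<open>\<open>\<phi>\<close>\<close>
  dens :: "(nat \<Rightarrow> real) \<Rightarrow> real"                    \<comment> \<open>\<open>p\<close>\<close>
  reg :: real                                      \<comment> \<open>\<open>\<lambda>\<close>\<close>
  ridge :: real                                    \<comment> \<open>\<open>\<mu>\<close>\<close>

definition feature_law :: "kernel_problem \<Rightarrow> (nat \<Rightarrow> real) measure" where
  "feature_law P = density (leb (dim_x P)) (\<lambda>\<omega>. ennreal (dens P \<omega>))"

definition valid_problem :: "kernel_problem \<Rightarrow> bool" where
  "valid_problem P \<longleftrightarrow>
     n_pts P \<ge> 1 \<and> reg P > 0 \<and> ridge P > 0 \<and>
     (\<forall>i<n_pts P. pt P i \<in> space (leb (dim_x P))) \<and>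
     (\<forall>y u. loss P y differentiable (at u) \<and> deriv (loss P y) differentiable (at u)) \<and>
     dens P \<in> borel_measurable (leb (dim_x P)) \<and>
     (\<forall>\<omega>\<in>space (leb (dim_x P)). 0 \<le> dens P \<omega>) \<and>
     prob_space (feature_law P) \<and>
     (\<forall>x\<in>space (leb (dim_x P)). feat P x \<in> borel_measurable (leb (dim_x P))) \<and>
     (\<forall>x\<in>space (leb (dim_x P)). \<forall>\<omega>\<in>space (leb (dim_x P)). \<bar>feat P x \<omega>\<bar> \<le> 1)"

definition kern :: "kernel_problem \<Rightarrow> (nat \<Rightarrow> real) \<Rightarrow> (nat \<Rightarrow> real) \<Rightarrow> real" where
  "kern P x x' = (LINT \<omega>|leb (dim_x P). feat P x \<omega> * feat P x' \<omega> * dens P \<omega>)"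

definition gram1 :: "kernel_problem \<Rightarrow> real mat" where
  "gram1 P = mat (n_pts P) (n_pts P) (\<lambda>(i, j). kern P (pt P i) (pt P j))"

definition add_ridge :: "kernel_problem \<Rightarrow> real mat \<Rightarrow> real mat" where
  "add_ridge P A = A + ridge P \<cdot>\<^sub>m 1\<^sub>m (n_pts P)"

definition gram :: "kernel_problem \<Rightarrow> real mat" where
  "gram P = add_ridge P (gram1 P)"

definition objective :: "kernel_problem \<Rightarrow> real vec \<Rightarrow> real" where
  "objective P w =
     (1 / real (n_pts P)) * (\<Sum>i<n_pts P. loss P (outp P i) ((gram P *\<^sub>v w) $ i))
     + reg P / 2 * scalar_prod w (gram P *\<^sub>v w)"

definition loss_diag :: "kernel_problem \<Rightarrow> real vec \<Rightarrow> real mat" where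
  "loss_diag P w = mat (n_pts P) (n_pts P)
     (\<lambda>(i, j). if i = j then deriv (deriv (loss P (outp P i))) ((gram P *\<^sub>v w) $ i) else 0)"

text \<open>
  With \<open>A = gram P\<close> the following is the Hessian H(w) of the objective; with
  \<open>A = add_ridge P (Z * Z\<^sup>T)\<close> it is its random feature approximation.
\<close>

definition hess_with :: "kernel_problem \<Rightarrow> real mat \<Rightarrow> real vec \<Rightarrow> real mat" where
  "hess_with P A w =
     (1 / real (n_pts P)) \<cdot>\<^sub>m (A * loss_diag P w * A) + reg P \<cdot>\<^sub>m A"

definition hess :: "kernel_problem \<Rightarrow> real vec \<Rightarrow> real mat" where
  "hess P = hess_with P (gram P)"


section \<open>Random features and the Newton iteration\<close>

text \<open>
  A sample \<open>s\<close> assigns to every iteration \<open>t < t0\<close> and every \<open>j < m t\<close> a random feature \<open>s (t, j)\<close>;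
  all of them are independent with density \<^const>\<open>dens\<close>.
\<close>

definition samples ::
  "kernel_problem \<Rightarrow> nat \<Rightarrow> (nat \<Rightarrow> nat) \<Rightarrow> (nat \<times> nat \<Rightarrow> nat \<Rightarrow> real) measure" where
  "samples P t0 m = (\<Pi>\<^sub>M q \<in> {(t, j). t < t0 \<and> j < m t}. feature_law P)"

definition feat_mat ::
  "kernel_problem \<Rightarrow> (nat \<Rightarrow> nat) \<Rightarrow> (nat \<times> nat \<Rightarrow> nat \<Rightarrow> real) \<Rightarrow> nat \<Rightarrow> real mat" where
  "feat_mat P m s t =
     mat (n_pts P) (m t) (\<lambda>(i, j). feat P (pt P i) (s (t, j)) / sqrt (real (m t)))"

definition gram_hat ::
  "kernel_problem \<Rightarrow> (nat \<Rightarrow> nat) \<Rightarrow> (nat \<times> nat \<Rightarrow> nat \<Rightarrow> real) \<Rightarrow> nat \<Rightarrow> real mat" where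
  "gram_hat P m s t = add_ridge P (feat_mat P m s t * (feat_mat P m s t)\<^sup>T)"

definition hess_hat ::
  "kernel_problem \<Rightarrow> (nat \<Rightarrow> nat) \<Rightarrow> (nat \<times> nat \<Rightarrow> nat \<Rightarrow> real) \<Rightarrow> nat \<Rightarrow> real vec \<Rightarrow> real mat" where
  "hess_hat P m s t = hess_with P (gram_hat P m s t)"

fun rfn :: "kernel_problem \<Rightarrow> (nat \<Rightarrow> nat) \<Rightarrow> (nat \<Rightarrow> real) \<Rightarrow> real vec \<Rightarrow>
    (nat \<times> nat \<Rightarrow> nat \<Rightarrow> real) \<Rightarrow> nat \<Rightarrow> real vec" where
  "rfn P m \<alpha> w0 s 0 = w0"
| "rfn P m \<alpha> w0 s (Suc t) =
     rfn P m \<alpha> w0 s t -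
       \<alpha> t \<cdot>\<^sub>v (mat_inv (hess_hat P m s t (rfn P m \<alpha> w0 s t)) *\<^sub>v
                gradient (n_pts P) (objective P) (rfn P m \<alpha> w0 s t))"

definition zeta ::
  "kernel_problem \<Rightarrow> real \<Rightarrow> (nat \<Rightarrow> nat) \<Rightarrow> (nat \<times> nat \<Rightarrow> nat \<Rightarrow> real) \<Rightarrow> nat \<Rightarrow> real" where
  "zeta P lam1 m s t = reg P
     + lam1 * spec_norm ((1 / real (n_pts P)) \<cdot>\<^sub>m gram_hat P m s t)
     + lam1 * spec_norm ((1 / real (n_pts P)) \<cdot>\<^sub>m gram P)"

definition eps_seq :: "real \<Rightarrow> real \<Rightarrow> nat \<Rightarrow> real" where
  "eps_seq \<epsilon> \<rho> t = \<rho> ^ t * \<epsilon>"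

definition nu_seq :: "real \<Rightarrow> real \<Rightarrow> nat \<Rightarrow> real" where
  "nu_seq \<epsilon> \<rho> t = eps_seq \<epsilon> \<rho> t / (1 - eps_seq \<epsilon> \<rho> t)"

definition eta_seq :: "real \<Rightarrow> real \<Rightarrow> real \<Rightarrow> real \<Rightarrow> nat \<Rightarrow> real" where
  "eta_seq M \<gamma> \<epsilon> \<rho> t = M / (2 * (1 - eps_seq \<epsilon> \<rho> t) * \<gamma>)"

text \<open>
  The expression inside the Omega bound on the number of features.  It is itself random,
  because \<^const>\<open>zeta\<close> depends on the features drawn in iteration \<open>t\<close>.
\<close>

definition sample_rate :: "kernel_problem \<Rightarrow> real \<Rightarrow> real \<Rightarrow> real \<Rightarrow> real \<Rightarrow> real \<Rightarrow>
    (nat \<Rightarrow> nat) \<Rightarrow> (nat \<times> nat \<Rightarrow> nat \<Rightarrow> real) \<Rightarrow> nat \<Rightarrow> real" where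
  "sample_rate P lam1 \<gamma> \<epsilon> \<rho> \<delta> m s t =
     (zeta P lam1 m s t)\<^sup>2 * real (n_pts P) * spec_norm (gram1 P) / ((eps_seq \<epsilon> \<rho> t)\<^sup>2 * \<gamma>\<^sup>2)
     * ln (tr (gram1 P) / (spec_norm (gram1 P) * \<delta>))"

text \<open>
  How an assumption \<open>m t \<ge> C * sample_rate \<dots>\<close> with a suitable constant C has to be read: a C that
  serves all problems exists once bounds \<open>\<delta> \<le> \<delta>\<^sub>0 < 1\<close> and \<open>\<epsilon> * \<mu> \<le> R * \<parallel>K\<^sub>1\<parallel>\<close> are fixed, and it then
  depends on \<open>\<delta>\<^sub>0\<close> and \<open>R\<close> only.  Neither bound can be dropped.  Let n = 1, \<open>\<ell>\<close> = 0, \<open>\<mu>\<close> = 1,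
  \<open>\<epsilon>\<close> = 0.1, \<open>\<rho>\<close> = 0.2, and let the feature map be 1 with probability \<open>\<kappa>\<close> and 0 otherwise, so that
  \<open>\<parallel>K\<^sub>1\<parallel> = \<kappa>\<close>.  For \<open>\<kappa>\<close> = 1/2 and \<open>\<delta>\<close> close to 1 the logarithm is so small that any C admits m = 1,
  but a step with one feature is never good enough.  For \<open>\<delta> = \<kappa> / 2\<close> and small \<open>\<kappa>\<close> any C admits
  m = 1, but the step fails if the feature is 1, which has probability \<open>\<kappa> > \<delta>\<close>.
\<close>

end

theory Submission
  imports Defs "Jordan_Normal_Form.Determinant"
begin

text \<open>
  Write \<open>K\<^sub>1\<close> for the Gram matrix and \<open>\<kappa>\<close> for its spectral norm.  If the sampled matrix satisfies
  \<open>\<parallel>ZZ\<^sup>T - K\<^sub>1\<parallel> \<le> s\<close>, then the approximate Hessian \<open>H'\<close> satisfies \<open>\<parallel>H'(w) - H(w)\<parallel> \<le> \<zeta> s\<close> for all \<open>w\<close>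
  simultaneously, and if moreover
  \<open>\<zeta> s \<le> \<epsilon>\<^sub>t \<gamma>\<close>, one Newton step maps the error \<open>e\<close> to at most \<open>\<nu>\<^sub>t e + \<eta>\<^sub>t e\<^sup>2\<close>.  Hence everything reduces
  to a concentration bound whose dimensional factor is \<open>tr K\<^sub>1 / \<kappa>\<close>.

  For this bound let \<open>Y\<close> be the sum over the \<open>m\<close> features of \<open>zz\<^sup>T - K\<^sub>1\<close>.  Exchanging one feature with an
  independent copy and applying a mean value inequality for the trace of odd powers gives
  \<open>E tr Y\<^sup>2\<^sup>p \<le> (2p - 1) n E tr ((Y + 2 m K\<^sub>1) Y\<^sup>2\<^sup>p\<^sup>-\<^sup>2)\<close>; the right-hand side is linear in \<open>Y\<close> because
  \<open>zz\<^sup>T\<close> has rank one.  Iterating down to \<open>E tr Y\<^sup>2\<close>, which is at most a multiple of \<open>tr K\<^sub>1\<close>, and using Markov's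
  inequality with \<open>p \<approx> ln (tr K\<^sub>1 / (\<kappa> \<delta>))\<close> yields the claim.
\<close>


text \<open>Polynomial moments are used so that every random quantity in the concentration bound is
  a polynomial in matrix entries: boundedness and integrability are immediate, and the Frobenius
  inner product replaces eigenvalues. The term linear in \<open>Y\<close> leaves an odd moment on
  the right; by AM-GM it costs half of the even moment being estimated, which is absorbed. In the
  other term \<open>K\<^sub>1\<close> is replaced by \<kappa> times the identity at every level but
  the last, so the trace is paid only once. The tail obtained is sub-Gaussian only while the radius
  \<open>s\<close> is at most a multiple of \<kappa>. Coercivity forces this: testing the Hessian on
  a unit vector gives \<gamma> \<le> \<zeta> (\<kappa> + \<mu>), so \<epsilon>_t \<gamma> / \<zeta>
  is at most \<epsilon> (\<kappa> + \<mu>), and the hypothesis with \<open>R\<close> bounds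
  \<epsilon> \<mu> by a multiple of \<kappa>. The bound \<open>\<delta>\<^sub>0\<close> keeps the
  logarithm away from 0, so that rounding \<open>p\<close> up to an integer costs only a constant
  factor.\<close>

hide_const (open) Determinants.det

no_notation Inner_Product.real_inner_class.inner (infix "\<bullet>" 70)
no_notation Finite_Cartesian_Product.vec_nth (infixl "$" 90)

declare minus_carrier_mat [simp]

section \<open>Euclidean vectors and traces\<close>

lemma vnorm_nonneg [simp]: "0 \<le> vnorm v"
  by (simp add: vnorm_def scalar_prod_def sum_nonneg)

lemma vnorm_sq: "(vnorm v)\<^sup>2 = v \<bullet> v"
  by (simp add: vnorm_def scalar_prod_def sum_nonneg)

lemma vnorm_eq_L2: "v \<in> carrier_vec n \<Longrightarrow> vnorm v = L2_set (\<lambda>i. v $ i) {..<n}"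
  by (simp add: vnorm_def L2_set_def scalar_prod_def power2_eq_square atLeast0LessThan)

lemma abs_scalar_prod_le:
  assumes "v \<in> carrier_vec n" "w \<in> carrier_vec n"
  shows "\<bar>v \<bullet> w\<bar> \<le> vnorm v * vnorm w"
proof -
  have "\<bar>v \<bullet> w\<bar> \<le> (\<Sum>i<n. \<bar>v $ i\<bar> * \<bar>w $ i\<bar>)"
    using assms by (auto simp: scalar_prod_def atLeast0LessThan simp flip: abs_mult)
  also have "\<dots> \<le> vnorm v * vnorm w"
    unfolding vnorm_eq_L2[OF assms(1)] vnorm_eq_L2[OF assms(2)] by (rule L2_set_mult_ineq)
  finally show ?thesis .
qed

lemma vnorm_add_le:
  assumes "v \<in> carrier_vec n" "w \<in> carrier_vec n"
  shows "vnorm (v + w) \<le> vnorm v + vnorm w"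
proof -
  have "vnorm (v + w) = L2_set (\<lambda>i. v $ i + w $ i) {..<n}"
    using assms by (subst vnorm_eq_L2[of _ n]) (auto intro: L2_set_cong)
  then show ?thesis
    using L2_set_triangle_ineq[of "\<lambda>i. v $ i" "\<lambda>i. w $ i" "{..<n}"] assms
    by (simp add: vnorm_eq_L2)
qed

lemma vnorm_smult: "vnorm (c \<cdot>\<^sub>v v) = \<bar>c\<bar> * vnorm v"
proof -
  have "(c \<cdot>\<^sub>v v) \<bullet> (c \<cdot>\<^sub>v v) = c\<^sup>2 * (v \<bullet> v)"
    by (simp add: scalar_prod_def sum_distrib_left power2_eq_square mult_ac)
  then show ?thesis by (simp add: vnorm_def real_sqrt_mult)
qed

lemma vnorm_uminus: "vnorm (- v) = vnorm v"
  by (simp add: vnorm_def scalar_prod_def)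

lemma vnorm_minus_le:
  assumes "v \<in> carrier_vec n" "w \<in> carrier_vec n"
  shows "vnorm (v - w) \<le> vnorm v + vnorm w"
  using vnorm_add_le[of v n "- w"] assms by (simp add: minus_add_uminus_vec vnorm_uminus)

lemma vnorm_eq_0_iff: "v \<in> carrier_vec n \<Longrightarrow> vnorm v = 0 \<longleftrightarrow> v = 0\<^sub>v n"
  by (auto simp: vnorm_eq_L2 L2_set_eq_0_iff)

lemma vnorm_zero [simp]: "vnorm (0\<^sub>v n) = 0"
  by (simp add: vnorm_def scalar_prod_def)

lemma scalar_prod_mult_mat_vec:
  assumes "A \<in> carrier_mat n n" "v \<in> carrier_vec n" "w \<in> carrier_vec n"
  shows "v \<bullet> (A *\<^sub>v w) = (\<Sum>i<n. \<Sum>j<n. v $ i * A $$ (i, j) * w $ j)"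
  using assms by (auto simp: scalar_prod_def atLeast0LessThan sum_distrib_left mult_ac intro!: sum.cong)

lemma scalar_prod_mult_mat_vec_sym:
  fixes A :: "real mat"
  assumes "A \<in> carrier_mat n n" "A\<^sup>T = A" "v \<in> carrier_vec n" "w \<in> carrier_vec n"
  shows "(A *\<^sub>v v) \<bullet> w = v \<bullet> (A *\<^sub>v w)"
  using transpose_vec_mult_scalar[of A n n w v] assms by simp

lemma tr_mult:
  assumes "A \<in> carrier_mat n n" "B \<in> carrier_mat n n"
  shows "tr (A * B) = (\<Sum>i<n. \<Sum>j<n. A $$ (i, j) * B $$ (j, i))"
  using assms by (auto simp: tr_def scalar_prod_def atLeast0LessThan intro!: sum.cong)

lemma tr_mult_commute:
  assumes "A \<in> carrier_mat n n" "B \<in> carrier_mat n n"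
  shows "tr (A * B) = tr (B * A)"
  unfolding tr_mult[OF assms] tr_mult[OF assms(2,1)]
  by (subst sum.swap) (simp add: mult.commute)

lemma tr_add:
  assumes "A \<in> carrier_mat n n" "B \<in> carrier_mat n n"
  shows "tr (A + B) = tr A + tr B"
  using assms by (simp add: tr_def sum.distrib)

lemma tr_minus:
  assumes "A \<in> carrier_mat n n" "B \<in> carrier_mat n n"
  shows "tr (A - B) = tr A - tr B"
  using assms by (simp add: tr_def sum_subtractf)

lemma tr_smult: "A \<in> carrier_mat n n \<Longrightarrow> tr (c \<cdot>\<^sub>m A) = c * tr A"
  by (simp add: tr_def sum_distrib_left)

lemma tr_transpose_mult:
  assumes "A \<in> carrier_mat n n" "B \<in> carrier_mat n n"
  shows "tr (A\<^sup>T * B) = (\<Sum>i<n. \<Sum>j<n. A $$ (i, j) * B $$ (i, j))"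
proof -
  have "A\<^sup>T \<in> carrier_mat n n" using assms by simp
  from tr_mult[OF this assms(2)] show ?thesis
    using assms by (simp, subst sum.swap, auto intro!: sum.cong)
qed

text \<open>AM-GM for the Frobenius inner product. It serves twice: for mixed words in two matrices
  it gives convexity in the exponent, and for powers of one matrix it absorbs odd moments.\<close>

lemma two_tr_transpose_mult_le:
  assumes "A \<in> carrier_mat n n" "B \<in> carrier_mat n n"
  shows "2 * tr (A\<^sup>T * B) \<le> tr (A\<^sup>T * A) + tr (B\<^sup>T * B)"
  unfolding tr_transpose_mult[OF assms] tr_transpose_mult[OF assms(1,1)]
    tr_transpose_mult[OF assms(2,2)] sum_distrib_left sum.distrib[symmetric]
proof (intro sum_mono)
  fix i j
  have "0 \<le> (A $$ (i, j) - B $$ (i, j))\<^sup>2" by simp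
  then show "2 * (A $$ (i, j) * B $$ (i, j)) \<le> A $$ (i, j) * A $$ (i, j) + B $$ (i, j) * B $$ (i, j)"
    by (simp add: power2_eq_square algebra_simps)
qed

lemma pow_mat_add:
  fixes A :: "real mat"
  assumes "A \<in> carrier_mat n n"
  shows "A ^\<^sub>m (k + l) = A ^\<^sub>m k * A ^\<^sub>m l"
proof (induction l)
  case (Suc l)
  have "A ^\<^sub>m (k + Suc l) = A ^\<^sub>m k * A ^\<^sub>m l * A"
    using Suc by simp
  also have "\<dots> = A ^\<^sub>m k * (A ^\<^sub>m l * A)"
    using assms by (intro assoc_mult_mat[of _ n n _ n _ n]) auto
  finally show ?case by simp
qed (use assms in auto)

lemma pow_mat_carrier [simp]: "A \<in> carrier_mat n n \<Longrightarrow> A ^\<^sub>m k \<in> carrier_mat n n"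
  by (rule pow_carrier_mat)

lemma mult_carrier_square [simp]:
  "A \<in> carrier_mat n n \<Longrightarrow> B \<in> carrier_mat n n \<Longrightarrow> A * B \<in> carrier_mat n n"
  by (rule mult_carrier_mat)

lemma pow_mat_sym:
  fixes A :: "real mat"
  assumes "A \<in> carrier_mat n n" "A\<^sup>T = A"
  shows "(A ^\<^sub>m k)\<^sup>T = A ^\<^sub>m k"
proof (induction k)
  case (Suc k)
  have "(A ^\<^sub>m Suc k)\<^sup>T = A * A ^\<^sub>m k"
    using assms Suc by (simp add: transpose_mult[of _ n n _ n])
  also have "\<dots> = A ^\<^sub>m (1 + k)"
    using assms by (subst pow_mat_add[of _ n]) auto
  finally show ?case by simp
qed simp


section \<open>A mean value inequality for traces of odd powers\<close>

text \<open>The increments of a discretely convex sequence increase, so its first \<open>i\<close>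
  increments sum to at most its last \<open>i\<close>.\<close>

lemma midpoint_convex_reflect:
  fixes g :: "nat \<Rightarrow> real"
  assumes conv: "\<And>i. Suc i < N \<Longrightarrow> 2 * g (Suc i) \<le> g i + g (Suc (Suc i))" and "i \<le> N"
  shows "g i + g (N - i) \<le> g 0 + g N"
proof -
  have mono: "g (Suc i) - g i \<le> g (Suc j) - g j" if "i \<le> j" "j < N" for i j
    using that
  proof (induction j rule: dec_induct)
    case (step j)
    then show ?case using conv[of j] by simp
  qed simp
  have "g i - g 0 = (\<Sum>j<i. g (Suc j) - g j)"
    by (simp add: sum_lessThan_telescope)
  also have "\<dots> \<le> (\<Sum>j<i. g (Suc (N - i + j)) - g (N - i + j))"
    using \<open>i \<le> N\<close> by (intro sum_mono mono) auto
  also have "\<dots> = g N - g (N - i)"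
    using sum_lessThan_telescope[of "\<lambda>j. g (N - i + j)" i] \<open>i \<le> N\<close> by simp
  finally show ?thesis by simp
qed

text \<open>Convexity is available only between even indices. The even subsequence is convex in the
  ordinary sense and is handled by reflection; an odd index lies midway between its even neighbours.
  Pairing k with 2N - k then bounds every pair by the two end values.\<close>

lemma midpoint_convex_sum:
  fixes f :: "nat \<Rightarrow> real"
  assumes mid: "\<And>a b. a \<le> N \<Longrightarrow> b \<le> N \<Longrightarrow> 2 * f (a + b) \<le> f (2 * a) + f (2 * b)"
  shows "(\<Sum>k\<le>2 * N. f k) \<le> real (2 * N + 1) / 2 * (f 0 + f (2 * N))"
proof -
  have even: "f (2 * a) + f (2 * (N - a)) \<le> f 0 + f (2 * N)" if "a \<le> N" for a
  proof -
    have "2 * f (2 * Suc i) \<le> f (2 * i) + f (2 * Suc (Suc i))" if "Suc i < N" for i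
    proof -
      have "i + Suc (Suc i) = 2 * Suc i" by simp
      moreover have "2 * f (i + Suc (Suc i)) \<le> f (2 * i) + f (2 * Suc (Suc i))"
        by (rule mid) (use that in auto)
      ultimately show ?thesis by (simp only:)
    qed
    from midpoint_convex_reflect[of N "\<lambda>i. f (2 * i)" a, OF this \<open>a \<le> N\<close>] show ?thesis by simp
  qed
  have all: "f k + f (2 * N - k) \<le> f 0 + f (2 * N)" if "k \<le> 2 * N" for k
  proof (cases "even k")
    case True
    then obtain a where "k = 2 * a" by auto
    then show ?thesis using even[of a] that by (simp add: diff_mult_distrib2)
  next
    case False
    then obtain a where k: "k = 2 * a + 1" using oddE by blast
    then have a: "Suc a \<le> N" using that by simp
    have "2 * f k \<le> f (2 * a) + f (2 * Suc a)"
    proof -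
      have "a + Suc a = k" using k by simp
      moreover have "2 * f (a + Suc a) \<le> f (2 * a) + f (2 * Suc a)"
        by (rule mid) (use a in auto)
      ultimately show ?thesis by (simp only:)
    qed
    moreover have "2 * N - k = (N - Suc a) + (N - a)" using k a by simp
    then have "2 * f (2 * N - k) \<le> f (2 * (N - Suc a)) + f (2 * (N - a))"
      using mid[of "N - Suc a" "N - a"] a by simp
    ultimately show ?thesis using even[of a] even[of "Suc a"] a by simp
  qed
  have "2 * (\<Sum>k\<le>2 * N. f k) = (\<Sum>k\<le>2 * N. f k) + (\<Sum>k\<le>2 * N. f (2 * N - k))"
    using sum.nat_diff_reindex[of f "Suc (2 * N)"] by (simp add: lessThan_Suc_atMost)
  also have "\<dots> = (\<Sum>k\<le>2 * N. f k + f (2 * N - k))"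
    by (simp add: sum.distrib)
  also have "\<dots> \<le> (\<Sum>k\<le>2 * N. f 0 + f (2 * N))"
    by (intro sum_mono all) auto
  finally show ?thesis by (simp add: field_simps)
qed

text \<open>AM-GM in the Frobenius inner product for the words A^a C B^b. By cyclicity of the trace
  the inner product of two such words depends only on the sums of their exponents; the even
  exponents on the right are those of squared norms.\<close>

lemma tr_powers_midpoint:
  fixes A B C :: "real mat"
  assumes A: "A \<in> carrier_mat n n" "A\<^sup>T = A" and B: "B \<in> carrier_mat n n" "B\<^sup>T = B"
    and C: "C \<in> carrier_mat n n" "C\<^sup>T = C"
  shows "2 * tr (C * A ^\<^sub>m (a + a') * C * B ^\<^sub>m (b + b'))
    \<le> tr (C * A ^\<^sub>m (2 * a) * C * B ^\<^sub>m (2 * b)) + tr (C * A ^\<^sub>m (2 * a') * C * B ^\<^sub>m (2 * b'))"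
proof -
  define U where "U a b = A ^\<^sub>m a * C * B ^\<^sub>m b" for a b
  have Uc: "U a b \<in> carrier_mat n n" for a b unfolding U_def using A B C by auto
  have U: "tr ((U a b)\<^sup>T * U a' b') = tr (C * A ^\<^sub>m (a + a') * C * B ^\<^sub>m (b + b'))" for a b a' b'
  proof -
    have "(U a b)\<^sup>T = B ^\<^sub>m b * (C * A ^\<^sub>m a)"
      unfolding U_def using A B C
      by (simp add: transpose_mult[of _ n n _ n] pow_mat_sym[of _ n])
    then have "(U a b)\<^sup>T * U a' b' = B ^\<^sub>m b * (C * A ^\<^sub>m a * U a' b')"
      using A B C Uc by (simp add: assoc_mult_mat[of _ n n _ n _ n])
    then have "tr ((U a b)\<^sup>T * U a' b') = tr (C * A ^\<^sub>m a * U a' b' * B ^\<^sub>m b)"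
      using A B C Uc by (simp add: tr_mult_commute[of _ n])
    also have "C * A ^\<^sub>m a * U a' b' * B ^\<^sub>m b = C * A ^\<^sub>m (a + a') * C * B ^\<^sub>m (b + b')"
      unfolding U_def add.commute[of b b'] using A B C
      by (simp add: assoc_mult_mat[of _ n n _ n _ n] pow_mat_add[of _ n])
    finally show ?thesis .
  qed
  show ?thesis
    using two_tr_transpose_mult_le[OF Uc Uc, of a b a' b'] by (simp only: U flip: mult_2)
qed

text \<open>The factors \<open>B\<close> are changed into \<open>A\<close> one at a time, from the
  left: \<open>h k\<close> below belongs to the hybrid word with \<open>k\<close> factors
  \<open>A\<close> followed by \<open>Suc q - k\<close> factors \<open>B\<close>.\<close>

lemma pow_mat_diff_telescope:
  fixes A B :: "real mat"
  assumes A: "A \<in> carrier_mat n n" and B: "B \<in> carrier_mat n n" and C: "C \<in> carrier_mat n n"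
  shows "tr (C * (A ^\<^sub>m Suc q - B ^\<^sub>m Suc q)) = (\<Sum>k\<le>q. tr (C * A ^\<^sub>m k * (A - B) * B ^\<^sub>m (q - k)))"
proof -
  define h where "h k = tr (C * A ^\<^sub>m k * B ^\<^sub>m (Suc q - k))" for k
  have "tr (C * A ^\<^sub>m k * (A - B) * B ^\<^sub>m (q - k)) = h (Suc k) - h k" if "k \<le> q" for k
  proof -
    have "C * A ^\<^sub>m k * (A - B) * B ^\<^sub>m (q - k)
      = C * A ^\<^sub>m k * A * B ^\<^sub>m (q - k) - C * A ^\<^sub>m k * B * B ^\<^sub>m (q - k)"
      using A B C by (simp add: mult_minus_distrib_mat[of _ n n _ n] minus_mult_distrib_mat[of _ n n _ _ n])
    moreover have "C * A ^\<^sub>m k * A * B ^\<^sub>m (q - k) = C * A ^\<^sub>m Suc k * B ^\<^sub>m (Suc q - Suc k)"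
      using A B C by (simp add: assoc_mult_mat[of _ n n _ n _ n])
    moreover have "C * A ^\<^sub>m k * B * B ^\<^sub>m (q - k) = C * A ^\<^sub>m k * B ^\<^sub>m (Suc q - k)"
    proof -
      have "B * B ^\<^sub>m (q - k) = B ^\<^sub>m (1 + (q - k))"
        using B by (subst pow_mat_add[of _ n]) auto
      also have "1 + (q - k) = Suc q - k" using that by simp
      finally show ?thesis
        using A B C by (subst assoc_mult_mat[of _ n n _ n _ n]) auto
    qed
    ultimately show ?thesis
      unfolding h_def using A B C by (simp add: tr_minus[of _ n])
  qed
  then have "(\<Sum>k\<le>q. tr (C * A ^\<^sub>m k * (A - B) * B ^\<^sub>m (q - k))) = (\<Sum>k<Suc q. h (Suc k) - h k)"
    by (simp add: lessThan_Suc_atMost)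
  also have "\<dots> = h (Suc q) - h 0" by (rule sum_lessThan_telescope)
  also have "\<dots> = tr (C * (A ^\<^sub>m Suc q - B ^\<^sub>m Suc q))"
    unfolding h_def using A B C
    by (simp add: tr_minus[of _ n] mult_minus_distrib_mat[of _ n n _ n])
  finally show ?thesis by simp
qed

text \<open>Telescoping gives 2N + 1 terms tr (C A^k C B^(2N-k)), and convexity in k bounds their
  mean by the mean of the two end terms. The exponent is odd so that the end terms contain even
  powers, which makes them monotone in \<open>C * C\<close>.\<close>

lemma tr_mean_value:
  fixes A B :: "real mat"
  assumes A: "A \<in> carrier_mat n n" "A\<^sup>T = A" and B: "B \<in> carrier_mat n n" "B\<^sup>T = B"
  defines "C \<equiv> A - B"
  shows "tr (C * (A ^\<^sub>m Suc (2 * N) - B ^\<^sub>m Suc (2 * N)))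
    \<le> real (2 * N + 1) / 2 * (tr (C * C * A ^\<^sub>m (2 * N)) + tr (C * C * B ^\<^sub>m (2 * N)))"
proof -
  have C: "C \<in> carrier_mat n n" "C\<^sup>T = C"
    using A B by (auto simp: C_def transpose_minus)
  define f where "f k = tr (C * A ^\<^sub>m k * C * B ^\<^sub>m (2 * N - k))" for k
  have mid: "2 * f (a + b) \<le> f (2 * a) + f (2 * b)" if "a \<le> N" "b \<le> N" for a b
  proof -
    have "2 * N - (a + b) = (N - a) + (N - b)" "2 * N - 2 * a = 2 * (N - a)"
      "2 * N - 2 * b = 2 * (N - b)" using that by auto
    then show ?thesis unfolding f_def using tr_powers_midpoint[OF A B C] by metis
  qed
  have "tr (C * (A ^\<^sub>m Suc (2 * N) - B ^\<^sub>m Suc (2 * N))) = (\<Sum>k\<le>2 * N. f k)"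
    unfolding f_def using pow_mat_diff_telescope[OF A(1) B(1) C(1)] by (simp only: C_def)
  also have "\<dots> \<le> real (2 * N + 1) / 2 * (f 0 + f (2 * N))"
    by (rule midpoint_convex_sum) (rule mid)
  also have "f (2 * N) = tr (C * C * A ^\<^sub>m (2 * N))"
    unfolding f_def using A B C
    by (simp add: assoc_mult_mat[of _ n n _ n _ n] tr_mult_commute[of C n])
  also have "f 0 = tr (C * C * B ^\<^sub>m (2 * N))"
    unfolding f_def using A B C by simp
  finally show ?thesis by (simp add: add.commute)
qed

section \<open>Quadratic forms and traces\<close>

text \<open>The trace becomes a sum of quadratic forms of \<open>M\<close> at the columns of
  \<open>X\<close>. This transfers inequalities between quadratic forms to traces against even
  powers.\<close>

lemma tr_mult_square_eq:
  fixes M X :: "real mat"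
  assumes M: "M \<in> carrier_mat n n" and X: "X \<in> carrier_mat n n" "X\<^sup>T = X"
  shows "tr (M * (X * X)) = (\<Sum>j<n. col X j \<bullet> (M *\<^sub>v col X j))"
proof -
  have "tr (M * (X * X)) = tr (M * X * X)"
    using M X by simp
  also have "\<dots> = tr (X\<^sup>T * (M * X))"
    using tr_mult_commute[of "M * X" n X] M X by simp
  also have "\<dots> = (\<Sum>j<n. col X j \<bullet> col (M * X) j)"
    unfolding tr_transpose_mult[OF X(1) mult_carrier_square[OF M X(1)]]
    by (subst sum.swap) (use M X in \<open>auto simp: scalar_prod_def atLeast0LessThan intro!: sum.cong\<close>)
  also have "\<dots> = (\<Sum>j<n. col X j \<bullet> (M *\<^sub>v col X j))"
    using M X by (intro sum.cong refl) (simp add: col_mult2[of _ n n])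
  finally show ?thesis .
qed

lemma tr_mult_square_mono:
  fixes M N X :: "real mat"
  assumes M: "M \<in> carrier_mat n n" and N: "N \<in> carrier_mat n n"
    and X: "X \<in> carrier_mat n n" "X\<^sup>T = X"
    and le: "\<And>v. v \<in> carrier_vec n \<Longrightarrow> v \<bullet> (M *\<^sub>v v) \<le> v \<bullet> (N *\<^sub>v v)"
  shows "tr (M * (X * X)) \<le> tr (N * (X * X))"
  unfolding tr_mult_square_eq[OF M X] tr_mult_square_eq[OF N X]
  using X by (intro sum_mono le) auto

lemma tr_mult_even_power_mono:
  fixes M N A :: "real mat"
  assumes "M \<in> carrier_mat n n" "N \<in> carrier_mat n n" "A \<in> carrier_mat n n" "A\<^sup>T = A"
    and "\<And>v. v \<in> carrier_vec n \<Longrightarrow> v \<bullet> (M *\<^sub>v v) \<le> v \<bullet> (N *\<^sub>v v)"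
  shows "tr (M * A ^\<^sub>m (2 * k)) \<le> tr (N * A ^\<^sub>m (2 * k))"
  using tr_mult_square_mono[of M n N "A ^\<^sub>m k"] assms
  by (simp add: mult_2 pow_mat_add[of A n] pow_mat_sym[of A n] del: mult_2_right)

lemma tr_even_power:
  fixes A :: "real mat"
  assumes "A \<in> carrier_mat n n" "A\<^sup>T = A"
  shows "tr (A ^\<^sub>m (2 * k)) = (\<Sum>i<n. \<Sum>j<n. ((A ^\<^sub>m k) $$ (i, j))\<^sup>2)"
proof -
  have "A ^\<^sub>m (2 * k) = (A ^\<^sub>m k)\<^sup>T * A ^\<^sub>m k"
    using assms by (simp only: mult_2 pow_mat_add[of A n] pow_mat_sym[of A n])
  then show ?thesis
    using tr_transpose_mult[of "A ^\<^sub>m k" n "A ^\<^sub>m k"] assms by (simp add: power2_eq_square)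
qed

section \<open>From traces of powers to operator bounds\<close>

lemma vnorm_mult_mat_vec_le:
  fixes A :: "real mat"
  assumes A: "A \<in> carrier_mat n n" and v: "v \<in> carrier_vec n"
  shows "(vnorm (A *\<^sub>v v))\<^sup>2 \<le> (\<Sum>i<n. \<Sum>j<n. (A $$ (i, j))\<^sup>2) * (vnorm v)\<^sup>2"
proof -
  have "(vnorm (A *\<^sub>v v))\<^sup>2 = (\<Sum>i<n. (row A i \<bullet> v)\<^sup>2)"
    unfolding vnorm_sq using A v
    by (simp add: scalar_prod_def[of "A *\<^sub>v v"] atLeast0LessThan power2_eq_square)
  also have "\<dots> \<le> (\<Sum>i<n. (vnorm (row A i))\<^sup>2 * (vnorm v)\<^sup>2)"
  proof (intro sum_mono)
    fix i assume "i \<in> {..<n}"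
    then have "\<bar>row A i \<bullet> v\<bar> \<le> vnorm (row A i) * vnorm v"
      using A v by (intro abs_scalar_prod_le) auto
    then have "\<bar>row A i \<bullet> v\<bar>\<^sup>2 \<le> (vnorm (row A i) * vnorm v)\<^sup>2"
      by (intro power_mono) auto
    then show "(row A i \<bullet> v)\<^sup>2 \<le> (vnorm (row A i))\<^sup>2 * (vnorm v)\<^sup>2"
      by (simp add: power_mult_distrib)
  qed
  also have "\<dots> = (\<Sum>i<n. \<Sum>j<n. (A $$ (i, j))\<^sup>2) * (vnorm v)\<^sup>2"
  proof -
    have "(vnorm (row A i))\<^sup>2 = (\<Sum>j<n. (A $$ (i, j))\<^sup>2)" if "i < n" for i
      unfolding vnorm_sq using A that
      by (simp add: scalar_prod_def atLeast0LessThan power2_eq_square)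
    then show ?thesis by (simp add: sum_distrib_right)
  qed
  finally show ?thesis .
qed

text \<open>Successive ratios of a log-convex sequence increase, so each is at least the first one.
  The cross-multiplied form \<open>step\<close> avoids dividing by terms that may vanish.\<close>

lemma log_convex_power_le:
  fixes x :: "nat \<Rightarrow> real"
  assumes nonneg: "\<And>k. 0 \<le> x k" and lc: "\<And>k. (x (Suc k))\<^sup>2 \<le> x k * x (Suc (Suc k))"
  shows "x 1 ^ Suc p \<le> x 0 ^ p * x (Suc p)"
proof -
  have step: "x 1 * x k \<le> x 0 * x (Suc k)" for k
  proof (induction k)
    case (Suc k)
    show ?case
    proof (cases "x k = 0")
      case True
      then have "x (Suc k) = 0" using lc[of k] by simp
      then show ?thesis using nonneg by simp
    next
      case False
      then have "0 < x k" using nonneg[of k] by simp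
      have "x 1 * x (Suc k) * x k \<le> x 0 * (x (Suc k))\<^sup>2"
        using mult_right_mono[OF Suc nonneg[of "Suc k"]] by (simp add: power2_eq_square mult_ac)
      also have "\<dots> \<le> x 0 * (x k * x (Suc (Suc k)))"
        by (intro mult_left_mono lc nonneg)
      finally have "x k * (x 1 * x (Suc k)) \<le> x k * (x 0 * x (Suc (Suc k)))"
        by (simp add: mult_ac)
      then show ?thesis using \<open>0 < x k\<close> by simp
    qed
  qed simp
  show ?thesis
  proof (induction p)
    case (Suc p)
    have "x 1 ^ Suc (Suc p) \<le> x 1 * (x 0 ^ p * x (Suc p))"
      using mult_left_mono[OF Suc nonneg[of 1]] by simp
    also have "\<dots> = x 0 ^ p * (x 1 * x (Suc p))" by simp
    also have "\<dots> \<le> x 0 ^ p * (x 0 * x (Suc (Suc p)))"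
      by (intro mult_left_mono step) (simp add: nonneg)
    finally show ?case by (simp add: mult_ac)
  qed simp
qed

text \<open>Stands in for the bound of the largest eigenvalue by the trace of a power. By symmetry
  and Cauchy-Schwarz the squared norm of A^k v is log-convex in k, so the norm of A v is controlled
  by that of A^p v, and this by the Frobenius norm of A^p, whose square is the trace.\<close>

lemma vnorm_le_of_tr_even_power_le:
  fixes A :: "real mat"
  assumes A: "A \<in> carrier_mat n n" "A\<^sup>T = A" and v: "v \<in> carrier_vec n"
    and tr: "tr (A ^\<^sub>m (2 * p)) \<le> c ^ (2 * p)" and "1 \<le> p" "0 \<le> c"
  shows "vnorm (A *\<^sub>v v) \<le> c * vnorm v"
proof -
  define x where "x k = (vnorm (A ^\<^sub>m k *\<^sub>v v))\<^sup>2" for k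
  have shift: "(A ^\<^sub>m (k + l) *\<^sub>v v) \<bullet> (A ^\<^sub>m j *\<^sub>v v) = (A ^\<^sub>m k *\<^sub>v v) \<bullet> (A ^\<^sub>m (l + j) *\<^sub>v v)" for k l j
  proof -
    have "A ^\<^sub>m (k + l) *\<^sub>v v = A ^\<^sub>m l *\<^sub>v (A ^\<^sub>m k *\<^sub>v v)"
      using A v by (simp add: add.commute[of k l] pow_mat_add[of A n] assoc_mult_mat_vec[of _ n n _ n])
    moreover have "A ^\<^sub>m (l + j) *\<^sub>v v = A ^\<^sub>m l *\<^sub>v (A ^\<^sub>m j *\<^sub>v v)"
      using A v by (simp add: pow_mat_add[of A n] assoc_mult_mat_vec[of _ n n _ n])
    ultimately show ?thesis
      using A v scalar_prod_mult_mat_vec_sym[of "A ^\<^sub>m l" n "A ^\<^sub>m k *\<^sub>v v" "A ^\<^sub>m j *\<^sub>v v"]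
      by (simp add: pow_mat_sym[of A n] mult_mat_vec_carrier[of _ n n])
  qed
  have "(x (Suc k))\<^sup>2 \<le> x k * x (Suc (Suc k))" for k
  proof -
    have "x (Suc k) = (A ^\<^sub>m k *\<^sub>v v) \<bullet> (A ^\<^sub>m Suc (Suc k) *\<^sub>v v)"
      using shift[of k 1 "Suc k"] by (simp add: x_def vnorm_sq)
    moreover have "\<bar>(A ^\<^sub>m k *\<^sub>v v) \<bullet> (A ^\<^sub>m Suc (Suc k) *\<^sub>v v)\<bar>
        \<le> vnorm (A ^\<^sub>m k *\<^sub>v v) * vnorm (A ^\<^sub>m Suc (Suc k) *\<^sub>v v)"
      using A v pow_mat_carrier[OF A(1)] by (intro abs_scalar_prod_le[of _ n] mult_mat_vec_carrier[of _ n n])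
    ultimately have "\<bar>x (Suc k)\<bar>\<^sup>2 \<le> (vnorm (A ^\<^sub>m k *\<^sub>v v) * vnorm (A ^\<^sub>m Suc (Suc k) *\<^sub>v v))\<^sup>2"
      by (intro power_mono) (auto simp del: pow_mat.simps)
    then show ?thesis by (simp add: x_def power_mult_distrib)
  qed
  moreover obtain q where q: "p = Suc q" using \<open>1 \<le> p\<close> by (cases p) auto
  ultimately have "x 1 ^ p \<le> x 0 ^ q * x p"
    using log_convex_power_le[of x q] by (simp add: x_def)
  also have "\<dots> \<le> x 0 ^ q * (c ^ (2 * p) * x 0)"
  proof (rule mult_left_mono)
    have "x p \<le> tr (A ^\<^sub>m (2 * p)) * (vnorm v)\<^sup>2"
      unfolding x_def tr_even_power[OF A] using A v by (intro vnorm_mult_mat_vec_le) auto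
    also have "\<dots> \<le> c ^ (2 * p) * x 0"
      using A v tr by (auto simp: x_def intro!: mult_right_mono)
    finally show "x p \<le> c ^ (2 * p) * x 0" .
  qed (simp add: x_def)
  also have "x 0 ^ q * (c ^ (2 * p) * x 0) = (c\<^sup>2 * x 0) ^ p"
    unfolding power_mult[of c 2 p] unfolding q
    by (simp only: power_mult_distrib power_Suc mult_ac)
  finally have "x 1 ^ p \<le> (c\<^sup>2 * x 0) ^ p" .
  then have "x 1 \<le> c\<^sup>2 * x 0"
    using \<open>1 \<le> p\<close> by (subst (asm) power_mono_iff) (auto simp: x_def)
  then have "(vnorm (A *\<^sub>v v))\<^sup>2 \<le> (c * vnorm v)\<^sup>2"
    using A v by (simp add: x_def power_mult_distrib)
  then show ?thesis using \<open>0 \<le> c\<close> by (auto dest: power2_le_imp_le)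
qed

lemma smult_mat_mult_vec:
  fixes A :: "real mat"
  assumes "A \<in> carrier_mat nr nc" "v \<in> carrier_vec nc"
  shows "(c \<cdot>\<^sub>m A) *\<^sub>v v = c \<cdot>\<^sub>v (A *\<^sub>v v)"
  using assms by (intro eq_vecI) (auto simp: scalar_prod_def sum_distrib_left mult_ac intro!: sum.cong)

section \<open>Expectations of bounded random matrices\<close>

text \<open>Unlike integrability, this class is closed under products, as required for traces of
  matrix powers; on a finite measure space it implies integrability.\<close>

definition bounded_rv :: "'a measure \<Rightarrow> ('a \<Rightarrow> real) \<Rightarrow> bool" where
  "bounded_rv M f \<longleftrightarrow> f \<in> borel_measurable M \<and> (\<exists>c. \<forall>x\<in>space M. \<bar>f x\<bar> \<le> c)"

lemma bounded_rv_const [simp]: "bounded_rv M (\<lambda>_. c)"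
  by (auto simp: bounded_rv_def)

lemma bounded_rv_add: "bounded_rv M f \<Longrightarrow> bounded_rv M g \<Longrightarrow> bounded_rv M (\<lambda>x. f x + g x)"
  unfolding bounded_rv_def
proof safe
  fix c d assume "\<forall>x\<in>space M. \<bar>f x\<bar> \<le> c" "\<forall>x\<in>space M. \<bar>g x\<bar> \<le> d"
  then show "\<exists>c. \<forall>x\<in>space M. \<bar>f x + g x\<bar> \<le> c"
    by (intro exI[of _ "c + d"]) (fastforce intro: order_trans[OF abs_triangle_ineq])
qed simp

lemma bounded_rv_mult: "bounded_rv M f \<Longrightarrow> bounded_rv M g \<Longrightarrow> bounded_rv M (\<lambda>x. f x * g x)"
  unfolding bounded_rv_def
proof safe
  fix c d assume cd: "\<forall>x\<in>space M. \<bar>f x\<bar> \<le> c" "\<forall>x\<in>space M. \<bar>g x\<bar> \<le> d"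
  have "\<bar>f x * g x\<bar> \<le> c * d" if "x \<in> space M" for x
    unfolding abs_mult using cd that by (intro mult_mono) (auto intro: order_trans[OF abs_ge_zero])
  then show "\<exists>c. \<forall>x\<in>space M. \<bar>f x * g x\<bar> \<le> c" by blast
qed simp

lemma bounded_rv_uminus: "bounded_rv M f \<Longrightarrow> bounded_rv M (\<lambda>x. - f x)"
  by (auto simp: bounded_rv_def)

lemma bounded_rv_diff: "bounded_rv M f \<Longrightarrow> bounded_rv M g \<Longrightarrow> bounded_rv M (\<lambda>x. f x - g x)"
  using bounded_rv_add[of M f "\<lambda>x. - g x"] bounded_rv_uminus by auto

lemma bounded_rv_sum: "(\<And>i. i \<in> A \<Longrightarrow> bounded_rv M (f i)) \<Longrightarrow> bounded_rv M (\<lambda>x. \<Sum>i\<in>A. f i x)"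
  by (induction A rule: infinite_finite_induct) (auto intro: bounded_rv_add)

lemma (in finite_measure) bounded_rv_integrable: "bounded_rv M f \<Longrightarrow> integrable M f"
  by (auto simp: bounded_rv_def intro!: integrable_const_bound AE_I2)

lemma bounded_rv_component:
  assumes "bounded_rv M f" "j \<in> I"
  shows "bounded_rv (PiM I (\<lambda>_. M)) (\<lambda>s. f (s j))"
  using assms unfolding bounded_rv_def
  by (auto simp: space_PiM intro!: measurable_compose[OF measurable_component_singleton])

text \<open>The dimension is demanded at every \<open>x\<close>, also outside the space, so that
  carrier conditions can be discharged without a membership proof.\<close>

definition bounded_rmat :: "'a measure \<Rightarrow> nat \<Rightarrow> ('a \<Rightarrow> real mat) \<Rightarrow> bool" where
  "bounded_rmat M n F \<longleftrightarrow> (\<forall>x. F x \<in> carrier_mat n n) \<and>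
     (\<forall>i<n. \<forall>j<n. bounded_rv M (\<lambda>x. F x $$ (i, j)))"

lemma bounded_rmat_carrier: "bounded_rmat M n F \<Longrightarrow> F x \<in> carrier_mat n n"
  by (simp add: bounded_rmat_def)

lemma bounded_rmat_entry: "bounded_rmat M n F \<Longrightarrow> i < n \<Longrightarrow> j < n \<Longrightarrow> bounded_rv M (\<lambda>x. F x $$ (i, j))"
  by (simp add: bounded_rmat_def)

lemma bounded_rmat_const: "A \<in> carrier_mat n n \<Longrightarrow> bounded_rmat M n (\<lambda>_. A)"
  by (simp add: bounded_rmat_def)

lemma bounded_rmat_add:
  assumes "bounded_rmat M n F" "bounded_rmat M n G"
  shows "bounded_rmat M n (\<lambda>x. F x + G x)"
proof -
  have "dim_row (F x) = n" "dim_col (F x) = n" "dim_row (G x) = n" "dim_col (G x) = n" for x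
    using assms by (auto simp: bounded_rmat_def)
  then show ?thesis using assms by (auto simp: bounded_rmat_def intro: bounded_rv_add)
qed

lemma bounded_rmat_diff:
  assumes "bounded_rmat M n F" "bounded_rmat M n G"
  shows "bounded_rmat M n (\<lambda>x. F x - G x)"
proof -
  have "dim_row (F x) = n" "dim_col (F x) = n" "dim_row (G x) = n" "dim_col (G x) = n" for x
    using assms by (auto simp: bounded_rmat_def)
  then show ?thesis using assms by (auto simp: bounded_rmat_def intro: bounded_rv_diff)
qed

lemma bounded_rmat_mult:
  assumes "bounded_rmat M n F" "bounded_rmat M n G"
  shows "bounded_rmat M n (\<lambda>x. F x * G x)"
proof -
  have [simp]: "dim_row (F x) = n" "dim_col (F x) = n" "dim_row (G x) = n" "dim_col (G x) = n" for x
    using assms by (auto simp: bounded_rmat_def)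
  have "(F x * G x) $$ (i, j) = (\<Sum>k<n. F x $$ (i, k) * G x $$ (k, j))" if "i < n" "j < n" for i j x
    using that by (simp add: scalar_prod_def atLeast0LessThan)
  then show ?thesis
    using assms by (auto simp: bounded_rmat_def intro!: bounded_rv_sum bounded_rv_mult)
qed

lemma bounded_rmat_pow:
  assumes "bounded_rmat M n F"
  shows "bounded_rmat M n (\<lambda>x. F x ^\<^sub>m k)"
proof (induction k)
  case 0
  have "F x ^\<^sub>m 0 = 1\<^sub>m n" for x using bounded_rmat_carrier[OF assms, of x] by simp
  then show ?case by (auto intro: bounded_rmat_const)
next
  case (Suc k)
  then show ?case using bounded_rmat_mult[OF Suc assms] by simp
qed

lemma bounded_rv_tr: "bounded_rmat M n F \<Longrightarrow> bounded_rv M (\<lambda>x. tr (F x))"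
proof -
  assume F: "bounded_rmat M n F"
  then have "tr (F x) = (\<Sum>i<n. F x $$ (i, i))" for x
    using bounded_rmat_carrier[OF F, of x] by (simp add: tr_def)
  then show ?thesis using F by (auto intro: bounded_rv_sum bounded_rmat_entry)
qed

lemmas bounded_intros = bounded_rv_const bounded_rv_add bounded_rv_diff bounded_rv_mult bounded_rv_tr
  bounded_rmat_const bounded_rmat_add bounded_rmat_diff bounded_rmat_mult bounded_rmat_pow

definition expect_mat :: "'a measure \<Rightarrow> nat \<Rightarrow> ('a \<Rightarrow> real mat) \<Rightarrow> real mat" where
  "expect_mat M n F = mat n n (\<lambda>(i, j). LINT x|M. F x $$ (i, j))"

lemma expect_mat_carrier [simp]: "expect_mat M n F \<in> carrier_mat n n"
  by (simp add: expect_mat_def)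

text \<open>By linearity of the trace, averaging over an independent copy amounts to inserting the
  mean matrix. The exchange argument rests on this.\<close>

lemma (in finite_measure) integral_tr_mult_left:
  assumes "bounded_rmat M n F" "B \<in> carrier_mat n n"
  shows "(LINT x|M. tr (F x * B)) = tr (expect_mat M n F * B)"
proof -
  have int: "integrable M (\<lambda>x. F x $$ (i, j))" if "i < n" "j < n" for i j
    using assms that by (intro bounded_rv_integrable bounded_rmat_entry)
  have "(LINT x|M. tr (F x * B)) = (LINT x|M. (\<Sum>i<n. \<Sum>j<n. F x $$ (i, j) * B $$ (j, i)))"
    using assms by (simp add: tr_mult[of _ n] bounded_rmat_def)
  also have "\<dots> = (\<Sum>i<n. \<Sum>j<n. (LINT x|M. F x $$ (i, j)) * B $$ (j, i))"
  proof -
    have int2: "integrable M (\<lambda>x. \<Sum>j<n. F x $$ (i, j) * B $$ (j, i))" if "i < n" for i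
      using that int by (intro Bochner_Integration.integrable_sum integrable_mult_left) auto
    have "(LINT x|M. (\<Sum>i<n. \<Sum>j<n. F x $$ (i, j) * B $$ (j, i)))
      = (\<Sum>i<n. LINT x|M. (\<Sum>j<n. F x $$ (i, j) * B $$ (j, i)))"
      by (intro Bochner_Integration.integral_sum int2) auto
    also have "\<dots> = (\<Sum>i<n. \<Sum>j<n. LINT x|M. F x $$ (i, j) * B $$ (j, i))"
      by (intro sum.cong refl Bochner_Integration.integral_sum integrable_mult_left int) auto
    finally show ?thesis by (simp add: int)
  qed
  also have "\<dots> = tr (expect_mat M n F * B)"
    using assms by (simp add: tr_mult[of _ n] expect_mat_def)
  finally show ?thesis .
qed

lemma (in finite_measure) integral_tr_mult_right:
  assumes "bounded_rmat M n F" "B \<in> carrier_mat n n"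
  shows "(LINT x|M. tr (B * F x)) = tr (B * expect_mat M n F)"
  using integral_tr_mult_left[OF assms] assms
  by (simp add: tr_mult_commute[of B n] bounded_rmat_def)


section \<open>The sample covariance of a bounded feature map\<close>

text \<open>Here \<open>z i\<close> stands for the feature map at the i-th data point, as a function
  of the random feature. The bound 1 makes all moments finite and, quantitatively, gives squared
  feature norm at most \<open>n\<close>.\<close>

locale bounded_features = prob_space N for N :: "'a measure" +
  fixes n :: nat and z :: "nat \<Rightarrow> 'a \<Rightarrow> real"
  assumes z_measurable: "i < n \<Longrightarrow> z i \<in> borel_measurable N"
    and z_bound: "i < n \<Longrightarrow> x \<in> space N \<Longrightarrow> \<bar>z i x\<bar> \<le> 1"
begin

definition feature_vec :: "'a \<Rightarrow> real vec" where
  "feature_vec x = vec n (\<lambda>i. z i x)"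

definition outer :: "'a \<Rightarrow> real mat" where
  "outer x = mat n n (\<lambda>(i, j). z i x * z j x)"

definition cov :: "real mat" where
  "cov = expect_mat N n outer"

text \<open>The sample \<open>s\<close> may live on a larger index set, from which \<open>J\<close>
  picks the features of one iteration; thus all iterations share one sample space. The sum is not
  normalised, and it is formed entrywise so that an empty \<open>J\<close> yields the square zero
  matrix.\<close>

definition deviation :: "'i set \<Rightarrow> ('i \<Rightarrow> 'a) \<Rightarrow> real mat" where
  "deviation J s = mat n n (\<lambda>(i, k). \<Sum>j\<in>J. (outer (s j) - cov) $$ (i, k))"

lemma feature_vec_carrier [simp]: "feature_vec x \<in> carrier_vec n"
  by (simp add: feature_vec_def)

lemma outer_carrier [simp]: "outer x \<in> carrier_mat n n"
  by (simp add: outer_def)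

lemma cov_carrier [simp]: "cov \<in> carrier_mat n n"
  by (simp add: cov_def)

lemma deviation_carrier [simp]: "deviation J s \<in> carrier_mat n n"
  by (simp add: deviation_def)

lemma outer_sym [simp]: "(outer x)\<^sup>T = outer x"
  by (intro eq_matI) (auto simp: outer_def mult.commute)

lemma cov_sym [simp]: "cov\<^sup>T = cov"
  by (intro eq_matI) (auto simp: cov_def expect_mat_def outer_def mult.commute)

lemma deviation_sym [simp]: "(deviation J s)\<^sup>T = deviation J s"
proof (intro eq_matI)
  have "(outer (s j) - cov) $$ (i, k) = (outer (s j) - cov) $$ (k, i)" if "i < n" "k < n" for i j k
    using that by (simp add: cov_def expect_mat_def outer_def mult.commute)
  then show "(deviation J s)\<^sup>T $$ (i, k) = deviation J s $$ (i, k)"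
    if "i < dim_row (deviation J s)" "k < dim_col (deviation J s)" for i k
    using that by (auto simp: deviation_def intro!: sum.cong)
qed (simp_all add: deviation_def)

lemma bounded_outer: "bounded_rmat N n outer"
  by (auto simp: bounded_rmat_def outer_def bounded_rv_def z_measurable
      intro!: bounded_rv_mult[unfolded bounded_rv_def] z_bound)

lemma outer_mult_vec:
  assumes "v \<in> carrier_vec n"
  shows "outer x *\<^sub>v v = (feature_vec x \<bullet> v) \<cdot>\<^sub>v feature_vec x"
  using assms by (intro eq_vecI)
    (auto simp: outer_def feature_vec_def scalar_prod_def atLeast0LessThan sum_distrib_left mult_ac intro!: sum.cong)

lemma feature_vec_norm:
  assumes "x \<in> space N"
  shows "feature_vec x \<bullet> feature_vec x \<le> n"
proof -
  have "feature_vec x \<bullet> feature_vec x = (\<Sum>i<n. (z i x)\<^sup>2)"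
    by (simp add: feature_vec_def scalar_prod_def atLeast0LessThan power2_eq_square)
  also have "\<dots> \<le> (\<Sum>i<n. 1)"
    using z_bound assms by (intro sum_mono) (simp add: abs_square_le_1)
  finally show ?thesis by simp
qed

text \<open>The rank-one structure makes the conditional variance proxy linear in the sampled matrix.\<close>

lemma outer_diff_square_le:
  assumes x: "x \<in> space N" and y: "y \<in> space N" and v: "v \<in> carrier_vec n"
  shows "v \<bullet> ((outer x - outer y) * (outer x - outer y) *\<^sub>v v)
    \<le> v \<bullet> ((2 * real n) \<cdot>\<^sub>m (outer x + outer y) *\<^sub>v v)"
proof -
  define a b where "a = feature_vec x \<bullet> v" and "b = feature_vec y \<bullet> v"
  define D where "D = outer x - outer y"
  have D: "D \<in> carrier_mat n n" "D\<^sup>T = D"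
    by (auto simp: D_def transpose_minus[of _ n n])
  have quad: "v \<bullet> (outer x *\<^sub>v v) = (feature_vec x \<bullet> v)\<^sup>2" for x
    using v comm_scalar_prod[of v n "feature_vec x"] by (simp add: outer_mult_vec power2_eq_square)
  have Dv: "D *\<^sub>v v = a \<cdot>\<^sub>v feature_vec x - b \<cdot>\<^sub>v feature_vec y"
    using v by (simp add: D_def minus_mult_distrib_mat_vec[of _ n n] outer_mult_vec a_def b_def)
  have "v \<bullet> (D * D *\<^sub>v v) = (vnorm (D *\<^sub>v v))\<^sup>2"
    using v D scalar_prod_mult_mat_vec_sym[of D n v "D *\<^sub>v v"]
    by (simp add: vnorm_sq assoc_mult_mat_vec[of _ n n _ n] mult_mat_vec_carrier[of _ n n])
  also have "\<dots> \<le> (\<bar>a\<bar> * vnorm (feature_vec x) + \<bar>b\<bar> * vnorm (feature_vec y))\<^sup>2"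
    unfolding Dv by (intro power_mono order_trans[OF vnorm_minus_le[of _ n]]) (auto simp: vnorm_smult)
  also have "\<dots> \<le> 2 * ((\<bar>a\<bar> * vnorm (feature_vec x))\<^sup>2 + (\<bar>b\<bar> * vnorm (feature_vec y))\<^sup>2)"
    by (smt (verit, best) sum_squares_bound power2_sum)
  also have "\<dots> = 2 * (a\<^sup>2 * (feature_vec x \<bullet> feature_vec x) + b\<^sup>2 * (feature_vec y \<bullet> feature_vec y))"
    by (simp add: power_mult_distrib vnorm_sq)
  also have "\<dots> \<le> 2 * (a\<^sup>2 * n + b\<^sup>2 * n)"
    using feature_vec_norm x y by (intro mult_left_mono add_mono) auto
  also have "\<dots> = v \<bullet> ((2 * real n) \<cdot>\<^sub>m (outer x + outer y) *\<^sub>v v)"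
  proof -
    have "((2 * real n) \<cdot>\<^sub>m (outer x + outer y)) *\<^sub>v v = (2 * real n) \<cdot>\<^sub>v (outer x *\<^sub>v v + outer y *\<^sub>v v)"
      using v by (simp add: smult_mat_mult_vec[of _ n n] add_mult_distrib_mat_vec[of _ n n])
    then show ?thesis
      using v by (simp add: scalar_prod_add_distrib[of _ n] mult_mat_vec_carrier[of _ n n] quad a_def b_def algebra_simps)
  qed
  finally show ?thesis by (simp add: D_def)
qed

text \<open>In \<open>A x - A y\<close> both \<open>W\<close> and \<open>cov\<close> cancel, so the
  mean value inequality applies with \<open>outer x - outer y\<close> as the difference. The square
  of that difference is bounded by \<open>outer_diff_square_le\<close>, whose factor 2n absorbs the
  1/2 of the mean value inequality.\<close>

lemma tr_swap_le:
  assumes W: "W \<in> carrier_mat n n" "W\<^sup>T = W" and x: "x \<in> space N" and y: "y \<in> space N"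
  defines "A \<equiv> \<lambda>x. W + (outer x - cov)"
  shows "tr ((outer x - outer y) * (A x ^\<^sub>m Suc (2 * k) - A y ^\<^sub>m Suc (2 * k)))
    \<le> real ((2 * k + 1) * n) * (tr ((outer x + outer y) * A x ^\<^sub>m (2 * k)) + tr ((outer x + outer y) * A y ^\<^sub>m (2 * k)))"
proof -
  have A: "A x \<in> carrier_mat n n" "(A x)\<^sup>T = A x" for x
    using W by (auto simp: A_def transpose_minus[of _ n n] transpose_add[of _ n n])
  have diff: "A x - A y = outer x - outer y"
    using W carrier_matD[OF cov_carrier] carrier_matD[OF outer_carrier] unfolding A_def
    by (intro eq_matI) auto
  have le: "tr ((outer x - outer y) * (outer x - outer y) * A u ^\<^sub>m (2 * k))
      \<le> 2 * real n * tr ((outer x + outer y) * A u ^\<^sub>m (2 * k))" for u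
  proof -
    have "tr ((outer x - outer y) * (outer x - outer y) * A u ^\<^sub>m (2 * k))
      \<le> tr ((2 * real n) \<cdot>\<^sub>m (outer x + outer y) * A u ^\<^sub>m (2 * k))"
      using x y A by (intro tr_mult_even_power_mono[of _ n] outer_diff_square_le) auto
    also have "\<dots> = 2 * real n * tr ((outer x + outer y) * A u ^\<^sub>m (2 * k))"
      using A by (simp add: mult_smult_assoc_mat[of _ n n _ n] tr_smult[of _ n])
    finally show ?thesis .
  qed
  have "tr ((outer x - outer y) * (A x ^\<^sub>m Suc (2 * k) - A y ^\<^sub>m Suc (2 * k)))
    \<le> real (2 * k + 1) / 2 * (tr ((outer x - outer y) * (outer x - outer y) * A x ^\<^sub>m (2 * k))
        + tr ((outer x - outer y) * (outer x - outer y) * A y ^\<^sub>m (2 * k)))"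
    using tr_mean_value[OF A A, of x y k] by (simp only: diff)
  also have "\<dots> \<le> real (2 * k + 1) / 2 * (2 * real n * tr ((outer x + outer y) * A x ^\<^sub>m (2 * k))
      + 2 * real n * tr ((outer x + outer y) * A y ^\<^sub>m (2 * k)))"
    by (intro mult_left_mono add_mono le) auto
  finally show ?thesis by (simp add: field_simps)
qed

text \<open>
  Integration by parts on the probability space: since \<open>outer x - cov\<close> is centred, \<open>x\<close> may be
  paired with an independent copy \<open>y\<close>.
\<close>

lemma expectation_tr_odd_power_le:
  assumes W: "W \<in> carrier_mat n n" "W\<^sup>T = W"
  defines "A \<equiv> \<lambda>x. W + (outer x - cov)"
  shows "expectation (\<lambda>x. tr ((outer x - cov) * A x ^\<^sub>m Suc (2 * k)))
    \<le> real ((2 * k + 1) * n) * expectation (\<lambda>x. tr ((outer x + cov) * A x ^\<^sub>m (2 * k)))"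
proof -
  define X where "X x = outer x - cov" for x
  define P where "P x = A x ^\<^sub>m Suc (2 * k)" for x
  define Q where "Q x = A x ^\<^sub>m (2 * k)" for x
  define c where "c = real ((2 * k + 1) * n)"
  have bX: "bounded_rmat N n X" and bA: "bounded_rmat N n A"
    unfolding X_def A_def using W by (auto intro!: bounded_intros bounded_outer)
  have bP: "bounded_rmat N n P" and bQ: "bounded_rmat N n Q"
    unfolding P_def Q_def by (intro bounded_intros bA)+
  note b = bX bP bQ bounded_outer
  have carr [simp]: "X x \<in> carrier_mat n n" "P x \<in> carrier_mat n n" "Q x \<in> carrier_mat n n" for x
    using b by (auto simp: bounded_rmat_def)
  have EX: "expect_mat N n X = 0\<^sub>m n n"
  proof (intro eq_matI)
    fix i j assume "i < dim_row (0\<^sub>m n n :: real mat)" "j < dim_col (0\<^sub>m n n :: real mat)"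
    then have ij: "i < n" "j < n" by auto
    have "X x $$ (i, j) = outer x $$ (i, j) - cov $$ (i, j)" for x
      using ij carrier_matD[OF cov_carrier] by (simp add: X_def)
    moreover have "integrable N (\<lambda>x. outer x $$ (i, j))"
      using ij by (intro bounded_rv_integrable bounded_rmat_entry[OF bounded_outer])
    ultimately show "expect_mat N n X $$ (i, j) = 0\<^sub>m n n $$ (i, j)"
      using ij by (simp add: expect_mat_def cov_def prob_space)
  qed (auto simp: expect_mat_def)
  define p where "p = expectation (\<lambda>x. tr (X x * P x))"
  define q where "q = expectation (\<lambda>x. tr (outer x * Q x))"
  define r where "r = expectation (\<lambda>x. tr (cov * Q x))"
  have int: "integrable N (\<lambda>x. tr (F x * G x))" if "bounded_rmat N n F" "bounded_rmat N n G" for F G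
    using that by (intro bounded_rv_integrable bounded_intros)
  have intl: "integrable N (\<lambda>x. tr (F x * G))" if "bounded_rmat N n F" "G \<in> carrier_mat n n" for F G
    using that by (intro bounded_rv_integrable bounded_intros)
  have intr: "integrable N (\<lambda>x. tr (F * G x))" if "F \<in> carrier_mat n n" "bounded_rmat N n G" for F G
    using that by (intro bounded_rv_integrable bounded_intros)
  note ints = int intl intr b carr expect_mat_carrier outer_carrier cov_carrier
  have Z: "tr (0\<^sub>m n n * B) = 0" "tr (B * 0\<^sub>m n n) = 0" if "B \<in> carrier_mat n n" for B
    using that by (auto simp: tr_def)
  \<comment> \<open>The product of differences is expanded into four traces, because the two mixed
    ones will average to 0 by \<open>EX\<close>.\<close>
  have swap: "tr (X x * P x) - tr (X x * P y) - tr (X y * P x) + tr (X y * P y)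
    \<le> c * (tr (outer x * Q x) + tr (outer y * Q x) + (tr (outer x * Q y) + tr (outer y * Q y)))"
    if "x \<in> space N" "y \<in> space N" for x y
  proof -
    have eq: "outer x - outer y = X x - X y"
      using carrier_matD[OF cov_carrier] carrier_matD[OF outer_carrier] unfolding X_def
      by (intro eq_matI) auto
    have "tr (X x * P x) - tr (X x * P y) - tr (X y * P x) + tr (X y * P y)
      = tr ((X x - X y) * (P x - P y))"
      by (simp add: mult_minus_distrib_mat[of _ n n _ n] minus_mult_distrib_mat[of _ n n _ _ n] tr_minus[of _ n])
    also have "\<dots> \<le> c * (tr ((outer x + outer y) * Q x) + tr ((outer x + outer y) * Q y))"
      unfolding eq[symmetric] P_def Q_def A_def c_def by (rule tr_swap_le[OF W that])
    finally show ?thesis by (simp add: add_mult_distrib_mat[of _ n n _ _ n] tr_add[of _ n])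
  qed
  \<comment> \<open>Average over \<open>y\<close> at fixed \<open>x\<close>. The mixed term with
    \<open>X y\<close> vanishes now; the one with \<open>P y\<close> retains the mean of
    \<open>P\<close> and vanishes when \<open>x\<close> is averaged in turn. Averaging one variable
    after the other stays on \<open>N\<close>, without a product space.\<close>
  have inner: "tr (X x * P x) - tr (X x * expect_mat N n P) + p
      \<le> c * (tr (outer x * Q x) + tr (cov * Q x) + (tr (outer x * expect_mat N n Q) + q))"
    if x: "x \<in> space N" for x
  proof -
    have "tr (X x * P x) - tr (X x * expect_mat N n P) + p
      = expectation (\<lambda>y. tr (X x * P x) - tr (X x * P y) - tr (X y * P x) + tr (X y * P y))"
      by (simp add: ints p_def integral_tr_mult_left[where n = n] integral_tr_mult_right[where n = n] EX Z prob_space)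
    also have "\<dots> \<le> expectation (\<lambda>y. c * (tr (outer x * Q x) + tr (outer y * Q x)
        + (tr (outer x * Q y) + tr (outer y * Q y))))"
      by (intro integral_mono swap x Bochner_Integration.integrable_add Bochner_Integration.integrable_diff
        integrable_mult_right ints integrable_const) auto
    also have "\<dots> = c * (tr (outer x * Q x) + tr (cov * Q x) + (tr (outer x * expect_mat N n Q) + q))"
      by (simp add: ints q_def integral_tr_mult_left[where n = n] integral_tr_mult_right[where n = n] prob_space flip: cov_def)
    finally show ?thesis .
  qed
  \<comment> \<open>Both diagonal terms of the expansion have mean \<open>p\<close>; this doubling
    matches that of \<open>q + r\<close> on the right.\<close>
  have "p + p = expectation (\<lambda>x. tr (X x * P x) - tr (X x * expect_mat N n P) + p)"
    by (simp add: ints p_def integral_tr_mult_left[where n = n] EX Z prob_space)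
  also have "\<dots> \<le> expectation (\<lambda>x. c * (tr (outer x * Q x) + tr (cov * Q x)
      + (tr (outer x * expect_mat N n Q) + q)))"
    by (intro integral_mono inner Bochner_Integration.integrable_add Bochner_Integration.integrable_diff
        integrable_mult_right ints integrable_const)
  also have "\<dots> = c * (q + r + (r + q))"
    by (simp add: ints q_def r_def integral_tr_mult_left[where n = n] integral_tr_mult_right[where n = n] prob_space flip: cov_def)
  finally have "p \<le> c * (q + r)" by (simp add: algebra_simps)
  also have "q + r = expectation (\<lambda>x. tr ((outer x + cov) * Q x))"
    by (simp add: q_def r_def ints add_mult_distrib_mat[of _ n n _ _ n] tr_add[of _ n])
  finally show ?thesis
    unfolding p_def c_def X_def P_def Q_def .
qed

text \<open>Fubini with one coordinate singled out. Applied to the difference of two integrands, it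
  integrates an inequality between expectations conditional on all other features.\<close>

lemma integral_PiM_coordinate_nonneg:
  fixes D :: "('i \<Rightarrow> 'a) \<Rightarrow> real"
  assumes "finite I" "j \<in> I" "integrable (PiM I (\<lambda>_. N)) D"
    and "\<And>x. x \<in> space (PiM (I - {j}) (\<lambda>_. N)) \<Longrightarrow> 0 \<le> (LINT y|N. D (x(j := y)))"
  shows "0 \<le> (LINT s|PiM I (\<lambda>_. N). D s)"
proof -
  interpret P: product_sigma_finite "\<lambda>_. N"
    by (simp add: product_sigma_finite_def sigma_finite_measure_axioms)
  have I: "insert j (I - {j}) = I" using assms(2) by auto
  have "(LINT s|PiM I (\<lambda>_. N). D s) = (LINT x|PiM (I - {j}) (\<lambda>_. N). LINT y|N. D (x(j := y)))"
    using P.product_integral_insert[of "I - {j}" j D] assms(1,3) unfolding I by simp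
  also have "0 \<le> \<dots>" using assms(4) by (rule Bochner_Integration.integral_nonneg)
  finally show ?thesis .
qed

lemma integral_PiM_component:
  fixes f :: "'a \<Rightarrow> real"
  assumes "bounded_rv N f" "j \<in> I"
  shows "(LINT s|PiM I (\<lambda>_. N). f (s j)) = expectation f"
proof -
  have "(LINT s|PiM I (\<lambda>_. N). f (s j)) = (LINT y|distr (PiM I (\<lambda>_. N)) N (\<lambda>s. s j). f y)"
    using assms by (intro integral_distr[symmetric]) (auto simp: bounded_rv_def)
  also have "distr (PiM I (\<lambda>_. N)) N (\<lambda>s. s j) = N"
    using assms prob_space_axioms by (intro distr_PiM_component)
  finally show ?thesis .
qed

section \<open>Moment recursion for the deviation matrix\<close>

lemma bounded_rmat_component:
  assumes "bounded_rmat M k F" "j \<in> I"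
  shows "bounded_rmat (PiM I (\<lambda>_. M)) k (\<lambda>s. F (s j))"
  using assms unfolding bounded_rmat_def
  by (auto intro!: bounded_rv_component[of M "\<lambda>x. F x $$ (_, _)"])

lemma tr_deviation_mult:
  assumes "B \<in> carrier_mat n n"
  shows "tr (deviation J s * B) = (\<Sum>j\<in>J. tr ((outer (s j) - cov) * B))"
proof -
  have "tr (deviation J s * B) = (\<Sum>i<n. \<Sum>k<n. \<Sum>j\<in>J. (outer (s j) - cov) $$ (i, k) * B $$ (k, i))"
    using assms by (simp add: tr_mult[of _ n] deviation_def sum_distrib_right)
  also have "\<dots> = (\<Sum>i<n. \<Sum>j\<in>J. \<Sum>k<n. (outer (s j) - cov) $$ (i, k) * B $$ (k, i))"
    by (intro sum.cong refl sum.swap)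
  also have "\<dots> = (\<Sum>j\<in>J. \<Sum>i<n. \<Sum>k<n. (outer (s j) - cov) $$ (i, k) * B $$ (k, i))"
    by (rule sum.swap)
  also have "\<dots> = (\<Sum>j\<in>J. tr ((outer (s j) - cov) * B))"
    using assms by (intro sum.cong refl tr_mult[symmetric]) auto
  finally show ?thesis .
qed

lemma bounded_deviation:
  assumes "J \<subseteq> I"
  shows "bounded_rmat (PiM I (\<lambda>_. N)) n (deviation J)"
proof -
  have "bounded_rmat N n (\<lambda>x. outer x - cov)"
    by (intro bounded_intros bounded_outer cov_carrier)
  then show ?thesis
    using assms by (auto simp: bounded_rmat_def deviation_def
        intro!: bounded_rv_sum bounded_rv_component[of N "\<lambda>x. (outer x - cov) $$ (_, _)"])
qed

lemma deviation_update:
  assumes "finite J" "j \<in> J"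
  shows "deviation J (x(j := y)) = deviation (J - {j}) x + (outer y - cov)"
proof (intro eq_matI)
  fix i k assume "i < dim_row (deviation (J - {j}) x + (outer y - cov))"
    "k < dim_col (deviation (J - {j}) x + (outer y - cov))"
  then have ik: "i < n" "k < n" by (auto simp: carrier_matD[OF cov_carrier])
  then have "deviation J (x(j := y)) $$ (i, k) = (outer y - cov) $$ (i, k)
      + (\<Sum>l\<in>J - {j}. (outer ((x(j := y)) l) - cov) $$ (i, k))"
    using assms by (simp add: deviation_def sum.remove)
  also have "(\<Sum>l\<in>J - {j}. (outer ((x(j := y)) l) - cov) $$ (i, k))
      = (\<Sum>l\<in>J - {j}. (outer (x l) - cov) $$ (i, k))"
    by (intro sum.cong) auto
  finally show "deviation J (x(j := y)) $$ (i, k) = (deviation (J - {j}) x + (outer y - cov)) $$ (i, k)"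
    using ik carrier_matD[OF cov_carrier] by (simp add: deviation_def)
qed (auto simp: deviation_def carrier_matD[OF cov_carrier])

lemma deviation_mult_pow: "deviation J s * deviation J s ^\<^sub>m k = deviation J s ^\<^sub>m Suc k"
  using pow_mat_add[OF deviation_carrier, of J s 1 k] by simp

text \<open>One factor of the even power is expanded as a sum over features. With the other features
  frozen into \<open>W\<close>, each summand falls under the inequality for a single feature.
  Summing back, the matrices \<open>outer (s j) + cov\<close> add up to the deviation plus
  \<open>2 * card J\<close> times \<open>cov\<close>.\<close>

lemma expectation_tr_power_recursion:
  fixes I J :: "'i set"
  assumes I: "finite I" and J: "J \<subseteq> I"
  defines "S \<equiv> PiM I (\<lambda>_. N)"
  shows "(LINT s|S. tr (deviation J s ^\<^sub>m (2 * Suc k)))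
    \<le> real ((2 * k + 1) * n) * ((LINT s|S. tr (deviation J s ^\<^sub>m Suc (2 * k)))
        + 2 * card J * (LINT s|S. tr (cov * deviation J s ^\<^sub>m (2 * k))))"
proof -
  interpret S: prob_space S
    unfolding S_def using prob_space_axioms by (intro prob_space_PiM)
  define c where "c = real ((2 * k + 1) * n)"
  have bdev: "bounded_rmat S n (deviation J)"
    unfolding S_def using J by (rule bounded_deviation)
  have bout: "bounded_rmat S n (\<lambda>s. outer (s j))" if "j \<in> J" for j
    using bounded_outer that J unfolding S_def by (intro bounded_rmat_component) auto
  have int1: "integrable S (\<lambda>s. tr ((outer (s j) + cov) * deviation J s ^\<^sub>m q))"
    and int2: "integrable S (\<lambda>s. tr ((outer (s j) - cov) * deviation J s ^\<^sub>m q))"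
    if "j \<in> J" for j q
    using that by (auto intro!: S.bounded_rv_integrable bounded_intros bdev bout)
  have int3: "integrable S (\<lambda>s. tr (cov * deviation J s ^\<^sub>m q))"
    and int4: "integrable S (\<lambda>s. tr (deviation J s ^\<^sub>m q))" for q
    by (auto intro!: S.bounded_rv_integrable bounded_intros bdev)
  have one: "(LINT s|S. tr ((outer (s j) - cov) * deviation J s ^\<^sub>m Suc (2 * k)))
    \<le> c * (LINT s|S. tr ((outer (s j) + cov) * deviation J s ^\<^sub>m (2 * k)))" if j: "j \<in> J" for j
  proof -
    have "0 \<le> (LINT s|S. c * tr ((outer (s j) + cov) * deviation J s ^\<^sub>m (2 * k))
        - tr ((outer (s j) - cov) * deviation J s ^\<^sub>m Suc (2 * k)))"
      unfolding S_def
    proof (rule integral_PiM_coordinate_nonneg[of I j])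
      show "integrable (PiM I (\<lambda>_. N)) (\<lambda>s. c * tr ((outer (s j) + cov) * deviation J s ^\<^sub>m (2 * k))
        - tr ((outer (s j) - cov) * deviation J s ^\<^sub>m Suc (2 * k)))"
        unfolding S_def[symmetric]
        by (intro Bochner_Integration.integrable_diff integrable_mult_right int1 int2 j)
    next
      fix x :: "'i \<Rightarrow> 'a"
      define W where "W = deviation (J - {j}) x"
      have W: "W \<in> carrier_mat n n" "W\<^sup>T = W" by (auto simp: W_def)
      have upd: "deviation J (x(j := y)) = W + (outer y - cov)" for y
        unfolding W_def using j finite_subset[OF J I] by (rule deviation_update[rotated])
      have bW: "bounded_rmat N n (\<lambda>y. W + (outer y - cov))"
        using W by (intro bounded_intros bounded_outer cov_carrier)
      have "integrable N (\<lambda>y. tr ((outer y + cov) * (W + (outer y - cov)) ^\<^sub>m (2 * k)))"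
        "integrable N (\<lambda>y. tr ((outer y - cov) * (W + (outer y - cov)) ^\<^sub>m Suc (2 * k)))"
        using bW W by (auto intro!: bounded_rv_integrable bounded_intros bounded_outer simp del: pow_mat.simps)
      then show "0 \<le> (LINT y|N. c * tr ((outer ((x(j := y)) j) + cov) * deviation J (x(j := y)) ^\<^sub>m (2 * k))
        - tr ((outer ((x(j := y)) j) - cov) * deviation J (x(j := y)) ^\<^sub>m Suc (2 * k)))"
        unfolding upd fun_upd_same
        using expectation_tr_odd_power_le[OF W, of k] by (simp add: c_def del: pow_mat.simps)
    qed (use I J j in auto)
    then show ?thesis
      by (simp add: int1 int2 j del: pow_mat.simps)
  qed
  have "(LINT s|S. tr (deviation J s ^\<^sub>m (2 * Suc k)))
    = (LINT s|S. (\<Sum>j\<in>J. tr ((outer (s j) - cov) * deviation J s ^\<^sub>m Suc (2 * k))))"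
  proof -
    have "tr (deviation J s ^\<^sub>m (2 * Suc k))
      = (\<Sum>j\<in>J. tr ((outer (s j) - cov) * deviation J s ^\<^sub>m Suc (2 * k)))" for s
      unfolding tr_deviation_mult[OF pow_mat_carrier[OF deviation_carrier], symmetric]
        deviation_mult_pow by simp
    then show ?thesis by simp
  qed
  also have "\<dots> = (\<Sum>j\<in>J. LINT s|S. tr ((outer (s j) - cov) * deviation J s ^\<^sub>m Suc (2 * k)))"
    by (intro Bochner_Integration.integral_sum int2)
  also have "\<dots> \<le> (\<Sum>j\<in>J. c * (LINT s|S. tr ((outer (s j) + cov) * deviation J s ^\<^sub>m (2 * k))))"
    by (intro sum_mono one)
  also have "\<dots> = c * (LINT s|S. (\<Sum>j\<in>J. tr ((outer (s j) + cov) * deviation J s ^\<^sub>m (2 * k))))"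
    by (simp add: sum_distrib_left int1 Bochner_Integration.integral_sum)
  also have "(\<lambda>s. \<Sum>j\<in>J. tr ((outer (s j) + cov) * deviation J s ^\<^sub>m (2 * k)))
    = (\<lambda>s. tr (deviation J s ^\<^sub>m Suc (2 * k)) + 2 * card J * tr (cov * deviation J s ^\<^sub>m (2 * k)))"
  proof
    fix s :: "'i \<Rightarrow> 'a"
    define B where "B = deviation J s ^\<^sub>m (2 * k)"
    have B: "B \<in> carrier_mat n n" by (simp add: B_def)
    have "(\<Sum>j\<in>J. tr ((outer (s j) + cov) * B)) = (\<Sum>j\<in>J. tr ((outer (s j) - cov) * B) + 2 * tr (cov * B))"
      using B by (intro sum.cong refl) (simp add: add_mult_distrib_mat[of _ n n _ _ n]
          minus_mult_distrib_mat[of _ n n _ _ n] tr_add[of _ n] tr_minus[of _ n])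
    also have "\<dots> = tr (deviation J s * B) + 2 * card J * tr (cov * B)"
      using B by (simp add: tr_deviation_mult sum.distrib)
    finally show "(\<Sum>j\<in>J. tr ((outer (s j) + cov) * deviation J s ^\<^sub>m (2 * k)))
      = tr (deviation J s ^\<^sub>m Suc (2 * k)) + 2 * card J * tr (cov * deviation J s ^\<^sub>m (2 * k))"
      by (simp only: B_def deviation_mult_pow)
  qed
  also have "(LINT s|S. tr (deviation J s ^\<^sub>m Suc (2 * k)) + 2 * card J * tr (cov * deviation J s ^\<^sub>m (2 * k)))
    = (LINT s|S. tr (deviation J s ^\<^sub>m Suc (2 * k))) + 2 * card J * (LINT s|S. tr (cov * deviation J s ^\<^sub>m (2 * k)))"
    by (simp add: int3 int4 del: pow_mat.simps)
  finally show ?thesis by (simp only: c_def)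
qed

text \<open>Half of the new moment is absorbed on the left. What remains is c^2 / 2 times the
  previous even moment from AM-GM and 2 c |J| \<kappa> times it from \<open>cov\<close>; doubling
  gives the factor. The coefficient \<open>b\<close> of level \<open>q\<close> dominates those of
  all levels k \<le> q, so one factor serves throughout.\<close>

lemma expectation_tr_even_power_le:
  fixes I J :: "'i set" and \<kappa> b :: real and q :: nat
  assumes I: "finite I" and J: "J \<subseteq> I"
    and \<kappa>: "0 \<le> \<kappa>" "\<And>v. v \<in> carrier_vec n \<Longrightarrow> v \<bullet> (cov *\<^sub>v v) \<le> \<kappa> * (v \<bullet> v)"
  defines "S \<equiv> PiM I (\<lambda>_. N)" and "b \<equiv> real ((2 * q + 1) * n)"
  shows "k \<le> q \<Longrightarrow> (LINT s|S. tr (deviation J s ^\<^sub>m (2 * Suc k)))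
    \<le> (b\<^sup>2 + 4 * b * card J * \<kappa>) ^ k * (2 * n * card J * tr cov)"
proof (induction k)
  interpret S: prob_space S
    unfolding S_def using prob_space_axioms by (intro prob_space_PiM)
  have bdev: "bounded_rmat S n (deviation J)"
    unfolding S_def using J by (rule bounded_deviation)
  have int3: "integrable S (\<lambda>s. tr (cov * deviation J s ^\<^sub>m q))"
    and int4: "integrable S (\<lambda>s. tr (deviation J s ^\<^sub>m q))" for q
    by (auto intro!: S.bounded_rv_integrable bounded_intros bdev)
  {
    \<comment> \<open>The odd moment left by the recursion is now the mean of the trace itself,
      which is 0. Of the right-hand side only \<open>2 * n * card J * tr cov\<close> survives, and
      this is where the trace of \<open>cov\<close> enters.\<close>
    case 0
    have bo: "bounded_rv N (\<lambda>x. tr (outer x * 1\<^sub>m n))"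
        by (intro bounded_rv_tr[of _ n] bounded_rmat_mult bounded_rmat_const bounded_outer one_carrier_mat)
    have "tr (deviation J s ^\<^sub>m Suc (2 * 0)) = (\<Sum>j\<in>J. tr ((outer (s j) - cov) * 1\<^sub>m n))" for s
      using tr_deviation_mult[of "1\<^sub>m n" J s] by (simp add: right_mult_one_mat[of _ n n])
    then have "(LINT s|S. tr (deviation J s ^\<^sub>m Suc (2 * 0))) = (LINT s|S. (\<Sum>j\<in>J. tr (outer (s j) * 1\<^sub>m n) - tr cov))"
      by (simp add: right_mult_one_mat[of _ n n] tr_minus[of _ n])
    also have "\<dots> = (\<Sum>j\<in>J. LINT s|S. tr (outer (s j) * 1\<^sub>m n) - tr cov)"
      using J by (intro Bochner_Integration.integral_sum S.bounded_rv_integrable bounded_rv_diff bounded_rv_const)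
        (auto simp: S_def intro!: bounded_rv_component[OF bo])
    also have "\<dots> = (\<Sum>j\<in>J. 0)"
    proof (intro sum.cong refl)
      fix j assume "j \<in> J"
      then have j: "j \<in> I" using J by auto
      have "(LINT s|S. tr (outer (s j) * 1\<^sub>m n)) = tr cov"
        unfolding S_def integral_PiM_component[OF bo j]
        using integral_tr_mult_left[OF bounded_outer one_carrier_mat]
        by (simp add: right_mult_one_mat[of _ n n] flip: cov_def)
      moreover have "integrable S (\<lambda>s. tr (outer (s j) * 1\<^sub>m n))"
        unfolding S_def using bounded_rv_component[OF bo j] S.bounded_rv_integrable S_def by blast
      ultimately show "(LINT s|S. tr (outer (s j) * 1\<^sub>m n) - tr cov) = 0"
        by (simp add: S.prob_space)
    qed
    finally have "(LINT s|S. tr (deviation J s ^\<^sub>m Suc (2 * 0))) = 0" by simp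
    then show ?case
      using expectation_tr_power_recursion[OF I J, of 0]
      by (simp add: S_def[symmetric] right_mult_one_mat[of _ n n] carrier_matD[OF deviation_carrier] S.prob_space
          del: pow_mat.simps(2))
  next
    case (Suc k)
    define T where "T k = (LINT s|S. tr (deviation J s ^\<^sub>m (2 * k)))" for k
    define c where "c = real ((2 * Suc k + 1) * n)"
    have "2 * Suc k + 1 \<le> 2 * q + 1" using Suc.prems by simp
    from mult_le_mono1[OF this, of n] have c: "0 \<le> c" "c \<le> b"
      unfolding c_def b_def of_nat_le_iff by simp_all
    have odd: "c * (LINT s|S. tr (deviation J s ^\<^sub>m Suc (2 * Suc k))) \<le> T (Suc (Suc k)) / 2 + c\<^sup>2 / 2 * T (Suc k)"
    proof -
      have "c * tr (deviation J s ^\<^sub>m Suc (2 * Suc k))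
        \<le> tr (deviation J s ^\<^sub>m (2 * Suc (Suc k))) / 2 + c\<^sup>2 / 2 * tr (deviation J s ^\<^sub>m (2 * Suc k))" for s
      proof -
        define A where "A = deviation J s"
        have A: "A \<in> carrier_mat n n" "A\<^sup>T = A" by (auto simp: A_def)
        have U: "(c \<cdot>\<^sub>m A ^\<^sub>m i)\<^sup>T = c \<cdot>\<^sub>m A ^\<^sub>m i" for i c
        proof -
          have "(c \<cdot>\<^sub>m A ^\<^sub>m i)\<^sup>T = c \<cdot>\<^sub>m (A ^\<^sub>m i)\<^sup>T" by (intro eq_matI) auto
          then show ?thesis by (simp add: pow_mat_sym[OF A])
        qed
        have V: "tr ((c \<cdot>\<^sub>m A ^\<^sub>m i) * (d \<cdot>\<^sub>m A ^\<^sub>m j)) = c * d * tr (A ^\<^sub>m (i + j))" for i j c d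
          using A by (simp add: pow_mat_add[of A n] mult_smult_assoc_mat[of _ n n _ n]
              mult_smult_distrib[of _ n n _ n] tr_smult[of _ n])
        \<comment> \<open>AM-GM for \<open>c\<close> times the power k+1 and for the power k+2,
          whose exponents add up to the odd number 2k+3.\<close>
        have "2 * (c * 1 * tr (A ^\<^sub>m (Suc k + Suc (Suc k))))
          \<le> c * c * tr (A ^\<^sub>m (Suc k + Suc k)) + 1 * 1 * tr (A ^\<^sub>m (Suc (Suc k) + Suc (Suc k)))"
          using two_tr_transpose_mult_le[of "c \<cdot>\<^sub>m A ^\<^sub>m Suc k" n "1 \<cdot>\<^sub>m A ^\<^sub>m Suc (Suc k)"] A(1)
          unfolding U V by (metis smult_carrier_mat pow_mat_carrier)
        moreover have "Suc k + Suc (Suc k) = Suc (2 * Suc k)" "Suc k + Suc k = 2 * Suc k"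
          "Suc (Suc k) + Suc (Suc k) = 2 * Suc (Suc k)" by auto
        ultimately show ?thesis unfolding A_def by (simp only: power2_eq_square) (simp add: field_simps)
      qed
      then have "(LINT s|S. c * tr (deviation J s ^\<^sub>m Suc (2 * Suc k)))
        \<le> (LINT s|S. tr (deviation J s ^\<^sub>m (2 * Suc (Suc k))) / 2 + c\<^sup>2 / 2 * tr (deviation J s ^\<^sub>m (2 * Suc k)))"
        by (intro integral_mono Bochner_Integration.integrable_add integrable_mult_right integrable_divide int4)
      then show ?thesis unfolding T_def by (simp only: Bochner_Integration.integral_add integrable_mult_right
          integrable_divide int4 integral_mult_right_zero integral_divide_zero)
    qed
    have ev: "(LINT s|S. tr (cov * deviation J s ^\<^sub>m (2 * Suc k))) \<le> \<kappa> * T (Suc k)"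
    proof -
      have "tr (cov * deviation J s ^\<^sub>m (2 * Suc k)) \<le> \<kappa> * tr (deviation J s ^\<^sub>m (2 * Suc k))" for s
      proof -
        have "tr (cov * deviation J s ^\<^sub>m (2 * Suc k)) \<le> tr ((\<kappa> \<cdot>\<^sub>m 1\<^sub>m n) * deviation J s ^\<^sub>m (2 * Suc k))"
          by (intro tr_mult_even_power_mono[of _ n]) (auto simp: smult_mat_mult_vec[of _ n n] \<kappa>)
        also have "\<dots> = \<kappa> * tr (deviation J s ^\<^sub>m (2 * Suc k))"
          using pow_mat_carrier[OF deviation_carrier, of J s "2 * Suc k"]
          by (simp only: mult_smult_assoc_mat[OF one_carrier_mat] left_mult_one_mat tr_smult)
        finally show ?thesis .
      qed
      then have "(LINT s|S. tr (cov * deviation J s ^\<^sub>m (2 * Suc k))) \<le> (LINT s|S. \<kappa> * tr (deviation J s ^\<^sub>m (2 * Suc k)))"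
        by (intro integral_mono int3 integrable_mult_right int4)
      then show ?thesis by (simp only: T_def integral_mult_right_zero)
    qed
    have T0: "0 \<le> T k" for k
      unfolding T_def by (intro Bochner_Integration.integral_nonneg) (simp add: tr_even_power[of _ n] sum_nonneg)
    have "T (Suc (Suc k)) \<le> c * ((LINT s|S. tr (deviation J s ^\<^sub>m Suc (2 * Suc k)))
        + 2 * card J * (LINT s|S. tr (cov * deviation J s ^\<^sub>m (2 * Suc k))))"
      unfolding T_def c_def S_def by (rule expectation_tr_power_recursion[OF I J])
    also have "\<dots> \<le> T (Suc (Suc k)) / 2 + c\<^sup>2 / 2 * T (Suc k) + c * (2 * card J * (\<kappa> * T (Suc k)))"
      unfolding distrib_left using c by (intro add_mono odd mult_left_mono ev) auto
    finally have "T (Suc (Suc k)) \<le> (c\<^sup>2 + 4 * c * card J * \<kappa>) * T (Suc k)"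
      by (simp add: algebra_simps)
    also have "\<dots> \<le> (b\<^sup>2 + 4 * b * card J * \<kappa>) * T (Suc k)"
      using c \<kappa>(1) by (intro mult_right_mono T0 add_mono power_mono mult_mono) auto
    also have "\<dots> \<le> (b\<^sup>2 + 4 * b * card J * \<kappa>) * ((b\<^sup>2 + 4 * b * card J * \<kappa>) ^ k * (2 * n * card J * tr cov))"
      using Suc c \<kappa>(1) unfolding T_def by (intro mult_left_mono) auto
    finally show ?case unfolding T_def by (simp add: mult_ac)
  }
qed

section \<open>Tail bounds for the deviation matrix\<close>

lemma tr_cov_nonneg: "0 \<le> tr cov"
  unfolding tr_def
  by (auto simp: cov_def expect_mat_def outer_def intro!: sum_nonneg Bochner_Integration.integral_nonneg)

text \<open>Markov's inequality for an even trace moment. The base moment is at most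
  \<open>Q * (tr cov / \<kappa>)\<close>, so it counts as one more factor \<open>Q\<close> at the
  price of the intrinsic dimension \<open>tr cov / \<kappa>\<close>. The denominator 3 is an upper
  bound for e, chosen so that about ln (1/\<delta>) plus the logarithm of the intrinsic dimension
  many factors suffice.\<close>

lemma deviation_tail:
  fixes I J :: "'i set" and \<kappa> x :: real and q :: nat
  assumes I: "finite I" and J: "J \<subseteq> I"
    and \<kappa>: "0 < \<kappa>" "\<And>v. v \<in> carrier_vec n \<Longrightarrow> v \<bullet> (cov *\<^sub>v v) \<le> \<kappa> * (v \<bullet> v)"
    and x: "0 < x" "(real ((2 * q + 1) * n))\<^sup>2 + 4 * real ((2 * q + 1) * n) * card J * \<kappa> \<le> x\<^sup>2 / 3"
  defines "S \<equiv> PiM I (\<lambda>_. N)"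
  shows "{s \<in> space S. tr (deviation J s ^\<^sub>m (2 * Suc q)) \<ge> x ^ (2 * Suc q)} \<in> sets S"
    and "measure S {s \<in> space S. tr (deviation J s ^\<^sub>m (2 * Suc q)) \<ge> x ^ (2 * Suc q)}
      \<le> tr cov / \<kappa> * (1 / 3) ^ Suc q"
proof -
  interpret S: prob_space S
    unfolding S_def using prob_space_axioms by (intro prob_space_PiM)
  define u where "u s = tr (deviation J s ^\<^sub>m (2 * Suc q))" for s
  define b where "b = real ((2 * q + 1) * n)"
  define Q where "Q = b\<^sup>2 + 4 * b * card J * \<kappa>"
  have bu: "bounded_rv S u"
    unfolding u_def S_def by (intro bounded_rv_tr[of _ n] bounded_rmat_pow bounded_deviation J)
  have [measurable]: "u \<in> borel_measurable S" using bu by (simp add: bounded_rv_def)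
  show "{s \<in> space S. tr (deviation J s ^\<^sub>m (2 * Suc q)) \<ge> x ^ (2 * Suc q)} \<in> sets S"
    unfolding u_def[symmetric] by measurable
  have b: "real n \<le> b" "0 \<le> b" by (simp_all add: b_def)
  have "0 \<le> Q" unfolding Q_def using b \<kappa>(1) by simp
  have "2 * n * card J * \<kappa> \<le> Q"
  proof -
    have "2 * n * card J * \<kappa> \<le> 4 * b * card J * \<kappa>"
      using mult_right_mono[of "2 * real n" "4 * b" "real (card J)"] b \<kappa>(1)
      by (intro mult_right_mono) auto
    then show ?thesis unfolding Q_def by (smt (verit) zero_le_power2)
  qed
  then have "2 * n * card J * \<kappa> * (tr cov / \<kappa>) \<le> Q * (tr cov / \<kappa>)"
    using tr_cov_nonneg \<kappa>(1) by (intro mult_right_mono) auto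
  then have lin: "2 * n * card J * tr cov \<le> Q * (tr cov / \<kappa>)" using \<kappa>(1) by simp
  have "(LINT s|S. u s) \<le> Q ^ q * (2 * n * card J * tr cov)"
    unfolding u_def Q_def b_def S_def using I J \<kappa> by (intro expectation_tr_even_power_le) auto
  also have "\<dots> \<le> Q ^ q * (Q * (tr cov / \<kappa>))"
    using lin \<open>0 \<le> Q\<close> by (intro mult_left_mono) auto
  also have "\<dots> = Q ^ Suc q * (tr cov / \<kappa>)" by simp
  also have "\<dots> \<le> (x\<^sup>2 / 3) ^ Suc q * (tr cov / \<kappa>)"
    using x(2) \<open>0 \<le> Q\<close> tr_cov_nonneg \<kappa>(1)
    by (intro mult_right_mono power_mono) (auto simp: Q_def b_def)
  also have "\<dots> = x ^ (2 * Suc q) * (tr cov / \<kappa> * (1 / 3) ^ Suc q)"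
    unfolding power_divide power_mult power_one by simp
  finally have T: "(LINT s|S. u s) \<le> x ^ (2 * Suc q) * (tr cov / \<kappa> * (1 / 3) ^ Suc q)" .
  have "measure S {s \<in> space S. u s \<ge> x ^ (2 * Suc q)} \<le> (LINT s|S. u s) / x ^ (2 * Suc q)"
  proof (rule integral_Markov_inequality_measure[where A = "{}"])
    show "AE s in S. 0 \<le> u s"
      unfolding u_def by (simp only: tr_even_power[OF deviation_carrier deviation_sym]) (simp add: sum_nonneg)
  qed (use bu x(1) S.bounded_rv_integrable in auto)
  also have "\<dots> \<le> tr cov / \<kappa> * (1 / 3) ^ Suc q"
    using T x(1) by (simp add: divide_le_eq mult.commute)
  finally show "measure S {s \<in> space S. tr (deviation J s ^\<^sub>m (2 * Suc q)) \<ge> x ^ (2 * Suc q)}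
      \<le> tr cov / \<kappa> * (1 / 3) ^ Suc q"
    unfolding u_def .
qed

text \<open>The sample size is given by an equation because the radius will later be chosen to solve
  it. \<open>B\<close> limits how far the radius may exceed \<kappa>; within this range the
  quadratic term of the moment factor stays below a fraction of the squared threshold, as the linear
  one does.\<close>

lemma deviation_concentration:
  fixes I J :: "'i set" and \<kappa> \<delta> \<delta>\<^sub>0 B s\<^sub>0 :: real
  assumes I: "finite I" and J: "J \<subseteq> I"
    and \<kappa>: "0 < \<kappa>" "\<And>v. v \<in> carrier_vec n \<Longrightarrow> v \<bullet> (cov *\<^sub>v v) \<le> \<kappa> * (v \<bullet> v)" "\<kappa> \<le> tr cov"
    and \<delta>: "0 < \<delta>" "\<delta> \<le> \<delta>\<^sub>0" "\<delta>\<^sub>0 < 1"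
    and s0: "0 < s\<^sub>0" "s\<^sub>0 \<le> B * \<kappa>" and B: "1 \<le> B" and J0: "0 < card J"
    and m: "real (card J) = 32 * (1 + 1 / ln (1 / \<delta>\<^sub>0)) * B\<^sup>2 * n * \<kappa> * ln (tr cov / (\<kappa> * \<delta>)) / s\<^sub>0\<^sup>2"
  defines "S \<equiv> PiM I (\<lambda>_. N)"
  shows "\<exists>E\<in>sets S. measure S E \<le> \<delta> \<and>
    (\<forall>s\<in>space S - E. \<forall>v\<in>carrier_vec n. vnorm (deviation J s *\<^sub>v v) \<le> card J * s\<^sub>0 * vnorm v)"
proof -
  define m where "m = real (card J)"
  define lg where "lg = ln (tr cov / (\<kappa> * \<delta>))"
  define c where "c = 1 + 1 / ln (1 / \<delta>\<^sub>0)"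
  have m': "m = 32 * c * B\<^sup>2 * n * \<kappa> * lg / s\<^sub>0\<^sup>2"
    unfolding m_def c_def lg_def by (rule m)
  have m0: "0 < m" using J0 by (simp add: m_def)
  have l0: "0 < ln (1 / \<delta>\<^sub>0)" using \<delta> by (intro ln_gt_zero) auto
  have "1 / \<delta>\<^sub>0 \<le> 1 / \<delta>" using \<delta> by (intro divide_left_mono) auto
  also have "\<dots> \<le> tr cov / \<kappa> / \<delta>"
    using \<kappa> \<delta> by (intro divide_right_mono) auto
  finally have "ln (1 / \<delta>\<^sub>0) \<le> lg" using \<delta> \<kappa> unfolding lg_def by (intro ln_mono) auto
  then have l: "0 < lg" "ln (1 / \<delta>\<^sub>0) \<le> lg" using l0 by auto
  \<comment> \<open>\<open>Suc q\<close> is the ceiling of \<open>lg\<close>: large enough for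
    3^(-(q+1)) to outweigh the intrinsic dimension divided by \<delta>, yet at most
    \<open>lg + 1\<close>, which \<open>c * lg\<close> dominates thanks to
    \<open>\<delta>\<^sub>0\<close>.\<close>
  define q where "q = nat \<lceil>lg\<rceil> - 1"
  have q: "lg \<le> real (Suc q)" "real (Suc q) \<le> lg + 1" using l unfolding q_def by linarith+
  have "lg + 1 \<le> c * lg"
    using l0 l by (simp add: c_def distrib_right)
  then have "real (2 * q + 1) \<le> 2 * (c * lg)" using q by simp
  then have "real ((2 * q + 1) * n) \<le> 2 * (c * lg) * n"
    unfolding of_nat_mult[of "2 * q + 1"] by (intro mult_right_mono) auto
  \<comment> \<open>Here 32 = 2 * 16 is used: with 16 in the denominator the two terms of the moment
    factor come out as at most 1/256 and 1/4 of \<open>(m * s\<^sub>0)\<^sup>2\<close>, together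
    below the required 1/3.\<close>
  also have "2 * (c * lg) * n = m * s\<^sub>0\<^sup>2 / (16 * B\<^sup>2 * \<kappa>)"
    unfolding m' using s0 B \<kappa>(1) by (simp add: field_simps)
  finally have b: "real ((2 * q + 1) * n) \<le> m * s\<^sub>0\<^sup>2 / (16 * B\<^sup>2 * \<kappa>)" (is "?b \<le> ?b'") .
  have "1 \<le> B\<^sup>2" using B by simp
  then have iB: "1 / B\<^sup>2 \<le> 1" using B by (simp add: pos_divide_le_eq)
  have sB: "s\<^sub>0\<^sup>2 / (B\<^sup>2 * \<kappa>\<^sup>2) \<le> 1"
    using power_mono[OF s0(2), of 2] s0(1) \<kappa>(1) B by (simp add: power_mult_distrib divide_le_eq)
  have "?b\<^sup>2 \<le> ?b'\<^sup>2" using b by (intro power_mono) auto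
  also have "?b'\<^sup>2 = (m * s\<^sub>0)\<^sup>2 / 256 * (s\<^sub>0\<^sup>2 / (B\<^sup>2 * \<kappa>\<^sup>2)) * (1 / B\<^sup>2)"
    using B \<kappa>(1) by (simp add: power_mult_distrib power_divide field_simps power2_eq_square)
  also have "\<dots> \<le> (m * s\<^sub>0)\<^sup>2 / 256 * 1 * 1"
    using sB iB by (intro mult_mono) auto
  finally have 1: "?b\<^sup>2 \<le> (m * s\<^sub>0)\<^sup>2 / 256" by simp
  have "4 * ?b * m * \<kappa> \<le> 4 * ?b' * m * \<kappa>"
    using b m0 \<kappa>(1) by (intro mult_right_mono mult_left_mono) auto
  also have "\<dots> = (m * s\<^sub>0)\<^sup>2 / 4 * (1 / B\<^sup>2)"
    using B \<kappa>(1) by (simp add: power_mult_distrib field_simps power2_eq_square)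
  also have "\<dots> \<le> (m * s\<^sub>0)\<^sup>2 / 4 * 1"
    using iB by (intro mult_left_mono) auto
  finally have 2: "4 * ?b * m * \<kappa> \<le> (m * s\<^sub>0)\<^sup>2 / 4" by simp
  have Q: "?b\<^sup>2 + 4 * ?b * card J * \<kappa> \<le> (m * s\<^sub>0)\<^sup>2 / 3"
    using 1 2 zero_le_power2[of "m * s\<^sub>0"] unfolding m_def[symmetric] by linarith
  note tail = deviation_tail[OF I J \<kappa>(1,2) mult_pos_pos[OF m0 s0(1)] Q, folded S_def]
  define E where "E = {s \<in> space S. tr (deviation J s ^\<^sub>m (2 * Suc q)) \<ge> (m * s\<^sub>0) ^ (2 * Suc q)}"
  have "(1 / 3 :: real) ^ Suc q \<le> exp (- 1) ^ Suc q"
    using exp_le by (intro power_mono) (auto simp: exp_minus field_simps)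
  also have "\<dots> = exp (- real (Suc q))" by (subst exp_of_nat_mult[symmetric]) simp
  also have "\<dots> \<le> exp (- lg)" using q by simp
  also have "\<dots> = \<kappa> * \<delta> / tr cov"
    using \<kappa> \<delta> by (simp add: lg_def exp_minus)
  finally have "tr cov / \<kappa> * (1 / 3) ^ Suc q \<le> tr cov / \<kappa> * (\<kappa> * \<delta> / tr cov)"
    using \<kappa> by (intro mult_left_mono) auto
  also have "\<dots> = \<delta>" using \<kappa> by simp
  finally have "measure S E \<le> \<delta>" using tail(2) unfolding E_def by simp
  moreover have "vnorm (deviation J s *\<^sub>v v) \<le> card J * s\<^sub>0 * vnorm v"
    if "s \<in> space S - E" "v \<in> carrier_vec n" for s v
    using that m0 s0(1) unfolding m_def[symmetric]
    by (intro vnorm_le_of_tr_even_power_le[of _ n _ "Suc q"]) (auto simp: E_def simp del: pow_mat.simps)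
  ultimately show ?thesis using tail(1) unfolding E_def[symmetric] by blast
qed

end

section \<open>The spectral norm\<close>

lemma vnorm_mult_le_frobenius:
  fixes A :: "real mat"
  assumes "A \<in> carrier_mat n n" "v \<in> carrier_vec n"
  shows "vnorm (A *\<^sub>v v) \<le> sqrt (\<Sum>i<n. \<Sum>j<n. (A $$ (i, j))\<^sup>2) * vnorm v"
  using real_sqrt_le_mono[OF vnorm_mult_mat_vec_le[OF assms]] by (simp add: real_sqrt_mult)

text \<open>The Frobenius norm is an upper bound, which makes the supremum in
  \<open>spec_norm\<close> a genuine one.\<close>

lemma bdd_above_spec_norm:
  assumes "A \<in> carrier_mat n n"
  shows "bdd_above {vnorm (A *\<^sub>v v) | v. v \<in> carrier_vec (dim_col A) \<and> vnorm v \<le> 1}"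
proof (rule bdd_aboveI)
  fix x assume "x \<in> {vnorm (A *\<^sub>v v) | v. v \<in> carrier_vec (dim_col A) \<and> vnorm v \<le> 1}"
  then obtain v where v: "x = vnorm (A *\<^sub>v v)" "v \<in> carrier_vec n" "vnorm v \<le> 1"
    using assms by auto
  have "x \<le> sqrt (\<Sum>i<n. \<Sum>j<n. (A $$ (i, j))\<^sup>2) * vnorm v"
    using vnorm_mult_le_frobenius[OF assms v(2)] v(1) by simp
  also have "\<dots> \<le> sqrt (\<Sum>i<n. \<Sum>j<n. (A $$ (i, j))\<^sup>2) * 1"
    using v(3) by (intro mult_left_mono) (auto intro!: sum_nonneg)
  finally show "x \<le> sqrt (\<Sum>i<n. \<Sum>j<n. (A $$ (i, j))\<^sup>2) * 1" .
qed

lemma spec_norm_upper: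
  assumes "A \<in> carrier_mat n n" "v \<in> carrier_vec n" "vnorm v \<le> 1"
  shows "vnorm (A *\<^sub>v v) \<le> spec_norm A"
  unfolding spec_norm_def using assms by (intro cSup_upper bdd_above_spec_norm) auto

lemma spec_norm_nonneg: "A \<in> carrier_mat n n \<Longrightarrow> 0 \<le> spec_norm A"
  by (rule order_trans[OF vnorm_nonneg spec_norm_upper[of A n "0\<^sub>v n"]]) auto

lemma vnorm_mult_le_spec_norm:
  assumes A: "A \<in> carrier_mat n n" and v: "v \<in> carrier_vec n"
  shows "vnorm (A *\<^sub>v v) \<le> spec_norm A * vnorm v"
proof (cases "vnorm v = 0")
  case True
  then have "v = 0\<^sub>v n" using v by (simp add: vnorm_eq_0_iff)
  moreover have "A *\<^sub>v 0\<^sub>v n = 0\<^sub>v n" using A by (intro eq_vecI) auto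
  ultimately show ?thesis by simp
next
  case False
  then have pos: "0 < vnorm v" using vnorm_nonneg[of v] by linarith
  have "vnorm (A *\<^sub>v ((1 / vnorm v) \<cdot>\<^sub>v v)) \<le> spec_norm A"
    using A v pos by (intro spec_norm_upper) (auto simp: vnorm_smult)
  also have "A *\<^sub>v ((1 / vnorm v) \<cdot>\<^sub>v v) = (1 / vnorm v) \<cdot>\<^sub>v (A *\<^sub>v v)"
    using A v by (rule mult_mat_vec)
  finally show ?thesis using pos by (simp add: vnorm_smult divide_le_eq)
qed

lemma spec_norm_le:
  assumes "A \<in> carrier_mat n n" "0 \<le> c"
    and "\<And>v. v \<in> carrier_vec n \<Longrightarrow> vnorm (A *\<^sub>v v) \<le> c * vnorm v"
  shows "spec_norm A \<le> c"
  unfolding spec_norm_def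
proof (rule cSup_least)
  have "vnorm (A *\<^sub>v 0\<^sub>v n) \<in> {vnorm (A *\<^sub>v v) | v. v \<in> carrier_vec (dim_col A) \<and> vnorm v \<le> 1}"
    using assms(1) by auto
  then show "{vnorm (A *\<^sub>v v) | v. v \<in> carrier_vec (dim_col A) \<and> vnorm v \<le> 1} \<noteq> {}" by blast
next
  fix x assume "x \<in> {vnorm (A *\<^sub>v v) | v. v \<in> carrier_vec (dim_col A) \<and> vnorm v \<le> 1}"
  then obtain v where v: "x = vnorm (A *\<^sub>v v)" "v \<in> carrier_vec n" "vnorm v \<le> 1"
    using assms by auto
  have "x \<le> c * vnorm v" using assms(3)[OF v(2)] v(1) by simp
  also have "\<dots> \<le> c * 1" using v(3) assms(2) by (intro mult_left_mono)
  finally show "x \<le> c" by simp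
qed


section \<open>Inverses of coercive matrices\<close>

lemma mat_inverse_nonsingular:
  fixes A :: "real mat"
  assumes A: "A \<in> carrier_mat n n" and det: "det A \<noteq> 0"
  obtains B where "mat_inverse A = Some B" "B \<in> carrier_mat n n" "A * B = 1\<^sub>m n" "B * A = 1\<^sub>m n"
proof (cases "mat_inverse A")
  case None
  then have "A \<notin> Units (ring_mat TYPE(real) n ())" using mat_inverse(1)[OF A, where b = "()"] by blast
  then show thesis using det_non_zero_imp_unit[OF A det, where b = "()"] by blast
next
  case (Some B)
  then show thesis using mat_inverse(2)[OF A] that by blast
qed

text \<open>Coercivity excludes a kernel, so \<open>mat_inv A\<close> is the true inverse and not
  its default value 0. Testing coercivity at y with A y = x and applying Cauchy-Schwarz bounds the
  norm of y.\<close>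

lemma coercive_mat_inv:
  fixes A :: "real mat"
  assumes A: "A \<in> carrier_mat n n" and "0 < c"
    and coer: "\<And>v. v \<in> carrier_vec n \<Longrightarrow> c * (v \<bullet> v) \<le> v \<bullet> (A *\<^sub>v v)"
  shows "mat_inv A \<in> carrier_mat n n" "mat_inv A * A = 1\<^sub>m n"
    and "x \<in> carrier_vec n \<Longrightarrow> vnorm (mat_inv A *\<^sub>v x) \<le> vnorm x / c"
proof -
  have "det A \<noteq> 0"
  proof
    assume "det A = 0"
    then obtain v where v: "v \<in> carrier_vec n" "v \<noteq> 0\<^sub>v n" "A *\<^sub>v v = 0\<^sub>v n"
      using det_0_iff_vec_prod_zero_field[OF A] by auto
    then have "v \<bullet> v \<le> 0" using coer[of v] \<open>0 < c\<close> by (simp add: mult_le_0_iff)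
    then have "vnorm v = 0" using vnorm_sq[of v] by (smt (verit) zero_le_power2 power_eq_0_iff)
    then show False using v by (simp add: vnorm_eq_0_iff)
  qed
  then obtain B where B: "mat_inverse A = Some B" "B \<in> carrier_mat n n" "A * B = 1\<^sub>m n" "B * A = 1\<^sub>m n"
    using mat_inverse_nonsingular[OF A] by metis
  then have inv: "mat_inv A = B" by (simp add: mat_inv_def)
  show "mat_inv A \<in> carrier_mat n n" "mat_inv A * A = 1\<^sub>m n" using B inv by auto
  assume x: "x \<in> carrier_vec n"
  define y where "y = B *\<^sub>v x"
  have y: "y \<in> carrier_vec n" using B x by (simp add: y_def mult_mat_vec_carrier[of _ n n])
  have "A *\<^sub>v y = A * B *\<^sub>v x"
    unfolding y_def using A B(2) x by (simp add: assoc_mult_mat_vec[of _ n n _ n] del: B(3))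
  then have Ay: "A *\<^sub>v y = x" using B(3) x by simp
  have "c * (vnorm y)\<^sup>2 \<le> \<bar>y \<bullet> x\<bar>" using coer[OF y] Ay by (simp add: vnorm_sq)
  also have "\<dots> \<le> vnorm y * vnorm x" using y x by (rule abs_scalar_prod_le)
  finally have le: "c * vnorm y * vnorm y \<le> vnorm x * vnorm y"
    by (simp add: power2_eq_square mult_ac)
  have "c * vnorm y \<le> vnorm x"
  proof (cases "vnorm y = 0")
    case False
    then have "0 < vnorm y" using vnorm_nonneg[of y] by linarith
    then show ?thesis using le by simp
  qed simp
  then show "vnorm (mat_inv A *\<^sub>v x) \<le> vnorm x / c"
    using \<open>0 < c\<close> by (simp add: inv y_def[symmetric] le_divide_eq mult.commute)
qed

text \<open>The new error is the inverse of H' applied to H' e - g = (H' - H) e + (H e - g), an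
  approximation error plus a Taylor remainder. Closeness leaves H' coercive with constant (1 -
  \<epsilon>) \<gamma>, which is the denominator in \<open>nu_seq\<close> and
  \<open>eta_seq\<close>.\<close>

lemma newton_step_le:
  fixes H H' :: "real mat"
  assumes H: "H \<in> carrier_mat n n" "H' \<in> carrier_mat n n"
    and g: "g \<in> carrier_vec n" and e: "e \<in> carrier_vec n"
    and coer: "\<And>v. v \<in> carrier_vec n \<Longrightarrow> \<gamma> * (v \<bullet> v) \<le> v \<bullet> (H *\<^sub>v v)"
    and close: "\<And>v. v \<in> carrier_vec n \<Longrightarrow> vnorm ((H' - H) *\<^sub>v v) \<le> \<epsilon> * \<gamma> * vnorm v"
    and remainder: "vnorm (H *\<^sub>v e - g) \<le> R"
    and \<gamma>: "0 < \<gamma>" "\<epsilon> < 1"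
  shows "vnorm (e - mat_inv H' *\<^sub>v g) \<le> (\<epsilon> * \<gamma> * vnorm e + R) / ((1 - \<epsilon>) * \<gamma>)"
proof -
  define D where "D = H' - H"
  have D: "D \<in> carrier_mat n n" using H by (simp add: D_def)
  have split: "H' *\<^sub>v v = H *\<^sub>v v + D *\<^sub>v v" if "v \<in> carrier_vec n" for v
    unfolding D_def minus_mult_distrib_mat_vec[OF H(2,1) that]
    using H that by (intro eq_vecI) auto
  have coer': "(1 - \<epsilon>) * \<gamma> * (v \<bullet> v) \<le> v \<bullet> (H' *\<^sub>v v)" if v: "v \<in> carrier_vec n" for v
  proof -
    have "\<bar>v \<bullet> (D *\<^sub>v v)\<bar> \<le> vnorm v * vnorm (D *\<^sub>v v)"
      using v D by (intro abs_scalar_prod_le[of _ n] mult_mat_vec_carrier[of _ n n])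
    also have "\<dots> \<le> vnorm v * (\<epsilon> * \<gamma> * vnorm v)"
      unfolding D_def using close[OF v] by (intro mult_left_mono) auto
    also have "\<dots> = \<epsilon> * \<gamma> * (v \<bullet> v)" by (simp add: vnorm_sq[symmetric] power2_eq_square)
    finally have "\<bar>v \<bullet> (D *\<^sub>v v)\<bar> \<le> \<epsilon> * \<gamma> * (v \<bullet> v)" .
    moreover have "v \<bullet> (H' *\<^sub>v v) = v \<bullet> (H *\<^sub>v v) + v \<bullet> (D *\<^sub>v v)"
      using v H D by (simp add: split scalar_prod_add_distrib[of _ n] mult_mat_vec_carrier[of _ n n])
    ultimately show ?thesis using coer[OF v] by (simp add: algebra_simps abs_le_iff)
  qed
  have c: "0 < (1 - \<epsilon>) * \<gamma>" using \<gamma> by simp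
  have inv: "mat_inv H' \<in> carrier_mat n n" "mat_inv H' * H' = 1\<^sub>m n"
    "\<And>x. x \<in> carrier_vec n \<Longrightarrow> vnorm (mat_inv H' *\<^sub>v x) \<le> vnorm x / ((1 - \<epsilon>) * \<gamma>)"
    using coercive_mat_inv[OF H(2) c] coer' by blast+
  define x where "x = D *\<^sub>v e + (H *\<^sub>v e - g)"
  have x: "x \<in> carrier_vec n"
    unfolding x_def using D H e g by (auto intro!: add_carrier_vec minus_carrier_vec mult_mat_vec_carrier[of _ n n])
  have "H' *\<^sub>v e - g = x"
    unfolding x_def split[OF e] using D H e g by (intro eq_vecI) auto
  then have "mat_inv H' *\<^sub>v x = mat_inv H' *\<^sub>v (H' *\<^sub>v e) - mat_inv H' *\<^sub>v g"
    using mult_minus_distrib_mat_vec[OF inv(1), of "H' *\<^sub>v e" g] H e g by (simp add: mult_mat_vec_carrier[of _ n n])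
  also have "mat_inv H' *\<^sub>v (H' *\<^sub>v e) = e"
    using assoc_mult_mat_vec[OF inv(1) H(2) e] inv(2) e by simp
  finally have "vnorm (e - mat_inv H' *\<^sub>v g) = vnorm (mat_inv H' *\<^sub>v x)" by simp
  also have "\<dots> \<le> vnorm x / ((1 - \<epsilon>) * \<gamma>)" by (rule inv(3)[OF x])
  also have "vnorm x \<le> vnorm (D *\<^sub>v e) + vnorm (H *\<^sub>v e - g)"
    unfolding x_def using D H e g by (intro vnorm_add_le[of _ n]) (auto intro!: minus_carrier_vec mult_mat_vec_carrier[of _ n n])
  also have "\<dots> \<le> \<epsilon> * \<gamma> * vnorm e + R"
    unfolding D_def using close[OF e] remainder by (rule add_mono)
  finally show "vnorm (e - mat_inv H' *\<^sub>v g) \<le> (\<epsilon> * \<gamma> * vnorm e + R) / ((1 - \<epsilon>) * \<gamma>)"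
    using c by (simp add: divide_right_mono)
qed


section \<open>Gradient and Hessian of the objective\<close>

lemma gram1_carrier [simp]: "gram1 P \<in> carrier_mat (n_pts P) (n_pts P)"
  by (simp add: gram1_def)

lemma add_ridge_carrier [simp]:
  "A \<in> carrier_mat (n_pts P) (n_pts P) \<Longrightarrow> add_ridge P A \<in> carrier_mat (n_pts P) (n_pts P)"
  by (simp add: add_ridge_def)

lemma gram_carrier [simp]: "gram P \<in> carrier_mat (n_pts P) (n_pts P)"
  by (simp add: gram_def)

lemma loss_diag_carrier [simp]: "loss_diag P w \<in> carrier_mat (n_pts P) (n_pts P)"
  by (simp add: loss_diag_def)

lemma gram_sym: "(gram P)\<^sup>T = gram P"
proof -
  have "gram P $$ (i, j) = gram P $$ (j, i)" if "i < n_pts P" "j < n_pts P" for i j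
    using that by (simp add: gram_def add_ridge_def gram1_def kern_def mult_ac)
  then show ?thesis using carrier_matD[OF gram_carrier[of P]] by (intro eq_matI) auto
qed

text \<open>Reduces the Frechet gradient to derivatives of real functions along lines, where
  uniqueness of derivatives is at hand.\<close>

lemma has_gradient_directional:
  assumes grad: "has_gradient n f g w" and w: "w \<in> carrier_vec n" and h: "h \<in> carrier_vec n"
  shows "((\<lambda>\<tau>. f (w + \<tau> \<cdot>\<^sub>v h)) has_real_derivative (g \<bullet> h)) (at 0)"
proof (cases "vnorm h = 0")
  case True
  then have h0: "h = 0\<^sub>v n" using h by (simp add: vnorm_eq_0_iff)
  moreover have "w + \<tau> \<cdot>\<^sub>v 0\<^sub>v n = w" for \<tau> using w by (intro eq_vecI) auto
  moreover have "g \<bullet> 0\<^sub>v n = 0" using grad by (simp add: has_gradient_def)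
  ultimately show ?thesis by simp
next
  case False
  then have hpos: "0 < vnorm h" using vnorm_nonneg[of h] by linarith
  have g: "g \<in> carrier_vec n" using grad by (simp add: has_gradient_def)
  have f0: "f (w + 0 \<cdot>\<^sub>v h) = f w"
  proof -
    have "w + 0 \<cdot>\<^sub>v h = w" using w h by (intro eq_vecI) auto
    then show ?thesis by simp
  qed
  show ?thesis
    unfolding DERIV_def
  proof (rule LIM_I)
    fix e :: real assume "0 < e"
    \<comment> \<open>The 2 turns the non-strict bound in \<open>has_gradient\<close> into the
      strict one demanded by a limit.\<close>
    define e' where "e' = e / (2 * vnorm h)"
    have "0 < e'" using \<open>0 < e\<close> hpos by (simp add: e'_def)
    then obtain r where r: "0 < r"
      "\<And>k. k \<in> carrier_vec n \<Longrightarrow> vnorm k < r \<Longrightarrow> \<bar>f (w + k) - f w - g \<bullet> k\<bar> \<le> e' * vnorm k"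
      using grad unfolding has_gradient_def by meson
    show "\<exists>s>0. \<forall>\<tau>. \<tau> \<noteq> 0 \<and> norm (\<tau> - 0) < s \<longrightarrow>
      norm ((f (w + (0 + \<tau>) \<cdot>\<^sub>v h) - f (w + 0 \<cdot>\<^sub>v h)) / \<tau> - g \<bullet> h) < e"
    proof (intro exI[of _ "r / vnorm h"] conjI allI impI)
      fix \<tau> :: real assume \<tau>: "\<tau> \<noteq> 0 \<and> norm (\<tau> - 0) < r / vnorm h"
      then have "vnorm (\<tau> \<cdot>\<^sub>v h) < r" using hpos by (simp add: vnorm_smult pos_less_divide_eq)
      then have "\<bar>f (w + \<tau> \<cdot>\<^sub>v h) - f w - \<tau> * (g \<bullet> h)\<bar> \<le> e' * (\<bar>\<tau>\<bar> * vnorm h)"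
        using r(2)[of "\<tau> \<cdot>\<^sub>v h"] h g by (simp add: vnorm_smult)
      also have "\<dots> = e / 2 * \<bar>\<tau>\<bar>" using hpos by (simp add: e'_def)
      finally have "\<bar>f (w + \<tau> \<cdot>\<^sub>v h) - f w - \<tau> * (g \<bullet> h)\<bar> / \<bar>\<tau>\<bar> \<le> e / 2"
        using \<tau> by (simp add: divide_le_eq)
      moreover have "(f (w + \<tau> \<cdot>\<^sub>v h) - f w) / \<tau> - g \<bullet> h = (f (w + \<tau> \<cdot>\<^sub>v h) - f w - \<tau> * (g \<bullet> h)) / \<tau>"
        using \<tau> by (simp add: diff_divide_distrib)
      ultimately have "\<bar>(f (w + \<tau> \<cdot>\<^sub>v h) - f w) / \<tau> - g \<bullet> h\<bar> \<le> e / 2"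
        by (simp only: abs_divide)
      then show "norm ((f (w + (0 + \<tau>) \<cdot>\<^sub>v h) - f (w + 0 \<cdot>\<^sub>v h)) / \<tau> - g \<bullet> h) < e"
        using \<open>0 < e\<close> by (simp add: f0)
    qed (use r hpos in auto)
  qed
qed

lemma vec_eqI_scalar_prod:
  fixes g g' :: "real vec"
  assumes "g \<in> carrier_vec n" "g' \<in> carrier_vec n" "\<And>h. h \<in> carrier_vec n \<Longrightarrow> g \<bullet> h = g' \<bullet> h"
  shows "g = g'"
proof (rule eq_vecI)
  fix i assume "i < dim_vec g'"
  then have "i < n" using assms by simp
  then show "g $ i = g' $ i" using assms(3)[of "unit_vec n i"] assms(1,2)
    by (simp add: scalar_prod_right_unit)
qed (use assms in auto)

text \<open>The gradient in closed form, by the chain rule and symmetry of \<open>gram P\<close>.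
  Since \<open>gradient\<close> is a definite description, this formula carries the estimates and
  the measurability proof.\<close>

definition objective_grad :: "kernel_problem \<Rightarrow> real vec \<Rightarrow> real vec" where
  "objective_grad P w = (1 / real (n_pts P)) \<cdot>\<^sub>v
     (gram P *\<^sub>v vec (n_pts P) (\<lambda>i. deriv (loss P (outp P i)) ((gram P *\<^sub>v w) $ i)))
     + reg P \<cdot>\<^sub>v (gram P *\<^sub>v w)"

lemma objective_grad_carrier [simp]: "objective_grad P w \<in> carrier_vec (n_pts P)"
  unfolding objective_grad_def
  by (rule carrier_vecI) (simp add: carrier_matD[OF gram_carrier])

context
  fixes P :: kernel_problem and n
  assumes valid: "valid_problem P"
  defines "n \<equiv> n_pts P"
begin

lemma gram_dim [simp]: "dim_row (gram P) = n" "dim_col (gram P) = n"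
  using carrier_matD[OF gram_carrier[of P]] by (simp_all add: n_def)

lemma n_pos [simp]: "0 < n" "n \<noteq> 0"
  using valid by (auto simp: n_def valid_problem_def)

lemma gram_line:
  assumes "w \<in> carrier_vec n" "h \<in> carrier_vec n"
  shows "gram P *\<^sub>v (w + \<tau> \<cdot>\<^sub>v h) = gram P *\<^sub>v w + \<tau> \<cdot>\<^sub>v (gram P *\<^sub>v h)"
  using assms mult_add_distrib_mat_vec[OF gram_carrier, of w P "\<tau> \<cdot>\<^sub>v h"] mult_mat_vec[OF gram_carrier, of h P \<tau>]
  by (simp add: n_def)

lemma gram_mult_vec_carrier: "w \<in> carrier_vec n \<Longrightarrow> gram P *\<^sub>v w \<in> carrier_vec n"
  unfolding n_def by (rule mult_mat_vec_carrier[OF gram_carrier])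

lemma gram_line_index:
  assumes "w \<in> carrier_vec n" "h \<in> carrier_vec n" "i < n"
  shows "(gram P *\<^sub>v (w + \<tau> \<cdot>\<^sub>v h)) $ i = (gram P *\<^sub>v w) $ i + \<tau> * (gram P *\<^sub>v h) $ i"
  using assms gram_mult_vec_carrier by (simp add: gram_line)

lemma objective_grad_scalar_prod:
  assumes w: "w \<in> carrier_vec n" and u: "u \<in> carrier_vec n"
  shows "objective_grad P w \<bullet> u = (1 / real n) * (\<Sum>i<n. deriv (loss P (outp P i)) ((gram P *\<^sub>v w) $ i) * (gram P *\<^sub>v u) $ i)
     + reg P * (\<Sum>i<n. (gram P *\<^sub>v w) $ i * u $ i)"
proof -
  define l where "l = vec n (\<lambda>i. deriv (loss P (outp P i)) ((gram P *\<^sub>v w) $ i))"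
  have l: "l \<in> carrier_vec n" by (simp add: l_def)
  have "objective_grad P w \<bullet> u = (1 / real n) * ((gram P *\<^sub>v l) \<bullet> u) + reg P * ((gram P *\<^sub>v w) \<bullet> u)"
    unfolding objective_grad_def n_def[symmetric] l_def[symmetric]
    using w u l gram_mult_vec_carrier
    by (simp add: add_scalar_prod_distrib[of _ n] smult_scalar_prod_distrib[of _ n])
  also have "(gram P *\<^sub>v l) \<bullet> u = l \<bullet> (gram P *\<^sub>v u)"
    using scalar_prod_mult_mat_vec_sym[OF gram_carrier gram_sym] l u by (simp add: n_def)
  finally show ?thesis
    using u gram_mult_vec_carrier[OF u] by (simp add: scalar_prod_def atLeast0LessThan l_def)
qed

lemma objective_directional:
  assumes w: "w \<in> carrier_vec n" and h: "h \<in> carrier_vec n"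
  shows "((\<lambda>\<tau>. objective P (w + \<tau> \<cdot>\<^sub>v h)) has_real_derivative (objective_grad P w \<bullet> h)) (at 0)"
proof -
  define a b where "a i = (gram P *\<^sub>v w) $ i" and "b i = (gram P *\<^sub>v h) $ i" for i
  have loss: "(loss P y has_real_derivative deriv (loss P y) u) (at u)" for y u
    using valid by (simp add: valid_problem_def DERIV_deriv_iff_real_differentiable)
  have "objective P (w + \<tau> \<cdot>\<^sub>v h) = (1 / real n) * (\<Sum>i<n. loss P (outp P i) (a i + \<tau> * b i))
      + reg P / 2 * (\<Sum>i<n. (w $ i + \<tau> * h $ i) * (a i + \<tau> * b i))" for \<tau>
  proof -
    have "(w + \<tau> \<cdot>\<^sub>v h) \<bullet> (gram P *\<^sub>v (w + \<tau> \<cdot>\<^sub>v h)) = (\<Sum>i<n. (w $ i + \<tau> * h $ i) * (a i + \<tau> * b i))"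
      using w h gram_mult_vec_carrier[OF w] gram_mult_vec_carrier[OF h]
      by (simp add: gram_line scalar_prod_def[of "_ + _"] atLeast0LessThan a_def b_def del: index_mult_mat_vec)
    moreover have "(\<Sum>i<n. loss P (outp P i) ((gram P *\<^sub>v (w + \<tau> \<cdot>\<^sub>v h)) $ i)) = (\<Sum>i<n. loss P (outp P i) (a i + \<tau> * b i))"
      using w h by (intro sum.cong refl) (simp add: gram_line_index a_def b_def del: index_mult_mat_vec)
    ultimately show ?thesis by (simp add: objective_def n_def)
  qed
  moreover have "((\<lambda>\<tau>. (1 / real n) * (\<Sum>i<n. loss P (outp P i) (a i + \<tau> * b i))
      + reg P / 2 * (\<Sum>i<n. (w $ i + \<tau> * h $ i) * (a i + \<tau> * b i))) has_real_derivative
      (1 / real n) * (\<Sum>i<n. deriv (loss P (outp P i)) (a i) * b i)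
      + reg P / 2 * (\<Sum>i<n. w $ i * b i + h $ i * a i)) (at 0)"
    by (auto intro!: derivative_eq_intros DERIV_chain2[OF loss] sum.cong simp: algebra_simps)
  moreover have "(\<Sum>i<n. w $ i * b i + h $ i * a i) = 2 * (\<Sum>i<n. a i * h $ i)"
  proof -
    have "(\<Sum>i<n. w $ i * b i) = w \<bullet> (gram P *\<^sub>v h)"
      using gram_mult_vec_carrier[OF h] by (simp add: scalar_prod_def atLeast0LessThan b_def)
    also have "\<dots> = (gram P *\<^sub>v w) \<bullet> h"
      using scalar_prod_mult_mat_vec_sym[OF gram_carrier gram_sym] w h by (simp add: n_def)
    also have "\<dots> = (\<Sum>i<n. a i * h $ i)"
      using h by (simp add: scalar_prod_def atLeast0LessThan a_def)
    finally show ?thesis by (simp add: sum.distrib mult.commute)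
  qed
  ultimately show ?thesis
    using objective_grad_scalar_prod[OF w h] by (simp add: a_def b_def)
qed

text \<open>Existence comes from twice differentiability; uniqueness holds because all directional
  derivatives are determined.\<close>

lemma gradient_objective:
  assumes diff: "twice_differentiable n (objective P)" and w: "w \<in> carrier_vec n"
  shows "gradient n (objective P) w = objective_grad P w"
proof -
  have unique: "g = objective_grad P w" if g: "has_gradient n (objective P) g w" for g
  proof (rule vec_eqI_scalar_prod[of _ n])
    fix h :: "real vec" assume h: "h \<in> carrier_vec n"
    show "g \<bullet> h = objective_grad P w \<bullet> h"
      using has_gradient_directional[OF g w h] objective_directional[OF w h] by (rule DERIV_unique)
  qed (use g n_def in \<open>auto simp: has_gradient_def\<close>)
  obtain g where "has_gradient n (objective P) g w"
    using diff w unfolding twice_differentiable_def by blast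
  then show ?thesis unfolding gradient_def using unique by (metis the_equality)
qed

lemma objective_grad_argmin:
  assumes "is_arg_min (objective P) (\<lambda>w. w \<in> carrier_vec n) w"
  shows "objective_grad P w = 0\<^sub>v n"
proof -
  have w: "w \<in> carrier_vec n" and min: "objective P w \<le> objective P v" if "v \<in> carrier_vec n" for v
    using assms that by (auto simp: is_arg_min_def not_less)
  have w: "w \<in> carrier_vec n" using assms by (auto simp: is_arg_min_def)
  have w0: "w + 0 \<cdot>\<^sub>v h = w" if "h \<in> carrier_vec n" for h
    using w that by (intro eq_vecI) auto
  have "objective_grad P w \<bullet> h = 0" if h: "h \<in> carrier_vec n" for h
    using objective_directional[OF w h]
    by (rule DERIV_local_min[where d = 1]) (use w h w0 min in auto)
  then show ?thesis
    by (intro vec_eqI_scalar_prod[of _ n]) (auto simp: n_def)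
qed

section \<open>The Hessian: Taylor remainder, perturbation and coercivity\<close>

lemma hess_with_carrier: "A \<in> carrier_mat n n \<Longrightarrow> hess_with P A w \<in> carrier_mat n n"
  by (auto simp: hess_with_def n_def intro!: add_carrier_mat smult_carrier_mat)

lemma hess_with_mult_vec:
  assumes A: "A \<in> carrier_mat n n" and v: "v \<in> carrier_vec n"
  shows "hess_with P A w *\<^sub>v v = (1 / real n) \<cdot>\<^sub>v (A *\<^sub>v (loss_diag P w *\<^sub>v (A *\<^sub>v v))) + reg P \<cdot>\<^sub>v (A *\<^sub>v v)"
proof -
  define D where "D = loss_diag P w"
  have D: "D \<in> carrier_mat n n" by (simp add: D_def n_def)
  have "hess_with P A w *\<^sub>v v = (1 / real n) \<cdot>\<^sub>v (A * D * A *\<^sub>v v) + reg P \<cdot>\<^sub>v (A *\<^sub>v v)"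
    unfolding hess_with_def n_def[symmetric] D_def[symmetric]
    using A D v by (simp add: add_mult_distrib_mat_vec[of _ n n] smult_mat_mult_vec[of _ n n])
  also have "A * D * A *\<^sub>v v = A *\<^sub>v (D *\<^sub>v (A *\<^sub>v v))"
    using A D v assoc_mult_mat_vec[of "A * D" n n A n v] assoc_mult_mat_vec[of A n n D n "A *\<^sub>v v"]
    by (simp add: mult_mat_vec_carrier[of _ n n])
  finally show ?thesis by (simp add: D_def)
qed

text \<open>Brings the Hessian form into the shape obtained by differentiating
  \<open>objective_grad_scalar_prod\<close> along a line. Comparing the two shows that
  \<open>hess\<close> is indeed the derivative of the gradient.\<close>

lemma hess_scalar_prod:
  assumes u: "u \<in> carrier_vec n" and v: "v \<in> carrier_vec n"
  shows "u \<bullet> (hess P w *\<^sub>v v) = (1 / real n) * (\<Sum>i<n. deriv (deriv (loss P (outp P i))) ((gram P *\<^sub>v w) $ i)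
      * (gram P *\<^sub>v v) $ i * (gram P *\<^sub>v u) $ i) + reg P * (\<Sum>i<n. (gram P *\<^sub>v v) $ i * u $ i)"
proof -
  define D where "D = loss_diag P w"
  have D: "D \<in> carrier_mat n n" by (simp add: D_def n_def)
  have K: "gram P \<in> carrier_mat n n" by (simp add: n_def)
  define k where "k = gram P *\<^sub>v v"
  have k: "k \<in> carrier_vec n" unfolding k_def using v by (rule gram_mult_vec_carrier)
  have Dk: "D *\<^sub>v k \<in> carrier_vec n" using D k by (rule mult_mat_vec_carrier)
  have "u \<bullet> (hess P w *\<^sub>v v) = (1 / real n) * (u \<bullet> (gram P *\<^sub>v (D *\<^sub>v k))) + reg P * (u \<bullet> k)"
    unfolding hess_def hess_with_mult_vec[OF K v] D_def[symmetric] k_def[symmetric]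
    using u k gram_mult_vec_carrier[OF Dk] by (simp add: scalar_prod_add_distrib[of _ n])
  also have "u \<bullet> (gram P *\<^sub>v (D *\<^sub>v k)) = (gram P *\<^sub>v u) \<bullet> (D *\<^sub>v k)"
    using scalar_prod_mult_mat_vec_sym[OF gram_carrier gram_sym] u Dk by (simp add: n_def)
  also have "\<dots> = (\<Sum>i<n. deriv (deriv (loss P (outp P i))) ((gram P *\<^sub>v w) $ i) * k $ i * (gram P *\<^sub>v u) $ i)"
  proof -
    have "(D *\<^sub>v k) $ i = deriv (deriv (loss P (outp P i))) ((gram P *\<^sub>v w) $ i) * k $ i" if "i < n" for i
    proof -
      have "(D *\<^sub>v k) $ i = (\<Sum>j<n. D $$ (i, j) * k $ j)"
        using k D that by (simp add: scalar_prod_def atLeast0LessThan)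
      also have "\<dots> = (\<Sum>j<n. (if j = i then deriv (deriv (loss P (outp P i))) ((gram P *\<^sub>v w) $ i) * k $ i else 0))"
        using that by (intro sum.cong refl) (auto simp: D_def loss_diag_def n_def[symmetric] simp del: index_mult_mat_vec)
      finally have "(D *\<^sub>v k) $ i = (\<Sum>j<n. (if j = i then deriv (deriv (loss P (outp P i))) ((gram P *\<^sub>v w) $ i) * k $ i else 0))" .
      then show ?thesis using that by (simp del: index_mult_mat_vec)
    qed
    then show ?thesis
      using Dk carrier_matD(1)[OF D] by (simp add: scalar_prod_def[of "gram P *\<^sub>v u"] atLeast0LessThan mult_ac del: index_mult_mat_vec)
  qed
  finally show ?thesis
    using k by (simp add: k_def[symmetric] scalar_prod_def[of u] atLeast0LessThan mult.commute del: index_mult_mat_vec)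
qed

text \<open>
  To stay with derivatives of real functions, the increment of the gradient along the segment is
  tested against the remainder vector \<open>u\<close> itself.
\<close>

lemma hess_remainder_le:
  assumes w: "w \<in> carrier_vec n" and ws: "ws \<in> carrier_vec n" and g0: "objective_grad P ws = 0\<^sub>v n"
    and lip: "\<And>w w'. w \<in> carrier_vec n \<Longrightarrow> w' \<in> carrier_vec n \<Longrightarrow>
      spec_norm (hess P w - hess P w') \<le> M * vnorm (w - w')"
  shows "vnorm (hess P w *\<^sub>v (w - ws) - objective_grad P w) \<le> M / 2 * (vnorm (w - ws))\<^sup>2"
proof -
  have Hc: "hess P w \<in> carrier_mat n n" for w
    unfolding hess_def by (intro hess_with_carrier) (simp add: n_def)
  define h where "h = ws - w"
  have h: "h \<in> carrier_vec n" using w ws by (simp add: h_def)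
  define u where "u = hess P w *\<^sub>v (w - ws) - objective_grad P w"
  have Hw: "hess P w *\<^sub>v (w - ws) \<in> carrier_vec n"
    by (intro mult_mat_vec_carrier[OF Hc] minus_carrier_vec w ws)
  have gw: "objective_grad P w \<in> carrier_vec n" by (simp add: n_def)
  have u: "u \<in> carrier_vec n" unfolding u_def by (intro minus_carrier_vec Hw gw)
  have loss: "(deriv (loss P y) has_real_derivative deriv (deriv (loss P y)) u) (at u)" for y u
    using valid by (simp add: valid_problem_def DERIV_deriv_iff_real_differentiable)
  define \<phi> where "\<phi> \<tau> = objective_grad P (w + \<tau> \<cdot>\<^sub>v h) \<bullet> u" for \<tau>
  have \<phi>': "(\<phi> has_real_derivative u \<bullet> (hess P (w + \<tau> \<cdot>\<^sub>v h) *\<^sub>v h)) (at \<tau>)" for \<tau>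
  proof -
    define a b c where "a i = (gram P *\<^sub>v w) $ i" and "b i = (gram P *\<^sub>v h) $ i" and "c i = (gram P *\<^sub>v u) $ i" for i
    have idx: "(gram P *\<^sub>v (w + \<tau> \<cdot>\<^sub>v h)) $ i = a i + \<tau> * b i" if "i < n" for i \<tau>
      using gram_line_index[OF w h that] by (simp add: a_def b_def)
    have "\<phi> \<tau> = (1 / real n) * (\<Sum>i<n. deriv (loss P (outp P i)) (a i + \<tau> * b i) * c i)
      + reg P * (\<Sum>i<n. (a i + \<tau> * b i) * u $ i)" for \<tau>
      unfolding \<phi>_def using w h u by (subst objective_grad_scalar_prod) (auto simp: idx c_def simp del: index_mult_mat_vec)
    then have "\<phi> = (\<lambda>\<tau>. (1 / real n) * (\<Sum>i<n. deriv (loss P (outp P i)) (a i + \<tau> * b i) * c i)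
      + reg P * (\<Sum>i<n. (a i + \<tau> * b i) * u $ i))" by auto
    moreover have "u \<bullet> (hess P (w + \<tau> \<cdot>\<^sub>v h) *\<^sub>v h) = (1 / real n) * (\<Sum>i<n. deriv (deriv (loss P (outp P i))) (a i + \<tau> * b i)
      * b i * c i) + reg P * (\<Sum>i<n. b i * u $ i)"
      unfolding hess_scalar_prod[OF u h] by (simp add: idx b_def c_def del: index_mult_mat_vec)
    ultimately show ?thesis
      by (auto intro!: derivative_eq_intros DERIV_chain2[OF loss] sum.cong simp: algebra_simps)
  qed
  define B where "B = vnorm u * (M * vnorm h * vnorm h)"
  have bound: "u \<bullet> (hess P (w + \<tau> \<cdot>\<^sub>v h) *\<^sub>v h) \<le> u \<bullet> (hess P w *\<^sub>v h) + \<tau> * B" if "0 \<le> \<tau>" for \<tau>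
  proof -
    have wt: "w + \<tau> \<cdot>\<^sub>v h \<in> carrier_vec n" using w h by simp
    define E where "E = hess P (w + \<tau> \<cdot>\<^sub>v h) - hess P w"
    have E: "E \<in> carrier_mat n n" using Hc by (simp add: E_def)
    have "w + \<tau> \<cdot>\<^sub>v h - w = \<tau> \<cdot>\<^sub>v h" using w h by (intro eq_vecI) auto
    then have sE: "spec_norm E \<le> M * (\<tau> * vnorm h)"
      using lip[OF wt w] that by (simp add: E_def vnorm_smult)
    have "u \<bullet> (E *\<^sub>v h) \<le> vnorm u * vnorm (E *\<^sub>v h)"
      using abs_scalar_prod_le[OF u mult_mat_vec_carrier[OF E h]] by simp
    also have "\<dots> \<le> vnorm u * (spec_norm E * vnorm h)"
      by (intro mult_left_mono vnorm_mult_le_spec_norm[OF E h]) simp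
    also have "\<dots> \<le> vnorm u * (M * (\<tau> * vnorm h) * vnorm h)"
      by (intro mult_left_mono mult_right_mono sE) auto
    finally have "u \<bullet> (E *\<^sub>v h) \<le> \<tau> * B" by (simp add: B_def mult_ac)
    moreover have "u \<bullet> (E *\<^sub>v h) = u \<bullet> (hess P (w + \<tau> \<cdot>\<^sub>v h) *\<^sub>v h) - u \<bullet> (hess P w *\<^sub>v h)"
      unfolding E_def minus_mult_distrib_mat_vec[OF Hc Hc h]
      using u mult_mat_vec_carrier[OF Hc h] by (intro scalar_prod_minus_distrib) auto
    ultimately show ?thesis by simp
  qed
  \<comment> \<open>By \<open>bound\<close> the slope of \<open>\<phi>\<close> exceeds its initial
    value by at most \<open>\<tau> * B\<close>. Subtracting the corresponding linear and quadratic
    parts leaves a function that does not increase on [0, 1].\<close>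
  define \<psi> where "\<psi> \<tau> = \<phi> \<tau> - \<tau> * (u \<bullet> (hess P w *\<^sub>v h)) - B / 2 * \<tau>\<^sup>2" for \<tau>
  have "\<psi> 1 \<le> \<psi> 0"
  proof (rule DERIV_nonpos_imp_nonincreasing[of 0 1 \<psi>])
    fix \<tau> :: real assume "0 \<le> \<tau>" "\<tau> \<le> 1"
    have "(\<psi> has_real_derivative u \<bullet> (hess P (w + \<tau> \<cdot>\<^sub>v h) *\<^sub>v h) - u \<bullet> (hess P w *\<^sub>v h) - B * \<tau>) (at \<tau>)"
      unfolding \<psi>_def by (auto intro!: derivative_eq_intros \<phi>')
    then show "\<exists>y. (\<psi> has_real_derivative y) (at \<tau>) \<and> y \<le> 0"
      using bound[OF \<open>0 \<le> \<tau>\<close>] by (intro exI conjI) (auto simp: mult.commute)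
  qed simp
  moreover have "\<phi> 1 = 0"
  proof -
    have "w + 1 \<cdot>\<^sub>v h = ws" using w ws by (intro eq_vecI) (auto simp: h_def)
    then show ?thesis using u g0 by (simp add: \<phi>_def)
  qed
  moreover have "\<phi> 0 = objective_grad P w \<bullet> u"
  proof -
    have "w + 0 \<cdot>\<^sub>v h = w" using w h by (intro eq_vecI) auto
    then show ?thesis by (simp add: \<phi>_def)
  qed
  ultimately have le: "- (u \<bullet> (hess P w *\<^sub>v h)) - objective_grad P w \<bullet> u \<le> B / 2"
    by (simp add: \<psi>_def)
  have "u \<bullet> u = u \<bullet> (hess P w *\<^sub>v (w - ws)) - u \<bullet> objective_grad P w"
    using scalar_prod_minus_distrib[OF u Hw gw] by (simp add: u_def[symmetric])
  also have "w - ws = (- 1) \<cdot>\<^sub>v h"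
    using w ws by (intro eq_vecI) (auto simp: h_def)
  also have "hess P w *\<^sub>v ((- 1) \<cdot>\<^sub>v h) = (- 1) \<cdot>\<^sub>v (hess P w *\<^sub>v h)"
    using Hc h by (rule mult_mat_vec)
  also have "u \<bullet> ((- 1) \<cdot>\<^sub>v (hess P w *\<^sub>v h)) = - (u \<bullet> (hess P w *\<^sub>v h))"
    using u mult_mat_vec_carrier[OF Hc h] by simp
  also have "u \<bullet> objective_grad P w = objective_grad P w \<bullet> u"
    using u gw by (simp add: comm_scalar_prod[of _ n])
  finally have "(vnorm u)\<^sup>2 \<le> B / 2" using le by (simp add: vnorm_sq)
  then have "vnorm u * vnorm u \<le> (M / 2 * (vnorm h)\<^sup>2) * vnorm u"
    by (simp add: B_def power2_eq_square mult_ac)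
  moreover have "vnorm (w - ws) = vnorm h"
    unfolding \<open>w - ws = (- 1) \<cdot>\<^sub>v h\<close> by (simp add: vnorm_smult)
  moreover have "0 \<le> M / 2 * (vnorm h)\<^sup>2"
  proof -
    have "0 \<le> M * vnorm h"
      using order_trans[OF spec_norm_nonneg[of "hess P ws - hess P w" n] lip[OF ws w]] Hc
      by (simp add: h_def)
    then show ?thesis using mult_nonneg_nonneg[of "M * vnorm h" "vnorm h"] by (simp add: power2_eq_square mult_ac)
  qed
  ultimately show ?thesis
    unfolding u_def[symmetric] using vnorm_nonneg[of u] mult_right_le_imp_le
    by (cases "vnorm u = 0") (auto simp: less_eq_real_def)
qed

text \<open>With E = A' - A one has A' D A' - A D A = A' D E + E D A. This asymmetric splitting,
  together with the regulariser acting on E, yields exactly the three terms of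
  \<open>zeta\<close>.\<close>

lemma hess_with_diff_le:
  assumes A: "A \<in> carrier_mat n n" and A': "A' \<in> carrier_mat n n"
    and close: "\<And>v. v \<in> carrier_vec n \<Longrightarrow> vnorm ((A' - A) *\<^sub>v v) \<le> s * vnorm v"
    and lam: "spec_norm (loss_diag P w) \<le> lam" and v: "v \<in> carrier_vec n"
  shows "vnorm ((hess_with P A' w - hess_with P A w) *\<^sub>v v)
    \<le> (reg P + lam * spec_norm ((1 / real n) \<cdot>\<^sub>m A') + lam * spec_norm ((1 / real n) \<cdot>\<^sub>m A)) * s * vnorm v"
proof -
  define D where "D = loss_diag P w"
  define E where "E = A' - A"
  define B B' where "B = (1 / real n) \<cdot>\<^sub>m A" and "B' = (1 / real n) \<cdot>\<^sub>m A'"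
  have c [simp]: "D \<in> carrier_mat n n" "E \<in> carrier_mat n n" "B \<in> carrier_mat n n" "B' \<in> carrier_mat n n"
    using A A' by (auto simp: D_def E_def B_def B'_def n_def)
  have mv [simp]: "X *\<^sub>v x \<in> carrier_vec n" if "X \<in> carrier_mat n n" "x \<in> carrier_vec n" for X x
    using that by (rule mult_mat_vec_carrier)
  have D: "vnorm (D *\<^sub>v x) \<le> lam * vnorm x" if "x \<in> carrier_vec n" for x
    using vnorm_mult_le_spec_norm[OF c(1) that] mult_right_mono[OF lam vnorm_nonneg[of x]]
    by (simp add: D_def)
  have lam0: "0 \<le> lam" using spec_norm_nonneg[OF c(1)] lam by (simp add: D_def)
  have reg: "0 \<le> reg P" using valid by (simp add: valid_problem_def)
  have E: "vnorm (E *\<^sub>v x) \<le> s * vnorm x" if "x \<in> carrier_vec n" for x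
    using close[OF that] by (simp add: E_def)
  have s0: "0 \<le> s * vnorm v" using order_trans[OF vnorm_nonneg E[OF v]] .
  have A'v: "A' *\<^sub>v x = A *\<^sub>v x + E *\<^sub>v x" if "x \<in> carrier_vec n" for x
    unfolding E_def minus_mult_distrib_mat_vec[OF A' A that]
    using A A' that by (intro eq_vecI) auto
  have Bv: "B *\<^sub>v x = (1 / real n) \<cdot>\<^sub>v (A *\<^sub>v x)" "B' *\<^sub>v x = (1 / real n) \<cdot>\<^sub>v (A' *\<^sub>v x)"
    if "x \<in> carrier_vec n" for x
    using A A' that by (simp_all add: B_def B'_def smult_mat_mult_vec[of _ n n])
  define p where "p = B' *\<^sub>v (D *\<^sub>v (E *\<^sub>v v))"
  define q where "q = E *\<^sub>v (D *\<^sub>v (B *\<^sub>v v))"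
  define r where "r = reg P \<cdot>\<^sub>v (E *\<^sub>v v)"
  have pqr: "p \<in> carrier_vec n" "q \<in> carrier_vec n" "r \<in> carrier_vec n"
    using v by (auto simp: p_def q_def r_def)
  have "(hess_with P A' w - hess_with P A w) *\<^sub>v v = hess_with P A' w *\<^sub>v v - hess_with P A w *\<^sub>v v"
    using minus_mult_distrib_mat_vec[OF hess_with_carrier[OF A'] hess_with_carrier[OF A] v] .
  also have "hess_with P A' w *\<^sub>v v = p + ((1 / real n) \<cdot>\<^sub>v (A' *\<^sub>v (D *\<^sub>v (A *\<^sub>v v))) + reg P \<cdot>\<^sub>v (A *\<^sub>v v)) + r"
  proof -
    have "A' *\<^sub>v (D *\<^sub>v (A' *\<^sub>v v)) = A' *\<^sub>v (D *\<^sub>v (A *\<^sub>v v)) + A' *\<^sub>v (D *\<^sub>v (E *\<^sub>v v))"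
      using v A A' by (simp add: A'v[OF v] mult_add_distrib_mat_vec[of _ n n])
    define a where "a = (1 / real n) \<cdot>\<^sub>v (A' *\<^sub>v (D *\<^sub>v (A *\<^sub>v v)))"
    define b where "b = reg P \<cdot>\<^sub>v (A *\<^sub>v v)"
    have ab: "a \<in> carrier_vec n" "b \<in> carrier_vec n" using v A A' by (auto simp: a_def b_def)
    have "(1 / real n) \<cdot>\<^sub>v (A' *\<^sub>v (D *\<^sub>v (A' *\<^sub>v v))) = a + p"
      unfolding \<open>A' *\<^sub>v (D *\<^sub>v (A' *\<^sub>v v)) = _\<close> a_def p_def
      using v A A' by (simp add: Bv smult_add_distrib_vec[of _ n])
    moreover have "reg P \<cdot>\<^sub>v (A' *\<^sub>v v) = b + r"
      unfolding A'v[OF v] b_def r_def using v A by (simp add: smult_add_distrib_vec[of _ n])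
    ultimately show ?thesis
      unfolding hess_with_mult_vec[OF A' v] D_def[symmetric] a_def[symmetric] b_def[symmetric]
      using ab pqr by (intro eq_vecI) auto
  qed
  also have "hess_with P A w *\<^sub>v v = (1 / real n) \<cdot>\<^sub>v (A *\<^sub>v (D *\<^sub>v (A *\<^sub>v v))) + reg P \<cdot>\<^sub>v (A *\<^sub>v v)"
    unfolding hess_with_mult_vec[OF A v] D_def ..
  also have "(1 / real n) \<cdot>\<^sub>v (A' *\<^sub>v (D *\<^sub>v (A *\<^sub>v v))) = (1 / real n) \<cdot>\<^sub>v (A *\<^sub>v (D *\<^sub>v (A *\<^sub>v v))) + q"
  proof -
    have "A' *\<^sub>v (D *\<^sub>v (A *\<^sub>v v)) = A *\<^sub>v (D *\<^sub>v (A *\<^sub>v v)) + E *\<^sub>v (D *\<^sub>v (A *\<^sub>v v))"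
      using v A by (intro A'v) auto
    moreover have "q = (1 / real n) \<cdot>\<^sub>v (E *\<^sub>v (D *\<^sub>v (A *\<^sub>v v)))"
      unfolding q_def using v A by (simp add: Bv mult_mat_vec[of _ n n])
    ultimately show ?thesis using v A by (simp add: smult_add_distrib_vec[of _ n])
  qed
  also have "p + ((1 / real n) \<cdot>\<^sub>v (A *\<^sub>v (D *\<^sub>v (A *\<^sub>v v))) + q + reg P \<cdot>\<^sub>v (A *\<^sub>v v)) + r
      - ((1 / real n) \<cdot>\<^sub>v (A *\<^sub>v (D *\<^sub>v (A *\<^sub>v v))) + reg P \<cdot>\<^sub>v (A *\<^sub>v v)) = p + q + r"
  proof -
    define a where "a = (1 / real n) \<cdot>\<^sub>v (A *\<^sub>v (D *\<^sub>v (A *\<^sub>v v)))"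
    define b where "b = reg P \<cdot>\<^sub>v (A *\<^sub>v v)"
    have "a \<in> carrier_vec n" "b \<in> carrier_vec n" using v A by (auto simp: a_def b_def)
    then show ?thesis unfolding a_def[symmetric] b_def[symmetric] using pqr by (intro eq_vecI) auto
  qed
  finally have "vnorm ((hess_with P A' w - hess_with P A w) *\<^sub>v v) = vnorm (p + q + r)" by simp
  also have "\<dots> \<le> vnorm p + vnorm q + vnorm r"
    using vnorm_add_le[of "p + q" n r] vnorm_add_le[of p n q] pqr by auto
  also have "vnorm p \<le> spec_norm B' * (lam * (s * vnorm v))"
  proof -
    have "vnorm p \<le> spec_norm B' * vnorm (D *\<^sub>v (E *\<^sub>v v))"
      unfolding p_def using v by (intro vnorm_mult_le_spec_norm[of _ n]) auto
    also have "\<dots> \<le> spec_norm B' * (lam * vnorm (E *\<^sub>v v))"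
      using v by (intro mult_left_mono D spec_norm_nonneg[OF c(4)]) auto
    also have "\<dots> \<le> spec_norm B' * (lam * (s * vnorm v))"
      using v lam0 by (intro mult_left_mono E spec_norm_nonneg[OF c(4)]) auto
    finally show ?thesis .
  qed
  also have "vnorm q \<le> lam * spec_norm B * (s * vnorm v)"
  \<comment> \<open>The sign of \<open>s\<close> is read off from \<open>close\<close> at
    \<open>v\<close> itself, which requires \<open>v\<close> to be nonzero.\<close>
  proof (cases "vnorm v = 0")
    case True
    then have "v = 0\<^sub>v n" using v by (simp add: vnorm_eq_0_iff)
    moreover have "X *\<^sub>v 0\<^sub>v n = 0\<^sub>v n" if "X \<in> carrier_mat n n" for X :: "real mat"
      using that by (intro eq_vecI) auto
    ultimately have "q = 0\<^sub>v n" unfolding q_def using c by simp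
    then show ?thesis using True by simp
  next
    case False
    then have s: "0 \<le> s" using s0 vnorm_nonneg[of v] by (simp add: zero_le_mult_iff)
    have "vnorm q \<le> s * vnorm (D *\<^sub>v (B *\<^sub>v v))"
      unfolding q_def using v by (intro E) auto
    also have "\<dots> \<le> s * (lam * vnorm (B *\<^sub>v v))"
      using v s by (intro mult_left_mono D) auto
    also have "\<dots> \<le> s * (lam * (spec_norm B * vnorm v))"
      using v s lam0 by (intro mult_left_mono vnorm_mult_le_spec_norm[of _ n]) auto
    finally show ?thesis by (simp add: mult_ac)
  qed
  also have "vnorm r \<le> reg P * (s * vnorm v)"
    unfolding r_def vnorm_smult using E[OF v] reg by (simp add: mult_left_mono)
  finally show ?thesis by (simp add: B_def B'_def algebra_simps)
qed

text \<open>A unit vector is mapped by the Hessian to a vector of norm at least \<gamma>, while its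
  image under \<open>gram P\<close> has norm at most \<kappa> + \<mu>. As the first factor is a
  lower bound for \<zeta>, this keeps the radius \<epsilon> \<gamma> / \<zeta> below \<epsilon>
  (\<kappa> + \<mu>).\<close>

lemma coercivity_le:
  assumes coer: "\<And>v. v \<in> carrier_vec n \<Longrightarrow> \<gamma> * (v \<bullet> v) \<le> v \<bullet> (hess P w *\<^sub>v v)"
    and lam: "spec_norm (loss_diag P w) \<le> lam"
  shows "\<gamma> \<le> (reg P + lam * spec_norm ((1 / real n) \<cdot>\<^sub>m gram P)) * (spec_norm (gram1 P) + ridge P)"
proof -
  define v :: "real vec" where "v = unit_vec n 0"
  have v: "v \<in> carrier_vec n" by (simp add: v_def)
  have vv: "v \<bullet> v = 1" by (simp add: v_def)
  then have nv: "vnorm v = 1" by (simp add: vnorm_def)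
  define D where "D = loss_diag P w"
  define B where "B = (1 / real n) \<cdot>\<^sub>m gram P"
  have c [simp]: "D \<in> carrier_mat n n" "gram P \<in> carrier_mat n n" "gram1 P \<in> carrier_mat n n" "B \<in> carrier_mat n n"
    using gram_carrier[of P] by (auto simp: D_def B_def n_def)
  have mv [simp]: "X *\<^sub>v x \<in> carrier_vec n" if "X \<in> carrier_mat n n" "x \<in> carrier_vec n" for X x
    using that by (rule mult_mat_vec_carrier)
  have pos: "0 < reg P" "0 < ridge P" using valid by (auto simp: valid_problem_def)
  have lam0: "0 \<le> lam" using spec_norm_nonneg[OF c(1)] lam by (simp add: D_def)
  define k where "k = gram P *\<^sub>v v"
  have k: "k \<in> carrier_vec n" using v by (simp add: k_def)
  have "k = gram1 P *\<^sub>v v + ridge P \<cdot>\<^sub>v v"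
    unfolding k_def gram_def add_ridge_def n_def[symmetric]
    using v by (simp add: add_mult_distrib_mat_vec[of _ n n] smult_mat_mult_vec[of _ n n])
  then have "vnorm k \<le> vnorm (gram1 P *\<^sub>v v) + vnorm (ridge P \<cdot>\<^sub>v v)"
    using v by (simp add: vnorm_add_le[of _ n])
  also have "\<dots> \<le> spec_norm (gram1 P) + ridge P"
    using vnorm_mult_le_spec_norm[OF c(3) v] pos by (simp add: vnorm_smult nv)
  finally have nk: "vnorm k \<le> spec_norm (gram1 P) + ridge P" .
  have "hess P w *\<^sub>v v = B *\<^sub>v (D *\<^sub>v k) + reg P \<cdot>\<^sub>v k"
    unfolding hess_def hess_with_mult_vec[OF c(2) v] D_def[symmetric] k_def[symmetric] B_def
    using k by (simp add: smult_mat_mult_vec[of _ n n])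
  then have "vnorm (hess P w *\<^sub>v v) \<le> vnorm (B *\<^sub>v (D *\<^sub>v k)) + vnorm (reg P \<cdot>\<^sub>v k)"
    using k by (simp add: vnorm_add_le[of _ n])
  also have "\<dots> \<le> spec_norm B * (lam * vnorm k) + reg P * vnorm k"
  proof (rule add_mono)
    have "vnorm (B *\<^sub>v (D *\<^sub>v k)) \<le> spec_norm B * vnorm (D *\<^sub>v k)"
      using k by (intro vnorm_mult_le_spec_norm[of _ n]) auto
    also have "vnorm (D *\<^sub>v k) \<le> spec_norm D * vnorm k"
      using k by (intro vnorm_mult_le_spec_norm[of _ n]) auto
    also have "spec_norm D * vnorm k \<le> lam * vnorm k"
      using lam by (intro mult_right_mono) (auto simp: D_def)
    finally show "vnorm (B *\<^sub>v (D *\<^sub>v k)) \<le> spec_norm B * (lam * vnorm k)"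
      using spec_norm_nonneg[OF c(4)] by (simp add: mult_left_mono)
  qed (use pos in \<open>simp add: vnorm_smult\<close>)
  also have "\<dots> = (reg P + lam * spec_norm B) * vnorm k" by (simp add: algebra_simps)
  also have "\<dots> \<le> (reg P + lam * spec_norm B) * (spec_norm (gram1 P) + ridge P)"
    using pos lam0 spec_norm_nonneg[OF c(4)] nk by (intro mult_left_mono) auto
  finally have "vnorm (hess P w *\<^sub>v v) \<le> \<dots>" .
  moreover have "\<gamma> \<le> vnorm (hess P w *\<^sub>v v)"
  proof -
    have "hess P w *\<^sub>v v \<in> carrier_vec n" unfolding hess_def by (intro mv hess_with_carrier v) simp
    then have "\<bar>v \<bullet> (hess P w *\<^sub>v v)\<bar> \<le> vnorm v * vnorm (hess P w *\<^sub>v v)"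
      by (rule abs_scalar_prod_le[OF v])
    then show ?thesis using coer[OF v] by (simp add: vv nv)
  qed
  ultimately show ?thesis by (simp add: B_def)
qed

end


section \<open>The recursion for the error\<close>

text \<open>The invariant is e t \<le> \<rho>^t e 0. After 1 - \<epsilon>_t is replaced by the
  smaller 1 - \<epsilon>, both terms of the step then carry a factor \<rho>^t, and the initial
  condition \<nu> + \<eta> e 0 \<le> \<rho> supplies one more power, hence the exponent
  \<open>Suc t\<close>.\<close>

lemma error_recursion:
  fixes e :: "nat \<Rightarrow> real" and M \<gamma> \<epsilon> \<rho> :: real
  assumes step: "\<And>t. t < t0 \<Longrightarrow> e (Suc t) \<le> (eps_seq \<epsilon> \<rho> t * \<gamma> * e t + M / 2 * (e t)\<^sup>2) / ((1 - eps_seq \<epsilon> \<rho> t) * \<gamma>)"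
    and nonneg: "\<And>t. 0 \<le> e t" and M: "0 < M" and \<gamma>: "0 < \<gamma>"
    and \<epsilon>: "0 < \<epsilon>" "\<epsilon> < 1" and \<rho>: "0 < \<rho>" "\<rho> < 1"
    and init: "e 0 \<le> (\<rho> - nu_seq \<epsilon> \<rho> 0) / eta_seq M \<gamma> \<epsilon> \<rho> 0"
  shows "t < t0 \<Longrightarrow> e (Suc t) \<le> \<rho> ^ Suc t * e t"
proof -
  define \<nu> where "\<nu> = \<epsilon> / (1 - \<epsilon>)"
  define \<eta> where "\<eta> = M / (2 * (1 - \<epsilon>) * \<gamma>)"
  have \<eta>: "0 < \<eta>" using M \<gamma> \<epsilon> by (simp add: \<eta>_def)
  have init': "\<nu> + \<eta> * e 0 \<le> \<rho>"
  proof -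
    have "nu_seq \<epsilon> \<rho> 0 = \<nu>" "eta_seq M \<gamma> \<epsilon> \<rho> 0 = \<eta>"
      by (simp_all add: nu_seq_def eta_seq_def eps_seq_def \<nu>_def \<eta>_def)
    then have "e 0 * \<eta> \<le> \<rho> - \<nu>" using init by (simp only: pos_le_divide_eq[OF \<eta>])
    then show ?thesis by (simp add: mult.commute)
  qed
  have contraction: "e (Suc t) \<le> \<rho> ^ Suc t * e t" if t: "t < t0" and IH: "e t \<le> \<rho> ^ t * e 0" for t
  proof -
    define \<epsilon>t where "\<epsilon>t = \<rho> ^ t * \<epsilon>"
    have \<epsilon>t: "0 < \<epsilon>t" "\<epsilon>t \<le> \<epsilon>" using \<epsilon> \<rho> by (auto simp: \<epsilon>t_def mult_left_le_one_le power_le_one)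
    have "e (Suc t) \<le> (\<epsilon>t * \<gamma> * e t + M / 2 * (e t)\<^sup>2) / ((1 - \<epsilon>t) * \<gamma>)"
      using step[OF t] by (simp add: \<epsilon>t_def eps_seq_def)
    also have "\<dots> \<le> (\<epsilon>t * \<gamma> * e t + M / 2 * (e t)\<^sup>2) / ((1 - \<epsilon>) * \<gamma>)"
      using \<epsilon>t \<epsilon> \<gamma> M nonneg[of t] by (intro divide_left_mono mult_right_mono) auto
    also have "\<dots> = (\<rho> ^ t * \<nu> + \<eta> * e t) * e t"
    proof -
      define d where "d = 1 - \<epsilon>"
      have "0 < d" using \<epsilon> by (simp add: d_def)
      then show ?thesis using \<gamma>
        by (simp add: \<epsilon>t_def \<nu>_def \<eta>_def d_def[symmetric] field_simps power2_eq_square)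
    qed
    also have "\<dots> \<le> (\<rho> ^ t * \<nu> + \<eta> * (\<rho> ^ t * e 0)) * e t"
      using IH \<eta> nonneg by (intro mult_right_mono add_left_mono mult_left_mono) auto
    also have "\<dots> = \<rho> ^ t * (\<nu> + \<eta> * e 0) * e t" by (simp add: algebra_simps)
    also have "\<dots> \<le> \<rho> ^ t * \<rho> * e t"
      using init' \<rho> nonneg by (intro mult_right_mono mult_left_mono) auto
    finally show ?thesis by (simp add: mult_ac)
  qed
  have bound: "e t \<le> \<rho> ^ t * e 0" if "t \<le> t0" for t
    using that
  proof (induction t)
    case (Suc t)
    then have "e t \<le> \<rho> ^ t * e 0" by simp
    with Suc.prems have "e (Suc t) \<le> \<rho> ^ Suc t * e t" by (intro contraction) auto
    \<comment> \<open>A single factor \<rho> of the contraction suffices to restore the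
      invariant.\<close>
    also have "\<dots> = \<rho> ^ t * (\<rho> * e t)" by simp
    also have "\<dots> \<le> 1 * (\<rho> * e t)"
      using \<rho> nonneg by (intro mult_right_mono power_le_one) auto
    also have "\<dots> \<le> \<rho> * (\<rho> ^ t * e 0)" using Suc \<rho> by simp
    finally show ?case by (simp add: mult_ac)
  qed simp
  show "e (Suc t) \<le> \<rho> ^ Suc t * e t" if "t < t0"
    using that bound[of t] by (intro contraction) auto
qed

section \<open>Measurability of the iterates\<close>

text \<open>A pointwise limit of continuous difference quotients. It is applied to both derivatives
  of the loss, the second of which is not assumed continuous.\<close>

lemma borel_measurable_deriv:
  fixes f :: "real \<Rightarrow> real"
  assumes "\<And>x. f differentiable (at x)"
  shows "deriv f \<in> borel_measurable borel"
proof (rule borel_measurable_LIMSEQ_real)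
  have cont: "continuous_on UNIV f"
    using assms by (intro continuous_at_imp_continuous_on) (auto intro: differentiable_imp_continuous_within)
  show "(\<lambda>x. (f (x + 1 / real (Suc k)) - f x) / (1 / real (Suc k))) \<in> borel_measurable borel" for k
    by (intro borel_measurable_continuous_onI continuous_intros continuous_on_compose2[OF cont]) auto
  fix x :: real
  have "((\<lambda>h. (f (x + h) - f x) / h) \<longlongrightarrow> deriv f x) (at 0)"
    using assms[of x] by (simp add: DERIV_deriv_iff_real_differentiable[symmetric] DERIV_def)
  moreover have "filterlim (\<lambda>k. 1 / real (Suc k)) (at 0) sequentially"
    using LIMSEQ_inverse_real_of_nat by (auto simp: filterlim_at inverse_eq_divide)
  ultimately show "(\<lambda>k. (f (x + 1 / real (Suc k)) - f x) / (1 / real (Suc k))) \<longlonglongrightarrow> deriv f x"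
    by (rule filterlim_compose)
qed

text \<open>Measurability is stated entry by entry, while the dimension is demanded at every
  \<open>s\<close>, so that index ranges can be rewritten unconditionally.\<close>

definition measurable_mat :: "'a measure \<Rightarrow> nat \<Rightarrow> nat \<Rightarrow> ('a \<Rightarrow> real mat) \<Rightarrow> bool" where
  "measurable_mat M r c F \<longleftrightarrow> (\<forall>s. F s \<in> carrier_mat r c) \<and>
     (\<forall>i<r. \<forall>j<c. (\<lambda>s. F s $$ (i, j)) \<in> borel_measurable M)"

definition measurable_vec :: "'a measure \<Rightarrow> nat \<Rightarrow> ('a \<Rightarrow> real vec) \<Rightarrow> bool" where
  "measurable_vec M r f \<longleftrightarrow> (\<forall>s. f s \<in> carrier_vec r) \<and>
     (\<forall>i<r. (\<lambda>s. f s $ i) \<in> borel_measurable M)"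

lemma measurable_mat_carrierD: "measurable_mat M r c F \<Longrightarrow> F s \<in> carrier_mat r c"
  by (simp add: measurable_mat_def)

lemma measurable_vec_carrierD: "measurable_vec M r f \<Longrightarrow> f s \<in> carrier_vec r"
  by (simp add: measurable_vec_def)

lemma measurable_mat_const: "A \<in> carrier_mat r c \<Longrightarrow> measurable_mat M r c (\<lambda>_. A)"
  by (simp add: measurable_mat_def)

lemma measurable_vec_const: "v \<in> carrier_vec r \<Longrightarrow> measurable_vec M r (\<lambda>_. v)"
  by (simp add: measurable_vec_def)

lemma measurable_mat_add:
  assumes "measurable_mat M r c F" "measurable_mat M r c G"
  shows "measurable_mat M r c (\<lambda>s. F s + G s)"
proof -
  have [simp]: "dim_row (G s) = r" "dim_col (G s) = c" for s
    using assms by (auto simp: measurable_mat_def)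
  show ?thesis
    using assms by (auto simp: measurable_mat_def intro!: borel_measurable_add borel_measurable_times)
qed

lemma measurable_mat_smult:
  assumes "measurable_mat M r c F"
  shows "measurable_mat M r c (\<lambda>s. a \<cdot>\<^sub>m F s)"
proof -
  have [simp]: "dim_row (F s) = r" "dim_col (F s) = c" for s
    using assms by (auto simp: measurable_mat_def)
  show ?thesis
    using assms by (auto simp: measurable_mat_def intro!: borel_measurable_add borel_measurable_times)
qed

lemma measurable_mat_transpose:
  assumes "measurable_mat M r c F"
  shows "measurable_mat M c r (\<lambda>s. (F s)\<^sup>T)"
proof -
  have [simp]: "dim_row (F s) = r" "dim_col (F s) = c" for s
    using assms by (auto simp: measurable_mat_def)
  show ?thesis
    using assms by (auto simp: measurable_mat_def intro!: borel_measurable_add borel_measurable_times)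
qed

lemma measurable_mat_mult:
  assumes "measurable_mat M r k F" "measurable_mat M k c G"
  shows "measurable_mat M r c (\<lambda>s. F s * G s)"
proof -
  have [simp]: "dim_row (F s) = r" "dim_col (F s) = k" "dim_row (G s) = k" "dim_col (G s) = c" for s
    using assms by (auto simp: measurable_mat_def)
  have "(F s * G s) $$ (i, j) = (\<Sum>l<k. F s $$ (i, l) * G s $$ (l, j))" if "i < r" "j < c" for i j s
    using that by (simp add: scalar_prod_def atLeast0LessThan)
  then show ?thesis
    using assms by (auto simp: measurable_mat_def intro!: borel_measurable_sum borel_measurable_times)
qed

lemma measurable_mat_mult_vec:
  assumes "measurable_mat M r k F" "measurable_vec M k g"
  shows "measurable_vec M r (\<lambda>s. F s *\<^sub>v g s)"
proof -
  have [simp]: "dim_row (F s) = r" "dim_col (F s) = k" "dim_vec (g s) = k" for s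
    using assms by (auto simp: measurable_mat_def measurable_vec_def)
  have "(F s *\<^sub>v g s) $ i = (\<Sum>l<k. F s $$ (i, l) * g s $ l)" if "i < r" for i s
    using that by (simp add: scalar_prod_def atLeast0LessThan)
  then show ?thesis
    using assms unfolding measurable_mat_def measurable_vec_def
    by (auto simp del: index_mult_mat_vec intro!: borel_measurable_sum borel_measurable_times mult_mat_vec_carrier[of _ r k])
qed

lemma measurable_vec_add:
  assumes "measurable_vec M r f" "measurable_vec M r g"
  shows "measurable_vec M r (\<lambda>s. f s + g s)"
proof -
  have [simp]: "dim_vec (g s) = r" for s using assms by (auto simp: measurable_vec_def)
  show ?thesis
    using assms by (auto simp: measurable_vec_def
        intro!: borel_measurable_add borel_measurable_diff borel_measurable_times)
qed

lemma measurable_vec_diff: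
  assumes "measurable_vec M r f" "measurable_vec M r g"
  shows "measurable_vec M r (\<lambda>s. f s - g s)"
proof -
  have [simp]: "dim_vec (g s) = r" for s using assms by (auto simp: measurable_vec_def)
  show ?thesis
    using assms by (auto simp: measurable_vec_def
        intro!: borel_measurable_add borel_measurable_diff borel_measurable_times)
qed

lemma measurable_vec_smult:
  assumes "measurable_vec M r f"
  shows "measurable_vec M r (\<lambda>s. a \<cdot>\<^sub>v f s)"
proof -
  have [simp]: "dim_vec (f s) = r" for s using assms by (auto simp: measurable_vec_def)
  show ?thesis
    using assms by (auto simp: measurable_vec_def
        intro!: borel_measurable_add borel_measurable_diff borel_measurable_times)
qed

lemma measurable_vnorm:
  assumes "measurable_vec M r f"
  shows "(\<lambda>s. vnorm (f s)) \<in> borel_measurable M"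
proof -
  have "dim_vec (f s) = r" for s using assms by (auto simp: measurable_vec_def)
  then have "vnorm (f s) = sqrt (\<Sum>i<r. f s $ i * f s $ i)" for s
    by (simp add: vnorm_def scalar_prod_def atLeast0LessThan)
  moreover have "(\<lambda>s. \<Sum>i<r. f s $ i * f s $ i) \<in> borel_measurable M"
    using assms by (auto simp: measurable_vec_def intro!: borel_measurable_sum borel_measurable_times)
  ultimately show ?thesis by simp
qed

text \<open>By the Leibniz formula the determinant is a polynomial in the entries.\<close>

lemma measurable_det:
  assumes "measurable_mat M r r F"
  shows "(\<lambda>s. det (F s)) \<in> borel_measurable M"
proof -
  have "det (F s) = (\<Sum>p | p permutes {0..<r}. signof p * (\<Prod>i = 0..<r. F s $$ (i, p i)))" for s
    using assms by (intro det_def') (simp add: measurable_mat_def)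
  moreover have "(\<lambda>s. F s $$ (i, p i)) \<in> borel_measurable M" if "p permutes {0..<r}" "i \<in> {0..<r}" for p i
    using assms that permutes_in_image[OF that(1), of i] by (auto simp: measurable_mat_def)
  ultimately show ?thesis
    by (auto intro!: borel_measurable_sum borel_measurable_times borel_measurable_prod)
qed

lemma mat_inv_carrier:
  assumes "A \<in> carrier_mat n n"
  shows "mat_inv A \<in> carrier_mat n n"
  using assms mat_inverse(2)[OF assms] by (auto simp: mat_inv_def split: option.splits)

text \<open>Also valid for singular \<open>A\<close>, since both sides are then \<open>0\<close>.\<close>

lemma mat_inv_index:
  assumes A: "A \<in> carrier_mat n n" and ij: "i < n" "j < n"
  shows "mat_inv A $$ (i, j) = cofactor A j i / det A"
proof (cases "det A = 0")
  case True
  have "mat_inverse A = None"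
  proof (cases "mat_inverse A")
    case (Some B)
    then have "A * B = 1\<^sub>m n" "B \<in> carrier_mat n n" using mat_inverse(2)[OF A] by auto
    then have "det A * det B = 1" using det_mult[OF A, of B] by simp
    then show ?thesis using True by simp
  qed
  then show ?thesis using True A ij by (simp add: mat_inv_def)
next
  case False
  then obtain B where B: "mat_inverse A = Some B" "B \<in> carrier_mat n n" "A * B = 1\<^sub>m n" "B * A = 1\<^sub>m n"
    using mat_inverse_nonsingular[OF A] by metis
  have "det A \<cdot>\<^sub>m B = B * (det A \<cdot>\<^sub>m 1\<^sub>m n)"
    using B(2) by (simp add: mult_smult_distrib[of _ n n _ n])
  also have "\<dots> = B * (A * adj_mat A)" using adj_mat(2)[OF A] by simp
  also have "\<dots> = B * A * adj_mat A" using A B(2) adj_mat(1)[OF A] by simp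
  also have "\<dots> = adj_mat A" using adj_mat(1)[OF A] by (simp only: B(4) left_mult_one_mat)
  finally have "(det A \<cdot>\<^sub>m B) $$ (i, j) = adj_mat A $$ (i, j)" by simp
  then show ?thesis using False A B(1,2) ij by (simp add: mat_inv_def adj_mat_def field_simps)
qed

lemma measurable_mat_inv:
  assumes F: "measurable_mat M n n F"
  shows "measurable_mat M n n (\<lambda>s. mat_inv (F s))"
  unfolding measurable_mat_def
proof (intro conjI allI impI)
  have carr: "F s \<in> carrier_mat n n" for s using F by (rule measurable_mat_carrierD)
  then show "mat_inv (F s) \<in> carrier_mat n n" for s by (rule mat_inv_carrier)
  fix i j assume ij: "i < n" "j < n"
  have "measurable_mat M (n - 1) (n - 1) (\<lambda>s. mat_delete (F s) j i)"
    using F ij carrier_matD[OF carr] by (auto simp: measurable_mat_def mat_delete_def)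
  then have "(\<lambda>s. (- 1) ^ (j + i) * det (mat_delete (F s) j i) / det (F s)) \<in> borel_measurable M"
    using measurable_det[OF F] measurable_det by (intro borel_measurable_divide borel_measurable_times) auto
  then show "(\<lambda>s. mat_inv (F s) $$ (i, j)) \<in> borel_measurable M"
    using ij by (simp add: mat_inv_index[OF carr] cofactor_def)
qed

context
  fixes P :: kernel_problem and n and t0 :: nat and m :: "nat \<Rightarrow> nat"
  assumes valid: "valid_problem P"
  defines "n \<equiv> n_pts P"
begin

section \<open>Measurability along the Newton iteration\<close>

lemma measurable_objective_grad:
  assumes "measurable_vec M n f"
  shows "measurable_vec M n (\<lambda>s. objective_grad P (f s))"
proof -
  have K: "measurable_vec M n (\<lambda>s. gram P *\<^sub>v f s)"
    using assms by (intro measurable_mat_mult_vec measurable_mat_const) (auto simp: n_def)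
  have "deriv (loss P y) \<in> borel_measurable borel" for y
    using valid by (intro borel_measurable_deriv) (simp add: valid_problem_def)
  then have "measurable_vec M n (\<lambda>s. vec n (\<lambda>i. deriv (loss P (outp P i)) ((gram P *\<^sub>v f s) $ i)))"
    using K by (auto simp: measurable_vec_def simp del: index_mult_mat_vec)
  then show ?thesis
    unfolding objective_grad_def n_def[symmetric]
    by (intro measurable_vec_add measurable_vec_smult K measurable_mat_mult_vec[OF measurable_mat_const])
      (auto simp: n_def)
qed

lemma measurable_hess_with:
  assumes A: "measurable_mat M n n A" and f: "measurable_vec M n f"
  shows "measurable_mat M n n (\<lambda>s. hess_with P (A s) (f s))"
proof -
  have K: "measurable_vec M n (\<lambda>s. gram P *\<^sub>v f s)"
    using f by (intro measurable_mat_mult_vec measurable_mat_const) (auto simp: n_def)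
  have "deriv (deriv (loss P y)) \<in> borel_measurable borel" for y
    using valid by (intro borel_measurable_deriv) (simp add: valid_problem_def)
  then have "measurable_mat M n n (\<lambda>s. loss_diag P (f s))"
    using K by (auto simp: measurable_mat_def measurable_vec_def loss_diag_def n_def simp del: index_mult_mat_vec)
  then show ?thesis
    unfolding hess_with_def by (intro measurable_mat_add measurable_mat_smult measurable_mat_mult[of _ n n] A)
qed

lemma feature_measurable:
  assumes "i < n"
  shows "feat P (pt P i) \<in> borel_measurable (feature_law P)"
  using valid assms by (simp add: valid_problem_def n_def feature_law_def)

lemma measurable_gram_hat:
  assumes "t < t0"
  shows "measurable_mat (samples P t0 m) n n (\<lambda>s. gram_hat P m s t)"
proof -
  have "(\<lambda>s. feat P (pt P i) (s (t, j))) \<in> borel_measurable (samples P t0 m)" if "i < n" "j < m t" for i j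
  proof -
    have "(\<lambda>s. s (t, j)) \<in> measurable (samples P t0 m) (feature_law P)"
      unfolding samples_def using assms that by (intro measurable_component_singleton) auto
    from measurable_compose[OF this feature_measurable[OF that(1)]] show ?thesis .
  qed
  then have "measurable_mat (samples P t0 m) n (m t) (\<lambda>s. feat_mat P m s t)"
    by (auto simp: measurable_mat_def feat_mat_def n_def)
  then show ?thesis
    unfolding gram_hat_def add_ridge_def
    by (intro measurable_mat_add measurable_mat_mult[of _ n "m t"] measurable_mat_transpose measurable_mat_const)
      (auto simp: n_def)
qed

text \<open>Makes the convergence event measurable. The induction carries the dimension of the
  iterates along, which allows \<open>gradient\<close> to be replaced by its closed form.\<close>

lemma measurable_rfn:
  assumes diff: "twice_differentiable n (objective P)" and w0: "w0 \<in> carrier_vec n"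
  shows "t \<le> t0 \<Longrightarrow> measurable_vec (samples P t0 m) n (\<lambda>s. rfn P m \<alpha> w0 s t)"
proof (induction t)
  case 0
  then show ?case using w0 by (simp add: measurable_vec_const)
next
  case (Suc t)
  then have IH: "measurable_vec (samples P t0 m) n (\<lambda>s. rfn P m \<alpha> w0 s t)" by simp
  have grad: "gradient (n_pts P) (objective P) (rfn P m \<alpha> w0 s t) = objective_grad P (rfn P m \<alpha> w0 s t)" for s
    using gradient_objective[OF valid] diff measurable_vec_carrierD[OF IH] by (simp add: n_def)
  show ?case
    unfolding rfn.simps grad hess_hat_def
    using Suc.prems
    by (intro measurable_vec_diff IH measurable_vec_smult measurable_mat_mult_vec[of _ n n] measurable_mat_inv
        measurable_hess_with measurable_objective_grad measurable_gram_hat) auto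
qed

end

section \<open>Random features\<close>

text \<open>The bilinear form of \<open>cov\<close> is its trace against the rank-one matrix
  \<open>B\<close> built from \<open>v\<close> and \<open>u\<close>, so the rule for integrating
  traces applies.\<close>

lemma (in bounded_features) scalar_prod_cov:
  assumes u: "u \<in> carrier_vec n" and v: "v \<in> carrier_vec n"
  shows "u \<bullet> (cov *\<^sub>v v) = expectation (\<lambda>x. (feature_vec x \<bullet> u) * (feature_vec x \<bullet> v))"
    and "integrable N (\<lambda>x. (feature_vec x \<bullet> u) * (feature_vec x \<bullet> v))"
proof -
  define B where "B = mat n n (\<lambda>(j, i). v $ j * u $ i)"
  have B: "B \<in> carrier_mat n n" by (simp add: B_def)
  have eq: "tr (outer x * B) = (feature_vec x \<bullet> u) * (feature_vec x \<bullet> v)" for x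
    unfolding tr_mult[OF outer_carrier B] using u v
    by (simp add: outer_def B_def feature_vec_def scalar_prod_def atLeast0LessThan sum_product mult_ac)
  show "integrable N (\<lambda>x. (feature_vec x \<bullet> u) * (feature_vec x \<bullet> v))"
    unfolding eq[symmetric]
    by (intro bounded_rv_integrable bounded_rv_tr[of _ n] bounded_rmat_mult bounded_rmat_const bounded_outer B)
  have "u \<bullet> (cov *\<^sub>v v) = tr (cov * B)"
    unfolding scalar_prod_mult_mat_vec[OF cov_carrier u v] tr_mult[OF cov_carrier B]
    by (simp add: B_def mult_ac)
  also have "\<dots> = expectation (\<lambda>x. tr (outer x * B))"
    unfolding cov_def by (rule integral_tr_mult_left[OF bounded_outer B, symmetric])
  finally show "u \<bullet> (cov *\<^sub>v v) = expectation (\<lambda>x. (feature_vec x \<bullet> u) * (feature_vec x \<bullet> v))"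
    by (simp only: eq)
qed

text \<open>\<open>cov *\<^sub>v v\<close> is tested against itself; Cauchy-Schwarz under the
  expectation produces the mean squared feature norm, which is the trace. Consequently the logarithm
  in the sample rate is at least ln (1/\<delta>).\<close>

lemma (in bounded_features) spec_norm_cov_le_tr: "spec_norm cov \<le> tr cov"
proof (rule spec_norm_le[OF cov_carrier tr_cov_nonneg])
  fix v :: "real vec" assume v: "v \<in> carrier_vec n"
  define u where "u = cov *\<^sub>v v"
  have u: "u \<in> carrier_vec n" unfolding u_def by (rule mult_mat_vec_carrier[OF cov_carrier v])
  have bz: "bounded_rmat N n outer" by (rule bounded_outer)
  have int: "integrable N (\<lambda>x. tr (outer x))" by (intro bounded_rv_integrable bounded_rv_tr[of _ n] bz)
  have trE: "expectation (\<lambda>x. tr (outer x)) = tr cov"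
    using integral_tr_mult_left[OF bz one_carrier_mat] by (simp add: cov_def right_mult_one_mat[of _ n n])
  have zz: "feature_vec x \<bullet> feature_vec x = tr (outer x)" for x
    by (simp add: feature_vec_def scalar_prod_def atLeast0LessThan tr_def outer_def)
  have "(vnorm u)\<^sup>2 = expectation (\<lambda>x. (feature_vec x \<bullet> u) * (feature_vec x \<bullet> v))"
    unfolding vnorm_sq using scalar_prod_cov(1)[OF u v] by (simp add: u_def)
  also have "\<dots> \<le> expectation (\<lambda>x. tr (outer x) * (vnorm u * vnorm v))"
  proof (intro integral_mono scalar_prod_cov(2)[OF u v] integrable_mult_left int)
    fix x
    have "(feature_vec x \<bullet> u) * (feature_vec x \<bullet> v) \<le> \<bar>feature_vec x \<bullet> u\<bar> * \<bar>feature_vec x \<bullet> v\<bar>"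
      by (simp flip: abs_mult)
    also have "\<dots> \<le> (vnorm (feature_vec x) * vnorm u) * (vnorm (feature_vec x) * vnorm v)"
      by (intro mult_mono abs_scalar_prod_le[of _ n] feature_vec_carrier u v) auto
    also have "\<dots> = (vnorm (feature_vec x))\<^sup>2 * (vnorm u * vnorm v)" by (simp add: power2_eq_square)
    finally show "(feature_vec x \<bullet> u) * (feature_vec x \<bullet> v) \<le> tr (outer x) * (vnorm u * vnorm v)"
      by (simp only: vnorm_sq zz)
  qed
  also have "\<dots> = tr cov * (vnorm u * vnorm v)" by (simp add: int trE)
  finally have le: "vnorm u * vnorm u \<le> (tr cov * vnorm v) * vnorm u" by (simp add: power2_eq_square mult_ac)
  show "vnorm (cov *\<^sub>v v) \<le> tr cov * vnorm v"
  proof (cases "vnorm u = 0")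
    case True
    then show ?thesis using tr_cov_nonneg by (simp add: u_def[symmetric])
  next
    case False
    then have "0 < vnorm u" using vnorm_nonneg[of u] by linarith
    then show ?thesis using le by (simp add: u_def[symmetric])
  qed
qed

lemma bounded_features_problem:
  assumes valid: "valid_problem P"
  shows "bounded_features (feature_law P) (n_pts P) (\<lambda>i. feat P (pt P i))"
proof -
  interpret prob_space "feature_law P" using valid by (simp add: valid_problem_def)
  show ?thesis
    by unfold_locales (use valid in \<open>auto simp: valid_problem_def feature_law_def\<close>)
qed

lemma cov_problem:
  assumes valid: "valid_problem P"
  shows "bounded_features.cov (feature_law P) (n_pts P) (\<lambda>i. feat P (pt P i)) = gram1 P"
proof -
  interpret bounded_features "feature_law P" "n_pts P" "\<lambda>i. feat P (pt P i)"
    using valid by (rule bounded_features_problem)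
  show ?thesis
  proof (rule eq_matI)
    fix i j assume "i < dim_row (gram1 P)" "j < dim_col (gram1 P)"
    then have ij: "i < n_pts P" "j < n_pts P" by (auto simp: gram1_def)
    have [measurable]: "feat P (pt P i) \<in> borel_measurable (leb (dim_x P))"
      "feat P (pt P j) \<in> borel_measurable (leb (dim_x P))" "dens P \<in> borel_measurable (leb (dim_x P))"
      using valid ij by (auto simp: valid_problem_def)
    have "(LINT \<omega>|feature_law P. feat P (pt P i) \<omega> * feat P (pt P j) \<omega>)
      = (LINT \<omega>|leb (dim_x P). dens P \<omega> * (feat P (pt P i) \<omega> * feat P (pt P j) \<omega>))"
      unfolding feature_law_def using valid by (intro integral_real_density) (auto simp: valid_problem_def)
    then show "cov $$ (i, j) = gram1 P $$ (i, j)"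
      using ij by (simp add: cov_def expect_mat_def outer_def gram1_def kern_def mult_ac)
  qed (auto simp: cov_def expect_mat_def gram1_def)
qed

text \<open>The ridge cancels, and the two factors 1 / sqrt m in \<open>feat_mat\<close> combine to
  1 / m. The features of iteration \<open>t\<close> are those with index
  \<open>(t, j)\<close>.\<close>

lemma gram_hat_diff:
  assumes valid: "valid_problem P" and m: "0 < m t" and v: "v \<in> carrier_vec (n_pts P)"
  shows "(gram_hat P m s t - gram P) *\<^sub>v v = (1 / real (m t)) \<cdot>\<^sub>v
    (bounded_features.deviation (feature_law P) (n_pts P) (\<lambda>i. feat P (pt P i)) (Pair t ` {..<m t}) s *\<^sub>v v)"
proof -
  interpret bounded_features "feature_law P" "n_pts P" "\<lambda>i. feat P (pt P i)"
    using valid by (rule bounded_features_problem)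
  have "gram_hat P m s t - gram P = (1 / real (m t)) \<cdot>\<^sub>m deviation (Pair t ` {..<m t}) s"
  proof (rule eq_matI)
    fix i k assume "i < dim_row ((1 / real (m t)) \<cdot>\<^sub>m deviation (Pair t ` {..<m t}) s)"
      "k < dim_col ((1 / real (m t)) \<cdot>\<^sub>m deviation (Pair t ` {..<m t}) s)"
    then have ik: "i < n_pts P" "k < n_pts P" by (auto simp: deviation_def)
    define a where "a j = feat P (pt P i) (s (t, j)) * feat P (pt P k) (s (t, j))" for j
    have "deviation (Pair t ` {..<m t}) s $$ (i, k) = (\<Sum>j<m t. a j - gram1 P $$ (i, k))"
      using ik carrier_matD[OF gram1_carrier[of P]]
      by (simp add: deviation_def sum.reindex inj_on_def outer_def cov_problem[OF valid] a_def)
    also have "\<dots> = (\<Sum>j<m t. a j) - real (m t) * gram1 P $$ (i, k)"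
      by (simp add: sum_subtractf)
    finally have dev: "deviation (Pair t ` {..<m t}) s $$ (i, k) = (\<Sum>j<m t. a j) - real (m t) * gram1 P $$ (i, k)" .
    have "(feat_mat P m s t * (feat_mat P m s t)\<^sup>T) $$ (i, k) = (\<Sum>j<m t. a j / real (m t))"
      using ik m by (simp add: feat_mat_def scalar_prod_def atLeast0LessThan a_def)
    also have "\<dots> = (\<Sum>j<m t. a j) / real (m t)" by (simp add: sum_divide_distrib)
    finally have "(feat_mat P m s t * (feat_mat P m s t)\<^sup>T) $$ (i, k) = (\<Sum>j<m t. a j) / real (m t)" .
    moreover have "feat_mat P m s t * (feat_mat P m s t)\<^sup>T \<in> carrier_mat (n_pts P) (n_pts P)"
      by (auto simp: feat_mat_def)
    ultimately show "(gram_hat P m s t - gram P) $$ (i, k) = ((1 / real (m t)) \<cdot>\<^sub>m deviation (Pair t ` {..<m t}) s) $$ (i, k)"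
      using ik dev m carrier_matD[OF gram1_carrier[of P]] carrier_matD[OF deviation_carrier[of "Pair t ` {..<m t}" s]]
      by (simp add: gram_hat_def gram_def add_ridge_def diff_divide_distrib)
  qed (auto simp: gram_hat_def gram_def add_ridge_def gram1_def deviation_def feat_mat_def)
  then show ?thesis using v by (simp add: smult_mat_mult_vec[OF deviation_carrier])
qed


section \<open>Convergence of the iteration\<close>

lemma gram_hat_carrier [simp]: "gram_hat P m s t \<in> carrier_mat (n_pts P) (n_pts P)"
  unfolding gram_hat_def
  by (intro add_ridge_carrier mult_carrier_mat[of _ _ "m t"]) (auto simp: feat_mat_def)

text \<open>Dropping the sampled matrix leaves a deterministic lower bound, of the form that
  \<open>coercivity_le\<close> provides.\<close>

lemma zeta_lower:
  assumes valid: "valid_problem P" and lam: "0 \<le> lam"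
  shows "reg P + lam * spec_norm ((1 / real (n_pts P)) \<cdot>\<^sub>m gram P) \<le> zeta P lam m s t"
    and "0 < zeta P lam m s t"
proof -
  have "0 \<le> lam * spec_norm ((1 / real (n_pts P)) \<cdot>\<^sub>m gram_hat P m s t)"
    using lam by (intro mult_nonneg_nonneg spec_norm_nonneg[of _ "n_pts P"]) auto
  moreover have "0 \<le> lam * spec_norm ((1 / real (n_pts P)) \<cdot>\<^sub>m gram P)"
    using lam by (intro mult_nonneg_nonneg spec_norm_nonneg[of _ "n_pts P"]) auto
  moreover have "0 < reg P" using valid by (simp add: valid_problem_def)
  ultimately show "reg P + lam * spec_norm ((1 / real (n_pts P)) \<cdot>\<^sub>m gram P) \<le> zeta P lam m s t"
    and "0 < zeta P lam m s t" by (simp_all add: zeta_def)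
qed

text \<open>
  The approximation bound holds for all \<open>w\<close> at once, so that the dependence of the iterates on the
  features drawn earlier is irrelevant.  The radius \<open>s\<^sub>0\<close> below is deterministic, while the bound
  \<open>s\<^sub>0 * \<zeta> \<le> \<epsilon>\<^sub>t * \<gamma>\<close> on it only holds almost surely.
\<close>

lemma hess_hat_concentration:
  fixes P :: kernel_problem and \<delta> \<delta>\<^sub>0 R \<gamma> lam \<epsilon> \<rho> :: real and t t0 :: nat
  assumes valid: "valid_problem P" and \<gamma>: "0 < \<gamma>"
    and coer: "\<And>w v. w \<in> carrier_vec (n_pts P) \<Longrightarrow> v \<in> carrier_vec (n_pts P) \<Longrightarrow>
      \<gamma> * (v \<bullet> v) \<le> v \<bullet> (hess P w *\<^sub>v v)"
    and lam: "\<And>w. w \<in> carrier_vec (n_pts P) \<Longrightarrow> spec_norm (loss_diag P w) \<le> lam"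
    and \<delta>: "0 < \<delta>" "\<delta> \<le> \<delta>\<^sub>0" "\<delta>\<^sub>0 < 1"
    and R: "\<epsilon> * ridge P \<le> R * spec_norm (gram1 P)"
    and \<epsilon>: "0 < \<epsilon>" "\<epsilon> < 1" and \<rho>: "0 < \<rho>" "\<rho> < 1" and t: "t < t0"
    and rate: "AE s in samples P t0 m. real (m t) \<ge>
      32 * (1 + 1 / ln (1 / \<delta>\<^sub>0)) * (1 + \<bar>R\<bar>)\<^sup>2 * sample_rate P lam \<gamma> \<epsilon> \<rho> \<delta> m s t"
  shows "\<exists>E\<in>sets (samples P t0 m). measure (samples P t0 m) E \<le> \<delta> \<and>
    (AE s in samples P t0 m. s \<notin> E \<longrightarrow> (\<forall>w\<in>carrier_vec (n_pts P). \<forall>v\<in>carrier_vec (n_pts P).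
      vnorm ((hess_hat P m s t w - hess P w) *\<^sub>v v) \<le> eps_seq \<epsilon> \<rho> t * \<gamma> * vnorm v))"
proof -
  interpret F: bounded_features "feature_law P" "n_pts P" "\<lambda>i. feat P (pt P i)"
    using valid by (rule bounded_features_problem)
  interpret S: prob_space "samples P t0 m"
    unfolding samples_def using F.prob_space_axioms by (intro prob_space_PiM)
  define n where "n = n_pts P"
  define \<kappa> where "\<kappa> = spec_norm (gram1 P)"
  define \<epsilon>t where "\<epsilon>t = eps_seq \<epsilon> \<rho> t"
  define B where "B = 1 + \<bar>R\<bar>"
  define c where "c = 32 * (1 + 1 / ln (1 / \<delta>\<^sub>0)) * B\<^sup>2"
  define lg where "lg = ln (tr (gram1 P) / (\<kappa> * \<delta>))"
  define Z where "Z s = zeta P lam m s t" for s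
  define J where "J = Pair t ` {..<m t}"
  have n: "0 < n" and ridge: "0 < ridge P"
    using valid by (auto simp: n_def valid_problem_def)
  have cov: "F.cov = gram1 P" using valid by (rule cov_problem)
  have \<epsilon>t: "0 < \<epsilon>t" "\<epsilon>t \<le> \<epsilon>"
    using \<epsilon> \<rho> by (auto simp: \<epsilon>t_def eps_seq_def mult_left_le_one_le power_le_one)
  have B: "1 \<le> B" by (simp add: B_def)
  have zero: "0\<^sub>v (n_pts P) \<in> carrier_vec (n_pts P)" by simp
  have lam0: "0 \<le> lam"
    using spec_norm_nonneg[OF loss_diag_carrier] lam[OF zero] by (rule order_trans)
  have \<kappa>0: "0 \<le> \<kappa>" unfolding \<kappa>_def by (rule spec_norm_nonneg[OF gram1_carrier])
  \<comment> \<open>For \<kappa> = 0 the hypothesis with \<open>R\<close> would read \<epsilon>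
    \<mu> \<le> 0.\<close>
  have \<kappa>: "0 < \<kappa>"
  proof (rule ccontr)
    assume "\<not> 0 < \<kappa>"
    then have "\<epsilon> * ridge P \<le> 0" using \<kappa>0 R by (simp add: \<kappa>_def)
    then show False using \<epsilon> ridge by (simp add: mult_le_0_iff)
  qed
  have quad: "v \<bullet> (F.cov *\<^sub>v v) \<le> \<kappa> * (v \<bullet> v)" if v: "v \<in> carrier_vec (n_pts P)" for v
  proof -
    have "v \<bullet> (F.cov *\<^sub>v v) \<le> vnorm v * vnorm (F.cov *\<^sub>v v)"
      using abs_scalar_prod_le[OF v mult_mat_vec_carrier[OF F.cov_carrier v]] by simp
    also have "\<dots> \<le> vnorm v * (\<kappa> * vnorm v)"
      unfolding \<kappa>_def cov by (intro mult_left_mono vnorm_mult_le_spec_norm[OF gram1_carrier v]) simp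
    also have "\<dots> = \<kappa> * (v \<bullet> v)" by (simp add: vnorm_sq[symmetric] power2_eq_square)
    finally show ?thesis .
  qed
  have tr: "\<kappa> \<le> tr (gram1 P)" using F.spec_norm_cov_le_tr by (simp add: cov \<kappa>_def)
  have lg: "0 < lg"
    unfolding lg_def
  proof (rule ln_gt_zero)
    have "\<kappa> * \<delta> < \<kappa> * 1" using \<kappa> \<delta> by (intro mult_strict_left_mono) auto
    then have "\<kappa> * \<delta> < tr (gram1 P)" using tr by linarith
    then show "1 < tr (gram1 P) / (\<kappa> * \<delta>)" using \<kappa> \<delta> by (simp add: less_divide_eq)
  qed
  have "0 < ln (1 / \<delta>\<^sub>0)" using \<delta> by (intro ln_gt_zero) auto
  then have c: "0 < c" using B by (simp add: c_def add_pos_pos)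
  have Z: "0 < Z s" "reg P + lam * spec_norm ((1 / real (n_pts P)) \<cdot>\<^sub>m gram P) \<le> Z s" for s
    unfolding Z_def using zeta_lower[OF valid lam0] by auto
  define good where "good s \<longleftrightarrow> c * ((Z s)\<^sup>2 * n * \<kappa> / (\<epsilon>t\<^sup>2 * \<gamma>\<^sup>2) * lg) \<le> real (m t)" for s
  have good: "AE s in samples P t0 m. good s"
    using rate unfolding good_def c_def B_def Z_def n_def \<kappa>_def \<epsilon>t_def lg_def sample_rate_def .
  \<comment> \<open>One sample at which the rate condition holds; it exists because the condition
    holds almost surely on a probability space. From it follow the deterministic facts that
    \<open>m t\<close> is positive and that the radius is at most
    \<open>B * \<kappa>\<close>.\<close>
  obtain s1 where s1: "good s1"
  proof -
    have "\<not> (AE s in samples P t0 m. False)" by simp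
    then have "\<exists>s. good s" using good by (metis (mono_tags, lifting) eventually_mono)
    then show thesis using that by blast
  qed
  have "0 < c * ((Z s1)\<^sup>2 * n * \<kappa> / (\<epsilon>t\<^sup>2 * \<gamma>\<^sup>2) * lg)"
    using c Z(1)[of s1] n \<kappa> \<epsilon>t \<gamma> lg by (intro mult_pos_pos divide_pos_pos) auto
  then have mt: "0 < real (m t)" using s1 unfolding good_def by linarith
  \<comment> \<open>The solution of the sample-size equation of
    \<open>deviation_concentration\<close>. With this choice the rate condition turns into
    \<open>s\<^sub>0 * Z s \<le> \<epsilon>t * \<gamma>\<close>.\<close>
  define s\<^sub>0 where "s\<^sub>0 = sqrt (c * n * \<kappa> * lg / m t)"
  have pos: "0 < c * n * \<kappa> * lg / m t"
    using c n \<kappa> lg mt by (intro mult_pos_pos divide_pos_pos) auto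
  then have s0: "0 < s\<^sub>0" "s\<^sub>0\<^sup>2 = c * n * \<kappa> * lg / m t" by (simp_all add: s\<^sub>0_def)
  have radius: "s\<^sub>0 * Z s \<le> \<epsilon>t * \<gamma>" if "good s" for s
  proof (rule power2_le_imp_le)
    have "c * (Z s)\<^sup>2 * n * \<kappa> * lg \<le> real (m t) * (\<epsilon>t\<^sup>2 * \<gamma>\<^sup>2)"
      using that \<epsilon>t \<gamma> unfolding good_def by (simp add: divide_le_eq mult_ac)
    then have "c * (Z s)\<^sup>2 * n * \<kappa> * lg / m t \<le> \<epsilon>t\<^sup>2 * \<gamma>\<^sup>2"
      using mt by (simp add: divide_le_eq mult_ac)
    then show "(s\<^sub>0 * Z s)\<^sup>2 \<le> (\<epsilon>t * \<gamma>)\<^sup>2"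
      by (simp add: power_mult_distrib s0(2) mult_ac)
  qed (use \<epsilon>t \<gamma> in simp)
  \<comment> \<open>Coercivity trades \<gamma> for \<open>Z s1 * (\<kappa> + ridge P)\<close>; the
    random factor \<open>Z s1\<close> then cancels and a deterministic bound on the radius
    remains.\<close>
  have "s\<^sub>0 * Z s1 \<le> \<epsilon>t * (\<kappa> + ridge P) * Z s1"
  proof -
    have "\<gamma> \<le> (reg P + lam * spec_norm ((1 / real (n_pts P)) \<cdot>\<^sub>m gram P)) * (\<kappa> + ridge P)"
      unfolding \<kappa>_def using coercivity_le[OF valid coer[OF zero] lam[OF zero]] .
    also have "\<dots> \<le> Z s1 * (\<kappa> + ridge P)"
      using Z \<kappa> ridge by (intro mult_right_mono) auto
    finally have "\<epsilon>t * \<gamma> \<le> \<epsilon>t * (Z s1 * (\<kappa> + ridge P))" using \<epsilon>t by (intro mult_left_mono) auto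
    then show ?thesis using radius[OF s1] by (simp add: mult_ac)
  qed
  then have "s\<^sub>0 \<le> \<epsilon>t * (\<kappa> + ridge P)" using Z(1)[of s1] by simp
  also have "\<dots> \<le> \<epsilon> * (\<kappa> + ridge P)" using \<epsilon>t \<kappa> ridge by (intro mult_right_mono) auto
  also have "\<dots> \<le> 1 * \<kappa> + \<bar>R\<bar> * \<kappa>"
  proof -
    have "\<epsilon> * \<kappa> \<le> 1 * \<kappa>" using \<epsilon> \<kappa> by (intro mult_right_mono) auto
    moreover have "R * \<kappa> \<le> \<bar>R\<bar> * \<kappa>" using \<kappa> by (intro mult_right_mono) auto
    ultimately show ?thesis using R unfolding \<kappa>_def[symmetric] distrib_left by linarith
  qed
  finally have s0B: "s\<^sub>0 \<le> B * \<kappa>" by (simp add: B_def distrib_right)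
  have cardJ: "card J = m t" by (simp add: J_def card_image inj_on_def)
  define I where "I = {(t, j). t < t0 \<and> j < m t}"
  have "I = Sigma {..<t0} (\<lambda>t. {..<m t})" by (auto simp: I_def)
  then have I: "finite I" by simp
  have J: "J \<subseteq> I" using t by (auto simp: I_def J_def)
  have "real (card J) = c * n * \<kappa> * lg / s\<^sub>0\<^sup>2"
    unfolding cardJ s0(2) using c n \<kappa> lg mt by simp
  then have mJ: "real (card J) = 32 * (1 + 1 / ln (1 / \<delta>\<^sub>0)) * B\<^sup>2 * real (n_pts P) * \<kappa>
      * ln (tr F.cov / (\<kappa> * \<delta>)) / s\<^sub>0\<^sup>2"
    unfolding c_def n_def lg_def cov .
  have J0: "0 < card J" using mt cardJ by simp
  obtain E where E: "E \<in> sets (samples P t0 m)" "measure (samples P t0 m) E \<le> \<delta>"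
    "\<And>s v. s \<in> space (samples P t0 m) - E \<Longrightarrow> v \<in> carrier_vec (n_pts P) \<Longrightarrow>
      vnorm (F.deviation J s *\<^sub>v v) \<le> card J * s\<^sub>0 * vnorm v"
    using F.deviation_concentration[OF I J \<kappa> quad tr[folded cov] \<delta> s0(1) s0B B J0 mJ]
    unfolding samples_def I_def[symmetric] by blast
  have close: "vnorm ((hess_hat P m s t w - hess P w) *\<^sub>v v) \<le> \<epsilon>t * \<gamma> * vnorm v"
    if s: "s \<in> space (samples P t0 m)" "s \<notin> E" "good s"
      and w: "w \<in> carrier_vec (n_pts P)" and v: "v \<in> carrier_vec (n_pts P)" for s w v
  proof -
    have diff: "vnorm ((gram_hat P m s t - gram P) *\<^sub>v x) \<le> s\<^sub>0 * vnorm x"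
      if x: "x \<in> carrier_vec (n_pts P)" for x
      using E(3)[of s x] s x mt
      by (simp add: gram_hat_diff[OF valid] vnorm_smult cardJ divide_le_eq mult_ac flip: J_def)
    from hess_with_diff_le[OF valid gram_carrier gram_hat_carrier diff lam[OF w] v]
    have "vnorm ((hess_hat P m s t w - hess P w) *\<^sub>v v) \<le> Z s * s\<^sub>0 * vnorm v"
      by (simp add: hess_hat_def hess_def Z_def zeta_def)
    also have "\<dots> \<le> \<epsilon>t * \<gamma> * vnorm v"
      using radius[OF s(3)] by (intro mult_right_mono) (auto simp: mult.commute)
    finally show ?thesis .
  qed
  have "AE s in samples P t0 m. s \<notin> E \<longrightarrow> (\<forall>w\<in>carrier_vec (n_pts P). \<forall>v\<in>carrier_vec (n_pts P).
      vnorm ((hess_hat P m s t w - hess P w) *\<^sub>v v) \<le> \<epsilon>t * \<gamma> * vnorm v)"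
    using good AE_space by eventually_elim (use close in blast)
  then show ?thesis using E(1,2) unfolding \<epsilon>t_def by blast
qed

text \<open>The deterministic half, for one fixed sample: \<open>newton_step_le\<close> with
  remainder M/2 times the squared error feeds \<open>error_recursion\<close>, whose index is shifted
  by one.\<close>

lemma rfn_converges:
  fixes P :: kernel_problem and M \<gamma> \<epsilon> \<rho> :: real and s :: "nat \<times> nat \<Rightarrow> nat \<Rightarrow> real"
  assumes valid: "valid_problem P" and diff: "twice_differentiable (n_pts P) (objective P)" and \<gamma>: "0 < \<gamma>"
    and coer: "\<And>w v. w \<in> carrier_vec (n_pts P) \<Longrightarrow> v \<in> carrier_vec (n_pts P) \<Longrightarrow>
      \<gamma> * (v \<bullet> v) \<le> v \<bullet> (hess P w *\<^sub>v v)"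
    and M: "0 < M"
    and lip: "\<And>w w'. w \<in> carrier_vec (n_pts P) \<Longrightarrow> w' \<in> carrier_vec (n_pts P) \<Longrightarrow>
        spec_norm (hess P w - hess P w') \<le> M * vnorm (w - w')"
    and min: "is_arg_min (objective P) (\<lambda>w. w \<in> carrier_vec (n_pts P)) wstar"
    and \<epsilon>: "0 < \<epsilon>" "\<epsilon> < 1" and \<rho>: "0 < \<rho>" "\<rho> < 1"
    and w0: "w0 \<in> carrier_vec (n_pts P)"
    and init: "vnorm (w0 - wstar) \<le> (\<rho> - nu_seq \<epsilon> \<rho> 0) / eta_seq M \<gamma> \<epsilon> \<rho> 0"
    and close: "\<And>t w v. t < t0 \<Longrightarrow> w \<in> carrier_vec (n_pts P) \<Longrightarrow> v \<in> carrier_vec (n_pts P) \<Longrightarrow>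
      vnorm ((hess_hat P m s t w - hess P w) *\<^sub>v v) \<le> eps_seq \<epsilon> \<rho> t * \<gamma> * vnorm v"
    and t: "t \<in> {1..t0}"
  shows "vnorm (rfn P m (\<lambda>_. 1) w0 s t - wstar) \<le> \<rho> ^ t * vnorm (rfn P m (\<lambda>_. 1) w0 s (t - 1) - wstar)"
proof -
  define n where "n = n_pts P"
  define w where "w t = rfn P m (\<lambda>_. 1) w0 s t" for t
  define e where "e t = vnorm (w t - wstar)" for t
  have ws: "wstar \<in> carrier_vec n" using min by (simp add: is_arg_min_def n_def)
  have w: "w t \<in> carrier_vec n" if "t \<le> t0" for t
    using measurable_vec_carrierD[OF measurable_rfn[OF valid diff w0 that]] by (simp add: w_def n_def)
  have Hc: "hess P u \<in> carrier_mat n n" for u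
    unfolding hess_def n_def by (rule hess_with_carrier[OF valid gram_carrier])
  have Hhc: "hess_hat P m s t u \<in> carrier_mat n n" for t u
    unfolding hess_hat_def n_def by (rule hess_with_carrier[OF valid gram_hat_carrier])
  have step: "e (Suc t) \<le> (eps_seq \<epsilon> \<rho> t * \<gamma> * e t + M / 2 * (e t)\<^sup>2) / ((1 - eps_seq \<epsilon> \<rho> t) * \<gamma>)"
    if t: "t < t0" for t
  proof -
    have wt: "w t \<in> carrier_vec n" using t by (intro w) simp
    define g where "g = objective_grad P (w t)"
    define x where "x = mat_inv (hess_hat P m s t (w t)) *\<^sub>v g"
    have g: "g \<in> carrier_vec n" by (simp add: g_def n_def)
    have rem: "vnorm (hess P (w t) *\<^sub>v (w t - wstar) - g) \<le> M / 2 * (e t)\<^sup>2"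
      unfolding g_def e_def
      by (rule hess_remainder_le[OF valid]) (use wt ws lip objective_grad_argmin[OF valid min] in \<open>auto simp: n_def\<close>)
    have "eps_seq \<epsilon> \<rho> t \<le> \<epsilon>"
      using \<epsilon> \<rho> by (auto simp: eps_seq_def mult_left_le_one_le power_le_one)
    then have "eps_seq \<epsilon> \<rho> t < 1" using \<epsilon> by simp
    then have "vnorm ((w t - wstar) - x) \<le> (eps_seq \<epsilon> \<rho> t * \<gamma> * vnorm (w t - wstar) + M / 2 * (e t)\<^sup>2)
        / ((1 - eps_seq \<epsilon> \<rho> t) * \<gamma>)"
      unfolding x_def using coer[OF wt[unfolded n_def]] close[OF t wt[unfolded n_def]] wt ws \<gamma>
      by (intro newton_step_le[OF Hc Hhc g _ _ _ rem]) (auto simp: n_def)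
    moreover have "w (Suc t) - wstar = (w t - wstar) - x"
    proof -
      have "gradient n (objective P) (w t) = g"
        using gradient_objective[OF valid diff] wt by (simp add: g_def n_def)
      then have "w (Suc t) = w t - x" by (simp add: w_def x_def n_def)
      moreover have "x \<in> carrier_vec n"
        unfolding x_def by (rule mult_mat_vec_carrier[OF mat_inv_carrier[OF Hhc] g])
      ultimately show ?thesis using wt ws by (intro eq_vecI) auto
    qed
    ultimately show ?thesis by (simp add: e_def)
  qed
  have "Suc (t - 1) = t" using t by simp
  moreover have "e (Suc (t - 1)) \<le> \<rho> ^ Suc (t - 1) * e (t - 1)"
    by (rule error_recursion[OF step _ M \<gamma> \<epsilon> \<rho>]) (use init t in \<open>auto simp: e_def w_def\<close>)
  ultimately show ?thesis unfolding e_def w_def by (simp only:)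
qed

text \<open>Each iteration has a bad event of probability at most \<delta>; outside all of them
  every approximate Hessian is close to the true one at once, and the deterministic convergence
  result applies. The constant is chosen before the problem, hence uniformly in dimensions, loss and
  feature law.\<close>

theorem theorem6:
  fixes \<delta>\<^sub>0 R :: real
  assumes "0 < \<delta>\<^sub>0" "\<delta>\<^sub>0 < 1"
  shows "\<exists>C>0. \<forall>(P :: kernel_problem) (\<gamma> :: real) (L :: real) (lam1 :: real) (M :: real)
            (wstar :: real vec) (w0 :: real vec) (\<delta> :: real) (\<epsilon> :: real) (\<rho> :: real)
            (t0 :: nat) (m :: nat \<Rightarrow> nat).
     valid_problem P \<and>
     twice_differentiable (n_pts P) (objective P) \<and>
     strongly_convex (n_pts P) \<gamma> (objective P) \<and>
     smooth (n_pts P) L (objective P) \<and>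
     (\<forall>w\<in>carrier_vec (n_pts P).
        loewner_le (n_pts P) (\<gamma> \<cdot>\<^sub>m 1\<^sub>m (n_pts P)) (hess P w) \<and>
        loewner_le (n_pts P) (hess P w) (L \<cdot>\<^sub>m 1\<^sub>m (n_pts P))) \<and>
     (\<forall>w\<in>carrier_vec (n_pts P). spec_norm (loss_diag P w) \<le> lam1) \<and>
     M > 0 \<and>
     (\<forall>w\<in>carrier_vec (n_pts P). \<forall>w'\<in>carrier_vec (n_pts P).
        spec_norm (hess P w - hess P w') \<le> M * vnorm (w - w')) \<and>
     is_arg_min (objective P) (\<lambda>w. w \<in> carrier_vec (n_pts P)) wstar \<and>
     0 < \<delta> \<and> \<delta> < 1 \<and> \<delta> \<le> \<delta>\<^sub>0 \<and>
     \<epsilon> * ridge P \<le> R * spec_norm (gram1 P) \<and>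
     0 < \<epsilon> / (1 - \<epsilon>) \<and> \<epsilon> / (1 - \<epsilon>) < 1 \<and>
     \<epsilon> / (1 - \<epsilon>) < \<rho> \<and> \<rho> < 1 \<and>
     w0 \<in> carrier_vec (n_pts P) \<and>
     vnorm (w0 - wstar) \<le> (\<rho> - nu_seq \<epsilon> \<rho> 0) / eta_seq M \<gamma> \<epsilon> \<rho> 0 \<and>
     (\<forall>t<t0. AE s in samples P t0 m.
        real (m t) \<ge> C * sample_rate P lam1 \<gamma> \<epsilon> \<rho> \<delta> m s t)
     \<longrightarrow>
     measure (samples P t0 m)
       {s \<in> space (samples P t0 m). \<forall>t\<in>{1..t0}.
          vnorm (rfn P m (\<lambda>_. 1) w0 s t - wstar)
            \<le> \<rho> ^ t * vnorm (rfn P m (\<lambda>_. 1) w0 s (t - 1) - wstar)}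
       \<ge> 1 - real t0 * \<delta>"
proof -
  \<comment> \<open>The constant of \<open>hess_hat_concentration\<close>, where
    \<open>1 + \<bar>R\<bar>\<close> is the ratio \<open>B\<close> allowed between radius and
    \<kappa>. The absolute value keeps it positive for every \<open>R\<close>.\<close>
  define C where "C = 32 * (1 + 1 / ln (1 / \<delta>\<^sub>0)) * (1 + \<bar>R\<bar>)\<^sup>2"
  have "0 < ln (1 / \<delta>\<^sub>0)" using assms by (intro ln_gt_zero) auto
  then have "0 < C" by (simp add: C_def add_pos_pos)
  show ?thesis
  proof (intro exI[of _ C] conjI allI impI, fact \<open>0 < C\<close>, elim conjE)
    fix P :: kernel_problem and \<gamma> L lam1 M :: real and wstar w0 :: "real vec" and \<delta> \<epsilon> \<rho> :: real
      and t0 :: nat and m :: "nat \<Rightarrow> nat"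
    let ?n = "n_pts P" and ?S = "samples P t0 m"
    assume valid: "valid_problem P" and diff: "twice_differentiable ?n (objective P)"
      and sc: "strongly_convex ?n \<gamma> (objective P)"
      and hess: "\<forall>w\<in>carrier_vec ?n. loewner_le ?n (\<gamma> \<cdot>\<^sub>m 1\<^sub>m ?n) (hess P w) \<and>
        loewner_le ?n (hess P w) (L \<cdot>\<^sub>m 1\<^sub>m ?n)"
      and lam: "\<forall>w\<in>carrier_vec ?n. spec_norm (loss_diag P w) \<le> lam1" and M: "M > 0"
      and lip: "\<forall>w\<in>carrier_vec ?n. \<forall>w'\<in>carrier_vec ?n. spec_norm (hess P w - hess P w') \<le> M * vnorm (w - w')"
      and min: "is_arg_min (objective P) (\<lambda>w. w \<in> carrier_vec ?n) wstar"
      and \<delta>: "0 < \<delta>" "\<delta> \<le> \<delta>\<^sub>0" and R: "\<epsilon> * ridge P \<le> R * spec_norm (gram1 P)"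
      and \<nu>: "0 < \<epsilon> / (1 - \<epsilon>)" "\<epsilon> / (1 - \<epsilon>) < \<rho>" and \<rho>: "\<rho> < 1" and w0: "w0 \<in> carrier_vec ?n"
      and init: "vnorm (w0 - wstar) \<le> (\<rho> - nu_seq \<epsilon> \<rho> 0) / eta_seq M \<gamma> \<epsilon> \<rho> 0"
      and rate: "\<forall>t<t0. AE s in ?S. real (m t) \<ge> C * sample_rate P lam1 \<gamma> \<epsilon> \<rho> \<delta> m s t"
    interpret F: bounded_features "feature_law P" ?n "\<lambda>i. feat P (pt P i)"
      using valid by (rule bounded_features_problem)
    interpret S: prob_space ?S
      unfolding samples_def using F.prob_space_axioms by (intro prob_space_PiM)
    have \<gamma>: "0 < \<gamma>" using sc by (simp add: strongly_convex_def)
    have \<epsilon>: "0 < \<epsilon>" "\<epsilon> < 1" using \<nu>(1) by (auto simp: zero_less_divide_iff)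
    have \<rho>0: "0 < \<rho>" using \<nu> by linarith
    have coer: "\<gamma> * (v \<bullet> v) \<le> v \<bullet> (hess P w *\<^sub>v v)"
      if w: "w \<in> carrier_vec ?n" and v: "v \<in> carrier_vec ?n" for w v
    proof -
      have H: "hess P w \<in> carrier_mat ?n ?n" and le: "0 \<le> v \<bullet> ((hess P w - \<gamma> \<cdot>\<^sub>m 1\<^sub>m ?n) *\<^sub>v v)"
        using hess w v by (auto simp: loewner_le_def psd_def)
      have "(hess P w - \<gamma> \<cdot>\<^sub>m 1\<^sub>m ?n) *\<^sub>v v = hess P w *\<^sub>v v - \<gamma> \<cdot>\<^sub>v v"
        using H v by (simp add: minus_mult_distrib_mat_vec[of _ ?n ?n] smult_mat_mult_vec[of _ ?n ?n])
      then show ?thesis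
        using le v mult_mat_vec_carrier[OF H v] by (simp add: scalar_prod_minus_distrib[of _ ?n])
    qed
    define close where "close s t \<longleftrightarrow> (\<forall>w\<in>carrier_vec ?n. \<forall>v\<in>carrier_vec ?n.
        vnorm ((hess_hat P m s t w - hess P w) *\<^sub>v v) \<le> eps_seq \<epsilon> \<rho> t * \<gamma> * vnorm v)" for s t
    have "\<forall>t\<in>{..<t0}. \<exists>E. E \<in> sets ?S \<and> measure ?S E \<le> \<delta> \<and> (AE s in ?S. s \<notin> E \<longrightarrow> close s t)"
    proof
      fix t assume "t \<in> {..<t0}"
      then have t: "t < t0" by simp
      show "\<exists>E. E \<in> sets ?S \<and> measure ?S E \<le> \<delta> \<and> (AE s in ?S. s \<notin> E \<longrightarrow> close s t)"
        using hess_hat_concentration[OF valid \<gamma> coer lam[rule_format] \<delta> assms(2) R \<epsilon> \<rho>0 \<rho> t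
            rate[rule_format, OF t, unfolded C_def]]
        unfolding close_def Bex_def .
    qed
    then obtain E where E: "\<And>t. t < t0 \<Longrightarrow> E t \<in> sets ?S" "\<And>t. t < t0 \<Longrightarrow> measure ?S (E t) \<le> \<delta>"
      "\<And>t. t < t0 \<Longrightarrow> AE s in ?S. s \<notin> E t \<longrightarrow> close s t"
      by (auto dest!: bchoice)
    let ?w = "rfn P m (\<lambda>_. 1) w0"
    define G where "G = {s \<in> space ?S. \<forall>t\<in>{1..t0}.
        vnorm (?w s t - wstar) \<le> \<rho> ^ t * vnorm (?w s (t - 1) - wstar)}"
    have wstar: "wstar \<in> carrier_vec ?n" using min by (simp add: is_arg_min_def)
    have [measurable]: "(\<lambda>s. vnorm (?w s t - wstar)) \<in> borel_measurable ?S" if "t \<le> t0" for t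
      using measurable_rfn[OF valid diff w0 that] wstar
      by (intro measurable_vnorm[of _ ?n] measurable_vec_diff measurable_vec_const)
    have G: "G \<in> sets ?S"
      unfolding G_def by (intro sets.sets_Collect_finite_All borel_measurable_le) auto
    have "AE s in ?S. \<forall>t\<in>{..<t0}. s \<notin> E t \<longrightarrow> close s t"
      using E(3) by (intro AE_finite_allI) auto
    \<comment> \<open>Failure is contained in the union of the bad events only up to a null set,
      since the rate condition is itself only almost sure.\<close>
    then have "AE s in ?S. s \<in> space ?S - G \<longrightarrow> s \<in> (\<Union>t\<in>{..<t0}. E t)"
      using AE_space
    proof eventually_elim
      fix s assume s: "\<forall>t\<in>{..<t0}. s \<notin> E t \<longrightarrow> close s t" "s \<in> space ?S"
      show "s \<in> space ?S - G \<longrightarrow> s \<in> (\<Union>t\<in>{..<t0}. E t)"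
      proof (rule impI, rule ccontr)
        assume "s \<in> space ?S - G" "s \<notin> (\<Union>t\<in>{..<t0}. E t)"
        then have "close s t" if "t < t0" for t using s that by auto
        then have "vnorm (?w s t - wstar) \<le> \<rho> ^ t * vnorm (?w s (t - 1) - wstar)" if "t \<in> {1..t0}" for t
          using rfn_converges[OF valid diff \<gamma> coer M _ min \<epsilon> \<rho>0 \<rho> w0 init _ that] lip
          unfolding close_def by blast
        then have "s \<in> G" using s by (simp add: G_def)
        then show False using \<open>s \<in> space ?S - G\<close> by blast
      qed
    qed
    then have "measure ?S (space ?S - G) \<le> measure ?S (\<Union>t\<in>{..<t0}. E t)"
      using E(1) by (intro S.finite_measure_mono_AE) auto
    also have "\<dots> \<le> (\<Sum>t<t0. measure ?S (E t))"
      using E(1) by (intro S.finite_measure_subadditive_finite) auto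
    also have "\<dots> \<le> (\<Sum>t<t0. \<delta>)" using E(2) by (intro sum_mono) auto
    finally have "1 - real t0 * \<delta> \<le> measure ?S G" using S.prob_compl[OF G] by simp
    then show "measure ?S {s \<in> space ?S. \<forall>t\<in>{1..t0}.
          vnorm (?w s t - wstar) \<le> \<rho> ^ t * vnorm (?w s (t - 1) - wstar)} \<ge> 1 - real t0 * \<delta>"
      unfolding G_def .
  qed
qed

end
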